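(* Let $A$, $G$, $\alpha$, $u$, $\phi$ be as in the context. When $\phi$ is an antisymmetric tricharacter, the twisted crossed product $A\rtimes_{\alpha,u}G$ satisfies the $*$-algebra identity $(f*g)^*=g^* * f^*$, and is associative if and only if $\phi\equiv 1$. In fact, $$((f*g)*h)(x)=\int_{G\times G} f(z)\,\alpha_z[g(z^{-1}y)]\,\alpha_y[h(y^{-1}x)]\,u(z,z^{-1}y)\,u(y,y^{-1}x)\,dy\,dz,$$ $$(f*(g*h))(x)=\int_{G\times G} f(z)\,\alpha_z[g(z^{-1}y)]\,\alpha_y[h(y^{-1}x)]\,\phi(z,z^{-1}y,y^{-1}x)\,u(z,z^{-1}y)\,u(y,y^{-1}x)\,dy\,dz.$$
   Context: $G$ is a unimodular separable locally compact group with Haar measure $dy$, and $A$ is a $C^*$-algebra. There are automorphisms $\alpha_x$ of $A$ ($x\in G$) and unitaries $u(x,y)$ (in $A$ or its multiplier algebra), measurable in $(x,y)\in G\times G$, with $u(x,y)=1$ whenever $x$ or $y$ is the identity, such that $\alpha_x\alpha_y=\mathrm{ad}(u(x,y))\alpha_{xy}$, where $\mathrm{ad}(w)[a]=waw^{-1}$. Consequently there are central unitary elements $\phi(x,y,z)$ with $$\phi(x,y,z)\,u(x,y)\,u(xy,z)=\alpha_x[u(y,z)]\,u(x,yz)\qquad(x,y,z\in G).$$ An antisymmetric tricharacter is a function $\phi:G\times G\times G\to\mathbb T$ (the unit circle) that is a character in each variable, is unchanged by even permutations of its variables and is inverted by odd permutations. The twisted crossed product $A\rtimes_{\alpha,u}G$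 is the algebra obtained by completing $C_0(G,A)$ with the twisted convolution product and adjoint $$(f*g)(x)=\int_G f(y)\,\alpha_y[g(y^{-1}x)]\,u(y,y^{-1}x)\,dy,\qquad f^*(x)=u(x,x^{-1})^{-1}\,\alpha_x[f(x^{-1})]^*.$$
   Formalization: The *-identity is proved when φ(x,x,y)=1 for all x,y (it can fail otherwise, e.g. for G=Z/2); in the integral formulas u(z,z⁻¹y) stands before α_y[h(y⁻¹x)], the printed order being proved only for central u; α is taken measurable and the completion is in the L¹-norm. *)

theory Defs
  imports "HOL-Analysis.Analysis"
begin

section \<open>\<open>C\<^sup>*\<close>-algebras, multipliers and automorphisms\<close>

text \<open>A \<open>C\<^sup>*\<close>-algebra need not have a unit, hence the use of \<^class>\<open>real_normed_algebra\<close>.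
  The zero algebra is allowed.\<close>

class cstar_algebra = real_normed_algebra + banach +
  fixes scaleC :: "complex \<Rightarrow> 'a \<Rightarrow> 'a"  (infixr \<open>*\<^sub>C\<close> 75)
    and star :: "'a \<Rightarrow> 'a"
  assumes scaleC_add_right: "c *\<^sub>C (a + b) = c *\<^sub>C a + c *\<^sub>C b"
    and scaleC_add_left: "(c + d) *\<^sub>C a = c *\<^sub>C a + d *\<^sub>C a"
    and scaleC_scaleC: "c *\<^sub>C (d *\<^sub>C a) = (c * d) *\<^sub>C a"
    and scaleC_of_real: "complex_of_real r *\<^sub>C a = r *\<^sub>R a"
    and norm_scaleC: "norm (c *\<^sub>C a) = cmod c * norm a"
    and scaleC_mult_left: "(c *\<^sub>C a) * b = c *\<^sub>C (a * b)"
    and scaleC_mult_right: "a * (c *\<^sub>C b) = c *\<^sub>C (a * b)"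
    and star_star: "star (star a) = a"
    and star_add: "star (a + b) = star a + star b"
    and star_scaleC: "star (c *\<^sub>C a) = cnj c *\<^sub>C star a"
    and star_mult: "star (a * b) = star b * star a"
    and cstar_identity: "norm (star a * a) = (norm a)\<^sup>2"

text \<open>The multiplier algebra \<open>M(A)\<close> consists of the double centralizers \<open>(L, R)\<close> of \<open>A\<close>;
  a multiplier \<open>m = (L, R)\<close> acts on \<open>A\<close> by \<open>m a = L a\<close> and \<open>a m = R a\<close>.\<close>

type_synonym 'a multiplier = "('a \<Rightarrow> 'a) \<times> ('a \<Rightarrow> 'a)"

definition multipliers :: "'a::cstar_algebra multiplier set" where
  "multipliers = {(L, R).
     bounded_linear L \<and> bounded_linear R \<and>
     (\<forall>c a. L (c *\<^sub>C a) = c *\<^sub>C L a \<and> R (c *\<^sub>C a) = c *\<^sub>C R a) \<and>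
     (\<forall>a b. L (a * b) = L a * b \<and> R (a * b) = a * R b \<and> a * L b = R a * b)}"

definition lmul :: "'a multiplier \<Rightarrow> 'a \<Rightarrow> 'a"  (infixr \<open>\<rhd>\<close> 70) where
  "m \<rhd> a = fst m a"

definition rmul :: "'a \<Rightarrow> 'a multiplier \<Rightarrow> 'a"  (infixl \<open>\<lhd>\<close> 70) where
  "a \<lhd> m = snd m a"

definition mone :: "'a multiplier" where
  "mone = (\<lambda>a. a, \<lambda>a. a)"

definition mtimes :: "'a multiplier \<Rightarrow> 'a multiplier \<Rightarrow> 'a multiplier"  (infixl \<open>\<odot>\<close> 75) where
  "m \<odot> n = (\<lambda>a. m \<rhd> (n \<rhd> a), \<lambda>a. (a \<lhd> m) \<lhd> n)"

definition mstar :: "'a::cstar_algebra multiplier \<Rightarrow> 'a multiplier" where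
  "mstar m = (\<lambda>a. star (star a \<lhd> m), \<lambda>a. star (m \<rhd> star a))"

definition mscalar :: "complex \<Rightarrow> 'a::cstar_algebra multiplier" where
  "mscalar c = (\<lambda>a. c *\<^sub>C a, \<lambda>a. c *\<^sub>C a)"

definition unitary_multiplier :: "'a::cstar_algebra multiplier \<Rightarrow> bool" where
  "unitary_multiplier w \<longleftrightarrow>
     w \<in> multipliers \<and> mstar w \<odot> w = mone \<and> w \<odot> mstar w = mone"

definition central_multiplier :: "'a::cstar_algebra multiplier \<Rightarrow> bool" where
  "central_multiplier m \<longleftrightarrow> m \<in> multipliers \<and> (\<forall>n\<in>multipliers. m \<odot> n = n \<odot> m)"

text \<open>The inverse of a unitary \<open>w\<close> is \<^term>\<open>mstar w\<close>, so this is \<open>w a w\<^sup>-\<^sup>1\<close>.\<close>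

definition mad :: "'a::cstar_algebra multiplier \<Rightarrow> 'a \<Rightarrow> 'a" where
  "mad w a = w \<rhd> (a \<lhd> mstar w)"

definition star_automorphism :: "('a::cstar_algebra \<Rightarrow> 'a) \<Rightarrow> bool" where
  "star_automorphism \<theta> \<longleftrightarrow> bij \<theta> \<and>
     (\<forall>a b. \<theta> (a + b) = \<theta> a + \<theta> b) \<and> (\<forall>c a. \<theta> (c *\<^sub>C a) = c *\<^sub>C \<theta> a) \<and>
     (\<forall>a b. \<theta> (a * b) = \<theta> a * \<theta> b) \<and> (\<forall>a. \<theta> (star a) = star (\<theta> a))"

text \<open>The unique extension of an automorphism of \<open>A\<close> to \<open>M(A)\<close>, characterised by
  \<open>\<theta>[m] \<theta>[a] = \<theta>[m a]\<close> and \<open>\<theta>[a] \<theta>[m] = \<theta>[a m]\<close>.\<close>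

definition mlift :: "('a \<Rightarrow> 'a) \<Rightarrow> 'a multiplier \<Rightarrow> 'a multiplier" where
  "mlift \<theta> m = (\<lambda>a. \<theta> (m \<rhd> inv \<theta> a), \<lambda>a. \<theta> (inv \<theta> a \<lhd> m))"


section \<open>Integration of functions with values in a Banach space\<close>

text \<open>The library's Bochner integral \<^const>\<open>has_bochner_integral\<close> is only available for separable
  Banach spaces, whereas \<open>A\<close> need not be separable.  The definitions below are the same, with
  Borel measurability replaced by strong measurability.\<close>

definition strongly_measurable :: "'b measure \<Rightarrow> ('b \<Rightarrow> 'a::real_normed_vector) \<Rightarrow> bool" where
  "strongly_measurable M f \<longleftrightarrow>
     (\<exists>s. (\<forall>i. simple_function M (s i)) \<and> (\<forall>x\<in>space M. (\<lambda>i. s i x) \<longlonglongrightarrow> f x))"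

definition has_strong_integral ::
    "'b measure \<Rightarrow> ('b \<Rightarrow> 'a::real_normed_vector) \<Rightarrow> 'a \<Rightarrow> bool" where
  "has_strong_integral M f I \<longleftrightarrow> strongly_measurable M f \<and>
     (\<exists>s. (\<forall>i. Bochner_Integration.simple_bochner_integrable M (s i)) \<and>
          (\<lambda>i. \<integral>\<^sup>+x. ennreal (norm (f x - s i x)) \<partial>M) \<longlonglongrightarrow> 0 \<and>
          (\<lambda>i. Bochner_Integration.simple_bochner_integral M (s i)) \<longlonglongrightarrow> I)"

definition strong_integral :: "'b measure \<Rightarrow> ('b \<Rightarrow> 'a::real_normed_vector) \<Rightarrow> 'a" where
  "strong_integral M f =
     (if \<exists>I. has_strong_integral M f I then THE I. has_strong_integral M f I else 0)"


section \<open>Groups, Haar measure and tricharacters\<close>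

text \<open>Groups are written additively because the library's topological groups are; no
  commutativity is assumed in \<^class>\<open>topological_group_add\<close>.  A locally compact group is Hausdorff,
  and is called separable if it is second countable; a Haar measure on such a group is
  automatically regular.\<close>

definition haar_measure :: "'g::topological_group_add measure \<Rightarrow> bool" where
  "haar_measure M \<longleftrightarrow> sets M = sets borel \<and>
     (\<forall>K. compact K \<longrightarrow> emeasure M K < \<infinity>) \<and>
     (\<forall>U. open U \<and> U \<noteq> {} \<longrightarrow> emeasure M U > 0) \<and>
     (\<forall>x. \<forall>E\<in>sets M. emeasure M ((\<lambda>y. x + y) ` E) = emeasure M E)"

definition right_invariant :: "'g::topological_group_add measure \<Rightarrow> bool" where
  "right_invariant M \<longleftrightarrow>
     (\<forall>x. \<forall>E\<in>sets M. emeasure M ((\<lambda>y. y + x) ` E) = emeasure M E)"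

definition group_character :: "('g::topological_group_add \<Rightarrow> complex) \<Rightarrow> bool" where
  "group_character c \<longleftrightarrow> continuous_on UNIV c \<and> (\<forall>x. cmod (c x) = 1) \<and>
     (\<forall>x y. c (x + y) = c x * c y)"

text \<open>Antisymmetry gives \<open>(\<omega> x x y)\<^sup>2 = 1\<close>, but not \<open>\<omega> x x y = 1\<close>: on the group with two
  elements, \<open>\<omega> x y z = (-1)\<^bsup>xyz\<^esup>\<close> is an antisymmetric tricharacter.\<close>

definition antisymmetric_tricharacter ::
    "('g::topological_group_add \<Rightarrow> 'g \<Rightarrow> 'g \<Rightarrow> complex) \<Rightarrow> bool" where
  "antisymmetric_tricharacter \<omega> \<longleftrightarrow>
     (\<forall>y z. group_character (\<lambda>x. \<omega> x y z)) \<and>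
     (\<forall>x z. group_character (\<lambda>y. \<omega> x y z)) \<and>
     (\<forall>x y. group_character (\<lambda>z. \<omega> x y z)) \<and>
     (\<forall>x y z. \<omega> y z x = \<omega> x y z \<and> \<omega> z x y = \<omega> x y z) \<and>
     (\<forall>x y z. \<omega> y x z = inverse (\<omega> x y z) \<and> \<omega> x z y = inverse (\<omega> x y z) \<and>
               \<omega> z y x = inverse (\<omega> x y z))"


section \<open>Twisted crossed products\<close>

text \<open>Measurability is strong (in the sense of Bochner) and pointwise on \<open>A\<close>.  For \<open>u\<close>, which has
  values in \<open>M(A)\<close>, this is measurability for the strict topology.\<close>

definition twisted_action ::
    "('g::{topological_group_add,second_countable_topology} \<Rightarrow> 'a::cstar_algebra \<Rightarrow> 'a) \<Rightarrow>
     ('g \<Rightarrow> 'g \<Rightarrow> 'a multiplier) \<Rightarrow> bool" where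
  "twisted_action \<alpha> u \<longleftrightarrow>
     (\<forall>x. star_automorphism (\<alpha> x)) \<and>
     (\<forall>x y. unitary_multiplier (u x y)) \<and>
     (\<forall>x. u x 0 = mone \<and> u 0 x = mone) \<and>
     (\<forall>x y a. \<alpha> x (\<alpha> y a) = mad (u x y) (\<alpha> (x + y) a)) \<and>
     (\<forall>a. strongly_measurable borel (\<lambda>x. \<alpha> x a)) \<and>
     (\<forall>a. strongly_measurable borel (\<lambda>(x, y). u x y \<rhd> a)) \<and>
     (\<forall>a. strongly_measurable borel (\<lambda>(x, y). a \<lhd> u x y))"

definition associator_of ::
    "('g::group_add \<Rightarrow> 'a::cstar_algebra \<Rightarrow> 'a) \<Rightarrow> ('g \<Rightarrow> 'g \<Rightarrow> 'a multiplier) \<Rightarrow>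
     ('g \<Rightarrow> 'g \<Rightarrow> 'g \<Rightarrow> 'a multiplier) \<Rightarrow> bool" where
  "associator_of \<alpha> u \<phi> \<longleftrightarrow>
     (\<forall>x y z. unitary_multiplier (\<phi> x y z) \<and> central_multiplier (\<phi> x y z) \<and>
        \<phi> x y z \<odot> u x y \<odot> u (x + y) z = mlift (\<alpha> x) (u y z) \<odot> u x (y + z))"

definition twisted_conv ::
    "'g::group_add measure \<Rightarrow> ('g \<Rightarrow> 'a::cstar_algebra \<Rightarrow> 'a) \<Rightarrow> ('g \<Rightarrow> 'g \<Rightarrow> 'a multiplier) \<Rightarrow>
     ('g \<Rightarrow> 'a) \<Rightarrow> ('g \<Rightarrow> 'a) \<Rightarrow> 'g \<Rightarrow> 'a" where
  "twisted_conv M \<alpha> u f g x =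
     strong_integral M (\<lambda>y. (f y * \<alpha> y (g (- y + x))) \<lhd> u y (- y + x))"

definition twisted_adj ::
    "('g::group_add \<Rightarrow> 'a::cstar_algebra \<Rightarrow> 'a) \<Rightarrow> ('g \<Rightarrow> 'g \<Rightarrow> 'a multiplier) \<Rightarrow>
     ('g \<Rightarrow> 'a) \<Rightarrow> 'g \<Rightarrow> 'a" where
  "twisted_adj \<alpha> u f x = mstar (u x (- x)) \<rhd> star (\<alpha> x (f (- x)))"

definition cc_functions :: "('g::topological_space \<Rightarrow> 'a::real_normed_vector) set" where
  "cc_functions = {f. continuous_on UNIV f \<and> compact (closure {x. f x \<noteq> 0})}"

text \<open>The completion, for the \<open>L\<^sup>1\<close>-norm, of the space of continuous functions of compact support.
  Its elements are represented by functions, two of which represent the same element iff they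
  agree almost everywhere.  Since \<open>u\<close> is only measurable, the continuous functions
  themselves are not closed under the operations \<^const>\<open>twisted_conv\<close> and \<^const>\<open>twisted_adj\<close>.\<close>

definition crossed_product ::
    "'g::topological_space measure \<Rightarrow> ('g \<Rightarrow> 'a::real_normed_vector) set" where
  "crossed_product M = {f. strongly_measurable M f \<and>
     (\<exists>s. (\<forall>i. s i \<in> cc_functions) \<and>
          (\<lambda>i. \<integral>\<^sup>+x. ennreal (norm (f x - s i x)) \<partial>M) \<longlonglongrightarrow> 0)}"

end

theory Submission
  imports Defs
begin

text \<open>In the coordinates \<open>p = z\<close>, \<open>q = z\<^sup>-\<^sup>1 y\<close>, \<open>r = y\<^sup>-\<^sup>1 x\<close> the integrands of both triple products
  have norm at most \<open>\<parallel>f p\<parallel> \<parallel>g q\<parallel> \<parallel>h r\<parallel>\<close>, because automorphisms and unitary multipliers are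
  isometric, and the cocycle identity says that they differ by the factor \<open>\<omega> p q r\<close>.  Fubini's
  theorem therefore gives the two formulas.  If the product is associative, integrating the
  difference of the two integrands over measurable boxes shows that it vanishes almost everywhere;
  for suitable \<open>f\<close>, \<open>g\<close>, \<open>h\<close> the integrand itself is nonzero, so \<open>\<omega> = 1\<close> almost everywhere, and then
  everywhere because \<open>\<omega>\<close> is continuous in each variable and nonempty open sets have positive
  measure.\<close>

text \<open>\<open>A\<close> need not be separable, so Borel measurability alone does not carry an
  integral; strong measurability, recast as Borel measurability with separable range, does, and
  Fubini's theorem is rebuilt on it. Every estimate is one of norms, so automorphisms, which are not
  assumed continuous, must first be shown isometric, and without a unit from which to form the
  square root of \<open>1 - a\<^sup>2\<close>. Since \<open>u\<close> is merely measurable, closure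
  of the completion under the operations rests on identifying it with the space of all strongly
  integrable functions. The integrals converge only for almost every \<open>x\<close>, and an inner
  convolution may diverge exactly where the outer factor vanishes, which has to be treated
  separately. Right invariance of \<open>M\<close> enters through invariance under inversion, on
  which the adjoint depends. The involution identity is of a different nature from associativity: it
  rests on \<open>\<omega> s s t = 1\<close>, which antisymmetry gives only up to sign.\<close>

abbreviation enorm :: "'a::real_normed_vector \<Rightarrow> ennreal" where
  "enorm a \<equiv> ennreal (norm a)"

abbreviation L1_norm :: "'b measure \<Rightarrow> ('b \<Rightarrow> 'a::real_normed_vector) \<Rightarrow> ennreal" where
  "L1_norm M f \<equiv> (\<integral>\<^sup>+x. enorm (f x) \<partial>M)"

abbreviation L1_dist :: "'b measure \<Rightarrow> ('b \<Rightarrow> 'a::real_normed_vector) \<Rightarrow> ('b \<Rightarrow> 'a) \<Rightarrow> ennreal" where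
  "L1_dist M f g \<equiv> (\<integral>\<^sup>+x. enorm (f x - g x) \<partial>M)"

section \<open>Isometric automorphisms and unitary multipliers\<close>

lemma scaleC_one [simp]: "1 *\<^sub>C (a::'a::cstar_algebra) = a"
  using scaleC_of_real[of 1 a] by simp

lemma scaleC_zero_left [simp]: "0 *\<^sub>C (a::'a::cstar_algebra) = 0"
  using scaleC_of_real[of 0 a] by simp

lemma scaleC_zero_right [simp]: "c *\<^sub>C (0::'a::cstar_algebra) = 0"
  using scaleC_add_right[of c 0 "0::'a"] by simp

lemma scaleC_minus_right: "c *\<^sub>C (- a::'a::cstar_algebra) = - (c *\<^sub>C a)"
  using scaleC_add_right[of c a "- a"] by (simp add: eq_neg_iff_add_eq_0 add.commute)

lemma scaleC_diff_right: "c *\<^sub>C (a - b::'a::cstar_algebra) = c *\<^sub>C a - c *\<^sub>C b"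
  using scaleC_add_right[of c a "- b"] by (simp add: scaleC_minus_right)

lemma scaleC_diff_left: "(c - d) *\<^sub>C (a::'a::cstar_algebra) = c *\<^sub>C a - d *\<^sub>C a"
  using scaleC_add_left[of "c - d" d a] by (simp add: algebra_simps)

lemma scaleC_scaleR: "c *\<^sub>C (r *\<^sub>R a) = r *\<^sub>R (c *\<^sub>C (a::'a::cstar_algebra))"
  by (simp add: scaleC_of_real[symmetric] scaleC_scaleC mult.commute)

lemma star_zero [simp]: "star (0::'a::cstar_algebra) = 0"
  using star_add[of 0 "0::'a"] by simp

lemma star_minus: "star (- a::'a::cstar_algebra) = - star a"
  using star_add[of a "- a"] by (simp add: eq_neg_iff_add_eq_0 add.commute)

lemma star_diff: "star (a - b::'a::cstar_algebra) = star a - star b"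
  using star_add[of a "- b"] by (simp add: star_minus)

lemma star_scaleR: "star (r *\<^sub>R a) = r *\<^sub>R star (a::'a::cstar_algebra)"
  using star_scaleC[of "complex_of_real r" a] by (simp add: scaleC_of_real)

lemma norm_star [simp]: "norm (star a) = norm (a::'a::cstar_algebra)"
proof -
  have *: "norm b \<le> norm (star b)" for b :: 'a
  proof (cases "b = 0")
    case False
    have "norm b * norm b \<le> norm (star b) * norm b"
      using cstar_identity[of b] norm_mult_ineq[of "star b" b] by (simp add: power2_eq_square)
    with False show ?thesis by simp
  qed simp
  from *[of a] *[of "star a"] show ?thesis by (simp add: star_star)
qed

lemma star_inject [simp]: "star a = star b \<longleftrightarrow> a = (b::'a::cstar_algebra)"
  by (metis star_star)

lemma bounded_linear_star: "bounded_linear (star :: 'a::cstar_algebra \<Rightarrow> 'a)"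
  by (rule bounded_linear_intro[where K=1]) (auto simp: star_add star_scaleR)

text \<open>In the absence of a unit the C*-identity does the cancelling: the choice
  \<open>c = star (a - b)\<close> gives \<open>star (a - b) * (a - b) = 0\<close>.\<close>

lemma eq_if_left_mult_eq:
  fixes a b :: "'a::cstar_algebra"
  assumes "\<And>c. c * a = c * b"
  shows "a = b"
proof -
  have "star (a - b) * (a - b) = 0"
    using assms[of "star (a - b)"] by (simp add: right_diff_distrib)
  then show ?thesis using cstar_identity[of "a - b"] by simp
qed

lemma eq_if_right_mult_eq:
  fixes a b :: "'a::cstar_algebra"
  assumes "\<And>c. a * c = b * c"
  shows "a = b"
proof -
  have "star a = star b"
  proof (rule eq_if_left_mult_eq)
    show "c * star a = c * star b" for c
      using arg_cong[OF assms[of "star c"], of star] by (simp add: star_mult star_star)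
  qed
  then show ?thesis by simp
qed

text \<open>The solution is \<open>d = 1 - (1 - a\<^sup>2)\<^sup>1\<^sup>/\<^sup>2\<close>, a fixed point of the contraction
  \<open>d \<mapsto> (a\<^sup>2 + d\<^sup>2) / 2\<close>; passing to \<open>1 - d\<close> would require a unit.\<close>

lemma selfadjoint_one_minus_sqrt:
  fixes a :: "'a::cstar_algebra"
  assumes sa: "star a = a" and less: "norm a < 1"
  obtains d where "star d = d" "a * d = d * a" "a * a = 2 *\<^sub>R d - d * d"
proof -
  define r where "r = norm a"
  define F where "F d = (1/2) *\<^sub>R (a * a + d * d)" for d
  \<comment> \<open>Everything demanded of \<open>d\<close> beyond the fixed point equation is a
    closed condition preserved by \<open>F\<close>, so the Banach fixed point inherits it from
    \<open>S\<close>. \<open>F\<close> keeps the ball of radius \<open>r\<close> because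
    \<open>r * r <= r\<close>, and its Lipschitz constant there is \<open>r < 1\<close>.\<close>
  define S where "S = {d. star d = d \<and> a * d = d * a \<and> norm d \<le> r}"
  have r: "0 \<le> r" "r < 1" using less by (auto simp: r_def)
  have cont: "continuous_on UNIV (star :: 'a \<Rightarrow> 'a)"
    using bounded_linear_star by (rule linear_continuous_on)
  have "closed S"
    unfolding S_def
    by (intro closed_Collect_conj closed_Collect_eq closed_Collect_le continuous_intros cont)
  then have "complete S" by (simp add: complete_eq_closed)
  moreover have "0 \<in> S" using r by (auto simp: S_def)
  moreover have "F d \<in> S" if "d \<in> S" for d
  proof -
    have d: "star d = d" "a * d = d * a" "norm d \<le> r" using that by (auto simp: S_def)
    have "norm (F d) \<le> (1/2) * (norm (a * a) + norm (d * d))"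
      unfolding F_def using norm_triangle_ineq[of "a * a" "d * d"] by simp
    also have "\<dots> \<le> (1/2) * (r * r + r * r)"
      using norm_mult_ineq[of a a] norm_mult_ineq[of d d] mult_mono[OF d(3) d(3)]
      by (simp add: r_def)
    also have "\<dots> \<le> r" using mult_left_le[of r r] r by simp
    finally have "norm (F d) \<le> r" .
    moreover have "a * F d = F d * a"
      by (simp add: F_def distrib_left distrib_right mult.assoc d(2))
        (metis d(2) mult.assoc)
    ultimately show ?thesis
      by (simp add: S_def F_def star_scaleR star_add star_mult d sa)
  qed
  moreover have "dist (F d) (F e) \<le> r * dist d e" if "d \<in> S" "e \<in> S" for d e
  proof -
    have "F d - F e = (1/2) *\<^sub>R (d * (d - e) + (d - e) * e)"
      by (simp add: F_def algebra_simps)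
    then have "norm (F d - F e) \<le> (1/2) * (norm (d * (d - e)) + norm ((d - e) * e))"
      using norm_triangle_ineq[of "d * (d - e)" "(d - e) * e"] by simp
    also have "\<dots> \<le> (1/2) * (norm d * norm (d - e) + norm (d - e) * norm e)"
      using norm_mult_ineq[of d "d - e"] norm_mult_ineq[of "d - e" e] by simp
    also have "\<dots> \<le> (1/2) * (r * norm (d - e) + norm (d - e) * r)"
      using that by (intro mult_left_mono add_mono mult_right_mono) (auto simp: S_def)
    finally show ?thesis by (simp add: dist_norm mult.commute)
  qed
  ultimately obtain d where "d \<in> S" "F d = d"
    using Banach_fix[of S r F] r by (metis empty_iff image_subsetI)
  from \<open>F d = d\<close> have "a * a + d * d = 2 *\<^sub>R d"
    by (metis F_def divideR_right zero_neq_numeral inverse_eq_divide)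
  with \<open>d \<in> S\<close> show thesis
    by (intro that[of d]) (auto simp: S_def eq_diff_eq)
qed

section \<open>Automorphisms are isometric\<close>

lemma star_automorphism_simps:
  assumes "star_automorphism \<theta>"
  shows "\<theta> (a + b) = \<theta> a + \<theta> b" "\<theta> (a - b) = \<theta> a - \<theta> b" "\<theta> 0 = 0"
    "\<theta> (c *\<^sub>C a) = c *\<^sub>C \<theta> a" "\<theta> (r *\<^sub>R a) = r *\<^sub>R \<theta> a"
    "\<theta> (a * b) = \<theta> a * \<theta> b" "\<theta> (star a) = star (\<theta> a)"
proof -
  show add: "\<theta> (a + b) = \<theta> a + \<theta> b" for a b
    using assms by (auto simp: star_automorphism_def)
  show "\<theta> (a - b) = \<theta> a - \<theta> b" using add[of "a - b" b] by (simp add: algebra_simps)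
  show "\<theta> 0 = 0" using add[of 0 0] by simp
  show C: "\<theta> (c *\<^sub>C a) = c *\<^sub>C \<theta> a" for c a
    using assms by (auto simp: star_automorphism_def)
  show "\<theta> (r *\<^sub>R a) = r *\<^sub>R \<theta> a" using C[of "complex_of_real r" a] by (simp add: scaleC_of_real)
  show "\<theta> (a * b) = \<theta> a * \<theta> b" "\<theta> (star a) = star (\<theta> a)"
    using assms by (auto simp: star_automorphism_def)
qed

lemma star_automorphism_inv:
  assumes "star_automorphism \<theta>"
  shows "star_automorphism (inv \<theta>)"
proof -
  note simps = star_automorphism_simps[OF assms]
  have bij: "bij \<theta>" using assms by (auto simp: star_automorphism_def)
  then have *: "inv \<theta> a = b \<longleftrightarrow> a = \<theta> b" "\<theta> (inv \<theta> a) = a" for a b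
    by (metis bij_inv_eq_iff)+
  show ?thesis
    unfolding star_automorphism_def using bij_imp_bij_inv[OF bij]
    by (auto simp: * simps)
qed

text \<open>With \<open>x = \<theta> a\<close> and \<open>e = \<theta> d\<close>, the identity \<open>x\<^sup>2 + (1 - e)\<^sup>2 = 1\<close> makes \<open>w = x + \<i> (1 - e)\<close> and
  \<open>w\<^sup>* = x - \<i> (1 - e)\<close> isometries, and \<open>x\<close> is their average.\<close>

lemma star_automorphism_norm_le_one:
  assumes "star_automorphism \<theta>" and "star a = a" and "norm a < 1"
  shows "norm (\<theta> a) \<le> 1"
proof -
  note simps = star_automorphism_simps[OF assms(1)]
  obtain d where d: "star d = d" "a * d = d * a" "a * a = 2 *\<^sub>R d - d * d"
    using selfadjoint_one_minus_sqrt assms(2,3) by blast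
  define x e where "x = \<theta> a" and "e = \<theta> d"
  have x: "star x = x" and e: "star e = e" and xe: "x * e = e * x"
    and xx: "x * x = 2 *\<^sub>R e - e * e"
    using arg_cong[OF d(2), of \<theta>] arg_cong[OF d(3), of \<theta>] d(1) assms(2)
    by (auto simp: x_def e_def simps simp flip: simps(7))
  \<comment> \<open>\<open>k\<close> stands for \<open>\<i>\<close> or \<open>- \<i>\<close>.
    Letting \<open>w\<close> act on an element \<open>c\<close> turns the product with
    \<open>1 - e\<close> into \<open>c - e * c\<close>, so that no unit has to be adjoined.\<close>
  have iso: "norm (x * c + k *\<^sub>C (c - e * c)) = norm c" if k: "cnj k = - k" "k * k = -1" for k c
  proof -
    define y where "y = c - e * c"
    have xx': "x * (x * c) = 2 *\<^sub>R (e * c) - e * (e * c)"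
      using arg_cong[OF xx, of "\<lambda>z. z * c"] by (simp add: left_diff_distrib mult.assoc)
    have xe': "x * (e * c) = e * (x * c)"
      by (metis xe mult.assoc)
    have sy: "star y = star c - star c * e" by (simp add: y_def star_diff star_mult e)
    have "star (x * c + k *\<^sub>C y) * (x * c + k *\<^sub>C y) =
        (star c * x - k *\<^sub>C star y) * (x * c + k *\<^sub>C y)"
      by (simp add: star_add star_mult x star_scaleC k)
        (metis (no_types, lifting) add_uminus_conv_diff scaleC_diff_left scaleC_zero_left diff_0)
    also have "\<dots> = star c * (x * (x * c)) + star y * y
          + k *\<^sub>C (star c * (x * y) - star y * (x * c))"
    proof -
      have "k *\<^sub>C star y * k *\<^sub>C y = - (star y * y)"
        using scaleC_diff_left[of 0 1 "star y * y"]
        by (simp add: scaleC_mult_left scaleC_mult_right scaleC_scaleC k)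
      then show ?thesis
        by (simp add: algebra_simps scaleC_mult_left scaleC_mult_right scaleC_diff_right)
    qed
    \<comment> \<open>The cross terms cancel because \<open>x\<close> commutes with
      \<open>e\<close>.\<close>
    also have "star c * (x * y) - star y * (x * c) = 0"
      unfolding sy by (simp add: y_def algebra_simps xe')
    also have "star c * (x * (x * c)) + star y * y = star c * c"
      unfolding sy by (simp add: y_def xx' algebra_simps scaleR_2)
    finally have "(norm (x * c + k *\<^sub>C y))\<^sup>2 = (norm c)\<^sup>2"
      by (simp flip: cstar_identity)
    then show ?thesis by (simp add: y_def)
  qed
  have "norm (x * c) \<le> norm c" for c
  proof -
    have "2 *\<^sub>R (x * c) = (x * c + \<i> *\<^sub>C (c - e * c)) + (x * c + (- \<i>) *\<^sub>C (c - e * c))"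
      using scaleC_add_left[of \<i> "- \<i>" "c - e * c"] by (simp add: scaleR_2 add_ac)
    then have "2 * norm (x * c) = norm ((x * c + \<i> *\<^sub>C (c - e * c)) + (x * c + (- \<i>) *\<^sub>C (c - e * c)))"
      by (metis norm_scaleR abs_numeral)
    also have "\<dots> \<le> norm c + norm c"
      using norm_triangle_ineq[of "x * c + \<i> *\<^sub>C (c - e * c)" "x * c + (- \<i>) *\<^sub>C (c - e * c)"]
        iso[of \<i> c] iso[of "- \<i>" c] by simp
    finally show ?thesis by simp
  qed
  \<comment> \<open>For self-adjoint \<open>x\<close> the C*-identity turns the contraction property
    at \<open>c = x\<close> into a bound on \<open>norm x\<close>.\<close>
  from this[of x] have "(norm x)\<^sup>2 \<le> norm x"
    using cstar_identity[of x] x by simp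
  then show ?thesis
    by (cases "norm x = 0") (auto simp: x_def power2_eq_square)
qed

text \<open>Scaling by \<open>norm b + \<epsilon>\<close> extends the bound on the open unit ball to
  every self-adjoint \<open>b\<close>; the C*-identity reduces \<open>a\<close> to
  \<open>star a * a\<close>; the inverse automorphism gives the opposite inequality.\<close>

lemma star_automorphism_norm:
  assumes "star_automorphism \<theta>"
  shows "norm (\<theta> a) = norm a"
proof -
  have *: "norm (\<theta> a) \<le> norm a" if \<theta>: "star_automorphism \<theta>" for \<theta> :: "'a \<Rightarrow> 'a" and a
  proof -
    note simps = star_automorphism_simps[OF \<theta>]
    have sa: "norm (\<theta> b) \<le> norm b" if "star b = b" for b
    proof (rule field_le_epsilon)
      fix \<epsilon> :: real assume "0 < \<epsilon>"
      define t where "t = norm b + \<epsilon>"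
      have t: "0 < t" using \<open>0 < \<epsilon>\<close> by (simp add: t_def add_nonneg_pos)
      have "norm (\<theta> ((1 / t) *\<^sub>R b)) \<le> 1"
        using t \<open>0 < \<epsilon>\<close> that
        by (intro star_automorphism_norm_le_one[OF \<theta>]) (auto simp: star_scaleR t_def divide_simps)
      then show "norm (\<theta> b) \<le> norm b + \<epsilon>"
        using t by (simp add: simps divide_simps t_def[symmetric])
    qed
    have "(norm (\<theta> a))\<^sup>2 = norm (\<theta> (star a * a))"
      by (simp add: simps cstar_identity)
    also have "\<dots> \<le> (norm a)\<^sup>2"
      using sa[of "star a * a"] by (simp add: star_mult star_star cstar_identity)
    finally show ?thesis by simp
  qed
  have "inv \<theta> (\<theta> a) = a"
    using assms by (simp add: star_automorphism_def bij_is_inj)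
  then show ?thesis
    using *[OF assms, of a] *[OF star_automorphism_inv[OF assms], of "\<theta> a"] by simp
qed

lemma star_automorphism_bounded_linear:
  assumes "star_automorphism \<theta>"
  shows "bounded_linear \<theta>"
  by (rule bounded_linear_intro[where K=1])
     (auto simp: star_automorphism_simps[OF assms] star_automorphism_norm[OF assms])

section \<open>Multipliers and their action on the algebra\<close>

lemma multiplier_simps:
  assumes "m \<in> multipliers"
  shows "m \<rhd> (a + b) = (m \<rhd> a) + (m \<rhd> b)" "(a + b) \<lhd> m = (a \<lhd> m) + (b \<lhd> m)"
    "m \<rhd> (c *\<^sub>C a) = c *\<^sub>C (m \<rhd> a)" "(c *\<^sub>C a) \<lhd> m = c *\<^sub>C (a \<lhd> m)"
    "m \<rhd> (a * b) = (m \<rhd> a) * b" "(a * b) \<lhd> m = a * (b \<lhd> m)"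
    "a * (m \<rhd> b) = (a \<lhd> m) * b"
  using assms unfolding multipliers_def lmul_def rmul_def
  by (auto simp: linear_simps bounded_linear.linear)

lemma multiplier_bounded_linear:
  assumes "m \<in> multipliers"
  shows "bounded_linear (\<lambda>a. m \<rhd> a)" "bounded_linear (\<lambda>a. a \<lhd> m)"
  using assms unfolding multipliers_def lmul_def rmul_def by auto

lemma mtimes_apply: "(m \<odot> n) \<rhd> a = m \<rhd> (n \<rhd> a)" "a \<lhd> (m \<odot> n) = (a \<lhd> m) \<lhd> n"
  by (auto simp: mtimes_def lmul_def rmul_def)

lemma mone_apply [simp]: "mone \<rhd> a = a" "a \<lhd> mone = a"
  by (auto simp: mone_def lmul_def rmul_def)

lemma mscalar_apply [simp]: "mscalar c \<rhd> a = c *\<^sub>C a" "a \<lhd> mscalar c = c *\<^sub>C a"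
  by (auto simp: mscalar_def lmul_def rmul_def)

lemma mstar_apply: "mstar m \<rhd> a = star (star a \<lhd> m)" "a \<lhd> mstar m = star (m \<rhd> star a)"
  by (auto simp: mstar_def lmul_def rmul_def)

lemma star_mult_apply: "star (m \<rhd> a) = star a \<lhd> mstar m" "star (a \<lhd> m) = mstar m \<rhd> star a"
  by (auto simp: mstar_apply star_star)

lemma mstar_multiplier:
  assumes m: "m \<in> multipliers"
  shows "mstar m \<in> multipliers"
proof -
  note simps = multiplier_simps[OF m]
  have "bounded_linear (\<lambda>a. star (star a \<lhd> m))" "bounded_linear (\<lambda>a. star (m \<rhd> star a))"
    using bounded_linear_compose[OF bounded_linear_star
        bounded_linear_compose[OF multiplier_bounded_linear(2)[OF m] bounded_linear_star]]
      bounded_linear_compose[OF bounded_linear_star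
        bounded_linear_compose[OF multiplier_bounded_linear(1)[OF m] bounded_linear_star]]
    by auto
  moreover have "a * star (star b \<lhd> m) = star (m \<rhd> star a) * b" for a b
    using arg_cong[OF simps(7)[of "star b" "star a"], of star] by (simp add: star_mult star_star)
  ultimately show ?thesis
    unfolding multipliers_def mstar_def by (auto simp: star_scaleC simps star_mult star_star)
qed

lemma unitary_multiplierD:
  assumes "unitary_multiplier w"
  shows "w \<in> multipliers" "mstar w \<in> multipliers"
    "mstar w \<rhd> (w \<rhd> a) = a" "w \<rhd> (mstar w \<rhd> a) = a"
    "(a \<lhd> mstar w) \<lhd> w = a" "(a \<lhd> w) \<lhd> mstar w = a"
proof -
  have eq: "mstar w \<odot> w = mone" "w \<odot> mstar w = mone"
    using assms by (auto simp: unitary_multiplier_def)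
  show "w \<in> multipliers" "mstar w \<in> multipliers"
    using assms by (auto simp: unitary_multiplier_def mstar_multiplier)
  show "mstar w \<rhd> (w \<rhd> a) = a" "w \<rhd> (mstar w \<rhd> a) = a"
    "(a \<lhd> mstar w) \<lhd> w = a" "(a \<lhd> w) \<lhd> mstar w = a"
    by (simp_all add: eq flip: mtimes_apply)
qed

text \<open>A multiplier passes across a product,
  \<open>a * (m \<rhd> b) = (a \<lhd> m) * b\<close>, so \<open>w\<close> meets
  \<open>mstar w\<close> inside \<open>star (w \<rhd> a) * (w \<rhd> a)\<close>, and the C*-identity
  compares the norms.\<close>

lemma unitary_multiplier_norm:
  assumes w: "unitary_multiplier w"
  shows "norm (w \<rhd> a) = norm a" "norm (a \<lhd> w) = norm a"
proof -
  note U = unitary_multiplierD[OF w]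
  have "star (w \<rhd> a) * (w \<rhd> a) = star a * a"
    by (simp add: star_mult_apply multiplier_simps(7)[OF U(1)] U(5))
  then have "(norm (w \<rhd> a))\<^sup>2 = (norm a)\<^sup>2" by (metis cstar_identity)
  then show "norm (w \<rhd> a) = norm a" by simp
  have "(a \<lhd> w) * star (a \<lhd> w) = a * star a"
    by (simp add: star_mult_apply multiplier_simps(7)[OF U(1), symmetric] U(4))
  then have "norm (star (star (a \<lhd> w)) * star (a \<lhd> w)) = norm (star (star a) * star a)"
    by (simp add: star_star)
  then have "(norm (a \<lhd> w))\<^sup>2 = (norm a)\<^sup>2"
    unfolding cstar_identity by simp
  then show "norm (a \<lhd> w) = norm a" by simp
qed

text \<open>Centrality speaks only of multipliers, so it is applied to the multiplier
  \<open>?n\<close> that \<open>a\<close> itself induces; the test element \<open>c\<close> is then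
  cancelled.\<close>

lemma central_multiplier_commute:
  assumes m: "central_multiplier m"
  shows "m \<rhd> a = a \<lhd> m"
proof (rule eq_if_right_mult_eq)
  fix c
  let ?n = "(\<lambda>c. a * c, \<lambda>c. c * a)"
  have mult: "m \<in> multipliers" using m by (simp add: central_multiplier_def)
  have "?n \<in> multipliers"
    unfolding multipliers_def
    by (auto simp: bounded_linear_mult_left bounded_linear_mult_right scaleC_mult_left
        scaleC_mult_right mult.assoc)
  then have "m \<odot> ?n = ?n \<odot> m"
    using m by (simp add: central_multiplier_def)
  then have "(m \<odot> ?n) \<rhd> c = (?n \<odot> m) \<rhd> c" by simp
  then have "m \<rhd> (a * c) = a * (m \<rhd> c)"
    unfolding mtimes_apply by (simp add: lmul_def)
  then show "(m \<rhd> a) * c = (a \<lhd> m) * c"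
    by (simp add: multiplier_simps[OF mult])
qed

text \<open>The double centralizer axioms relate the two halves of one multiplier, not halves of
  two. Multiplying by an arbitrary \<open>c\<close> on the left reduces the claim to those
  axioms.\<close>

lemma multiplier_assoc:
  fixes a :: "'a::cstar_algebra"
  assumes m: "m \<in> multipliers" and n: "n \<in> multipliers"
  shows "(m \<rhd> a) \<lhd> n = m \<rhd> (a \<lhd> n)"
proof (rule eq_if_left_mult_eq)
  fix c
  have "c * ((m \<rhd> a) \<lhd> n) = (c * (m \<rhd> a)) \<lhd> n"
    by (simp only: multiplier_simps(6)[OF n])
  also have "\<dots> = ((c \<lhd> m) * a) \<lhd> n" by (simp only: multiplier_simps(7)[OF m])
  also have "\<dots> = (c \<lhd> m) * (a \<lhd> n)" by (simp only: multiplier_simps(6)[OF n])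
  also have "\<dots> = c * (m \<rhd> (a \<lhd> n))" by (simp only: multiplier_simps(7)[OF m])
  finally show "c * ((m \<rhd> a) \<lhd> n) = c * (m \<rhd> (a \<lhd> n))" .
qed

text \<open>In the zero algebra every scalar acts as the identity and \<open>c\<close> is
  undetermined; this exception returns in the final theorem.\<close>

lemma mscalar_eq_mone_iff: "mscalar c = (mone :: 'a::cstar_algebra multiplier) \<longleftrightarrow> c = 1 \<or> (\<forall>a::'a. a = 0)"
proof
  assume *: "mscalar c = (mone :: 'a multiplier)"
  have "(c - 1) *\<^sub>C a = 0" for a :: 'a
    using arg_cong[OF *, of "\<lambda>m. m \<rhd> a"] by (simp add: scaleC_diff_left)
  then have "cmod (c - 1) * norm a = 0" for a :: 'a
    by (metis norm_scaleC norm_zero)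
  then show "c = 1 \<or> (\<forall>a::'a. a = 0)" by auto
next
  assume "c = 1 \<or> (\<forall>a::'a. a = 0)"
  then have "c *\<^sub>C a = a" for a :: 'a by (metis scaleC_one)
  then show "mscalar c = (mone :: 'a multiplier)" by (simp add: mscalar_def mone_def)
qed

section \<open>Strong measurability\<close>

lemma strongly_measurable_borel:
  assumes "strongly_measurable M f"
  shows "f \<in> borel_measurable M"
  using assms unfolding strongly_measurable_def
  by (metis borel_measurable_LIMSEQ_metric borel_measurable_simple_function)

lemma strongly_measurable_norm [measurable_dest]:
  assumes "strongly_measurable M f"
  shows "(\<lambda>x. norm (f x)) \<in> borel_measurable M"
  using strongly_measurable_borel[OF assms] by simp

lemma strongly_measurable_separable:
  assumes "strongly_measurable M f"
  obtains D where "countable D" "f ` space M \<subseteq> closure D"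
proof -
  obtain s where s: "\<And>i. simple_function M (s i)" "\<And>x. x \<in> space M \<Longrightarrow> (\<lambda>i. s i x) \<longlonglongrightarrow> f x"
    using assms unfolding strongly_measurable_def by metis
  show thesis
  proof
    show "countable (\<Union>i. s i ` space M)"
      using s(1) by (auto simp: simple_function_def intro: countable_finite)
    show "f ` space M \<subseteq> closure (\<Union>i. s i ` space M)"
    proof safe
      fix x assume x: "x \<in> space M"
      have "s i x \<in> closure (\<Union>i. s i ` space M)" for i
        using x closure_subset by fastforce
      then show "f x \<in> closure (\<Union>i. s i ` space M)"
        using Lim_in_closed_set[OF closed_closure _ _ s(2)[OF x]] by simp
    qed
  qed
qed

text \<open>With \<open>strongly_measurable_borel\<close> and
  \<open>strongly_measurable_separable\<close> this characterises strong measurability as Borel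
  measurability with separable range. The approximants take the value nearest to \<open>f x\<close>
  among the first points of a dense sequence.\<close>

lemma strongly_measurableI:
  assumes f: "f \<in> borel_measurable M" and "countable D" and sub: "f ` space M \<subseteq> closure D"
  shows "strongly_measurable M f"
proof (cases "D = {}")
  case True
  with sub have "space M = {}" by auto
  then show ?thesis
    by (auto simp: strongly_measurable_def simple_function_def intro!: exI[of _ "\<lambda>_. f"])
next
  case False
  define d where "d = from_nat_into D"
  have d: "range d = D" using \<open>countable D\<close> False by (simp add: d_def range_from_nat_into)
  \<comment> \<open>Taking the least index among ties makes the choice a measurable function with
    values in a countable space.\<close>
  define K where "K n x = (LEAST k. k \<le> n \<and> (\<forall>j\<in>{..n}. dist (f x) (d k) \<le> dist (f x) (d j)))" for n x
  have [measurable]: "(\<lambda>x. dist (f x) c) \<in> borel_measurable M" for c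
    by (rule borel_measurable_continuous_on[OF _ f]) (intro continuous_intros)
  have Kmeas[measurable]: "K n \<in> measurable M (count_space UNIV)" for n
    unfolding K_def by measurable
  have K: "K n x \<le> n" "j \<le> n \<Longrightarrow> dist (f x) (d (K n x)) \<le> dist (f x) (d j)" for n x j
  proof -
    obtain k where "k \<in> {..n}" "\<forall>j\<in>{..n}. dist (f x) (d k) \<le> dist (f x) (d j)"
      using ex_is_arg_min_if_finite[of "{..n}" "\<lambda>k. dist (f x) (d k)"]
      by (auto simp: is_arg_min_linorder)
    then have "\<exists>k. k \<le> n \<and> (\<forall>j\<in>{..n}. dist (f x) (d k) \<le> dist (f x) (d j))" by auto
    from LeastI_ex[OF this]
    show "K n x \<le> n" "j \<le> n \<Longrightarrow> dist (f x) (d (K n x)) \<le> dist (f x) (d j)"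
      by (auto simp: K_def)
  qed
  have "simple_function M (\<lambda>x. d (K n x))" for n
    unfolding simple_function_def
  proof safe
    have "(\<lambda>x. d (K n x)) ` space M \<subseteq> d ` {..n}" using K(1) by auto
    then show "finite ((\<lambda>x. d (K n x)) ` space M)" by (rule finite_subset) simp
    show "(\<lambda>x. d (K n x)) -` {d (K n x)} \<inter> space M \<in> sets M" for x
    proof -
      have "(\<lambda>x. d (K n x)) -` {d (K n x)} \<inter> space M = K n -` (d -` {d (K n x)}) \<inter> space M" by auto
      then show ?thesis using measurable_sets[OF Kmeas] by simp
    qed
  qed
  moreover have "(\<lambda>n. d (K n x)) \<longlonglongrightarrow> f x" if "x \<in> space M" for x
  proof (rule LIMSEQ_I)
    fix r :: real assume "0 < r"
    have "f x \<in> closure D" using sub that by auto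
    then obtain j where "dist (d j) (f x) < r"
      using \<open>0 < r\<close> unfolding closure_approachable d[symmetric] by auto
    then show "\<exists>no. \<forall>n\<ge>no. norm (d (K n x) - f x) < r"
      using K(2)[of j _ x] by (metis dist_commute dist_norm le_less_trans)
  qed
  ultimately show ?thesis
    unfolding strongly_measurable_def by (intro exI[of _ "\<lambda>n x. d (K n x)"]) simp
qed

text \<open>A diagonal choice of simple functions does not converge pointwise in general. In the
  form with separable range it suffices to unite the countable sets \<open>D i\<close>.\<close>

lemma strongly_measurable_LIMSEQ:
  assumes f: "\<And>i. strongly_measurable M (f i)"
    and lim: "\<And>x. x \<in> space M \<Longrightarrow> (\<lambda>i. f i x) \<longlonglongrightarrow> g x"
  shows "strongly_measurable M g"
proof -
  have "\<forall>i. \<exists>D. countable D \<and> f i ` space M \<subseteq> closure D"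
    by (meson strongly_measurable_separable[OF f])
  then obtain D where D: "\<And>i. countable (D i)" "\<And>i. f i ` space M \<subseteq> closure (D i)"
    by metis
  show ?thesis
  proof (rule strongly_measurableI)
    show "g \<in> borel_measurable M"
      using borel_measurable_LIMSEQ_metric[OF strongly_measurable_borel[OF f] lim] .
    show "countable (\<Union>i. D i)" using D(1) by simp
    show "g ` space M \<subseteq> closure (\<Union>i. D i)"
    proof safe
      fix x assume x: "x \<in> space M"
      have "f i x \<in> closure (\<Union>i. D i)" for i
        using D(2)[of i] x closure_mono[of "D i" "\<Union>i. D i"] by blast
      then show "g x \<in> closure (\<Union>i. D i)"
        using Lim_in_closed_set[OF closed_closure _ _ lim[OF x]] by simp
    qed
  qed
qed

lemma strongly_measurable_compose:
  assumes "strongly_measurable M f" and T: "T \<in> measurable N M"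
  shows "strongly_measurable N (\<lambda>x. f (T x))"
proof -
  obtain D where D: "countable D" "f ` space M \<subseteq> closure D"
    using strongly_measurable_separable[OF assms(1)] .
  show ?thesis
    using D measurable_space[OF T] measurable_compose[OF T strongly_measurable_borel[OF assms(1)]]
    by (intro strongly_measurableI[where D=D]) auto
qed

lemma strongly_measurable_cong:
  assumes "\<And>x. x \<in> space M \<Longrightarrow> f x = g x"
  shows "strongly_measurable M f \<longleftrightarrow> strongly_measurable M g"
  using assms by (simp add: strongly_measurable_def)

lemma strongly_measurable_cong_sets:
  assumes "sets M = sets N"
  shows "strongly_measurable M f \<longleftrightarrow> strongly_measurable N f"
  using assms sets_eq_imp_space_eq[OF assms]
  by (simp add: strongly_measurable_def simple_function_def)

lemma strongly_measurable_const: "strongly_measurable M (\<lambda>_. c)"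
  unfolding strongly_measurable_def by (intro exI[of _ "\<lambda>_ _. c"]) simp

lemma strongly_measurable_real:
  fixes f :: "'b \<Rightarrow> real"
  assumes "f \<in> borel_measurable M"
  shows "strongly_measurable M f"
  using borel_measurable_implies_sequence_metric[OF assms, of 0]
  by (auto simp: strongly_measurable_def)

lemma strongly_measurable_continuous:
  assumes "strongly_measurable M f" and "continuous_on UNIV h"
  shows "strongly_measurable M (\<lambda>x. h (f x))"
proof -
  obtain s where s: "\<And>i. simple_function M (s i)" "\<And>x. x \<in> space M \<Longrightarrow> (\<lambda>i. s i x) \<longlonglongrightarrow> f x"
    using assms(1) unfolding strongly_measurable_def by metis
  show ?thesis
    unfolding strongly_measurable_def
    using s(1) continuous_on_tendsto_compose[OF assms(2) s(2)]
    by (intro exI[of _ "\<lambda>i x. h (s i x)"]) (auto intro: simple_function_compose1)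
qed

lemma strongly_measurable_continuous2:
  assumes "strongly_measurable M f" "strongly_measurable M g"
    and h: "continuous_on UNIV (\<lambda>p. h (fst p) (snd p))"
  shows "strongly_measurable M (\<lambda>x. h (f x) (g x))"
proof -
  obtain s where s: "\<And>i. simple_function M (s i)" "\<And>x. x \<in> space M \<Longrightarrow> (\<lambda>i. s i x) \<longlonglongrightarrow> f x"
    using assms(1) unfolding strongly_measurable_def by metis
  obtain t where t: "\<And>i. simple_function M (t i)" "\<And>x. x \<in> space M \<Longrightarrow> (\<lambda>i. t i x) \<longlonglongrightarrow> g x"
    using assms(2) unfolding strongly_measurable_def by metis
  have "(\<lambda>i. h (s i x) (t i x)) \<longlonglongrightarrow> h (f x) (g x)" if "x \<in> space M" for x
    using continuous_on_tendsto_compose[OF h tendsto_Pair[OF s(2) t(2)]] that by simp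
  then show ?thesis
    unfolding strongly_measurable_def using s(1) t(1)
    by (intro exI[of _ "\<lambda>i x. h (s i x) (t i x)"]) (auto intro: simple_function_compose2)
qed

lemma strongly_measurable_add:
  "strongly_measurable M f \<Longrightarrow> strongly_measurable M g \<Longrightarrow> strongly_measurable M (\<lambda>x. f x + g x)"
  by (rule strongly_measurable_continuous2[where h="(+)"]) (auto intro!: continuous_intros)

lemma strongly_measurable_diff:
  "strongly_measurable M f \<Longrightarrow> strongly_measurable M g \<Longrightarrow> strongly_measurable M (\<lambda>x. f x - g x)"
  by (rule strongly_measurable_continuous2[where h="(-)"]) (auto intro!: continuous_intros)

lemma strongly_measurable_mult:
  fixes f g :: "'b \<Rightarrow> 'a::real_normed_algebra"
  shows "strongly_measurable M f \<Longrightarrow> strongly_measurable M g \<Longrightarrow> strongly_measurable M (\<lambda>x. f x * g x)"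
  by (rule strongly_measurable_continuous2[where h="(*)"]) (auto intro!: continuous_intros)

lemma strongly_measurable_scaleR:
  fixes g :: "'b \<Rightarrow> 'a::real_normed_vector" and c :: "'b \<Rightarrow> real"
  assumes "c \<in> borel_measurable M" "strongly_measurable M g"
  shows "strongly_measurable M (\<lambda>x. c x *\<^sub>R g x)"
  using strongly_measurable_real[OF assms(1)] assms(2)
  by (rule strongly_measurable_continuous2[where h="(*\<^sub>R)"]) (intro continuous_intros)

lemma strongly_measurable_sum:
  assumes "\<And>i. i \<in> I \<Longrightarrow> strongly_measurable M (f i)"
  shows "strongly_measurable M (\<lambda>x. \<Sum>i\<in>I. f i x)"
  using assms
  by (induction I rule: infinite_finite_induct)
     (auto intro: strongly_measurable_const strongly_measurable_add)

lemma strongly_measurable_star: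
  fixes f :: "'b \<Rightarrow> 'a::cstar_algebra"
  shows "strongly_measurable M f \<Longrightarrow> strongly_measurable M (\<lambda>x. star (f x))"
  by (rule strongly_measurable_continuous)
     (auto intro: linear_continuous_on bounded_linear_star)

text \<open>\<open>T\<close> is measurable only at each fixed argument. A simple \<open>F\<close>
  splits \<open>T x (F x)\<close> into finitely many pieces of that kind, and continuity of
  \<open>T x\<close> passes to the limit. This serves for \<open>\<alpha>\<close> and
  \<open>u\<close> acting on values of functions.\<close>

lemma strongly_measurable_apply:
  assumes T: "\<And>a. strongly_measurable M (\<lambda>x. T x a)" and lin: "\<And>x. bounded_linear (T x)"
    and F: "strongly_measurable M F"
  shows "strongly_measurable M (\<lambda>x. T x (F x))"
proof -
  obtain s where s: "\<And>i. simple_function M (s i)" "\<And>x. x \<in> space M \<Longrightarrow> (\<lambda>i. s i x) \<longlonglongrightarrow> F x"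
    using F unfolding strongly_measurable_def by metis
  have "strongly_measurable M (\<lambda>x. T x (s i x))" for i
  proof -
    have [simp]: "finite (s i ` space M)" using s(1)[of i] by (simp add: simple_function_def)
    have "T x (s i x) = (\<Sum>v\<in>s i ` space M. indicator (s i -` {v} \<inter> space M) x *\<^sub>R T x v)"
      if "x \<in> space M" for x
    proof -
      have "(\<Sum>v\<in>s i ` space M. indicator (s i -` {v} \<inter> space M) x *\<^sub>R T x v) =
          (\<Sum>v\<in>s i ` space M. if v = s i x then T x v else 0)"
        using that by (intro sum.cong) (auto simp: indicator_def)
      then show ?thesis using that by (simp add: sum.delta')
    qed
    moreover have "strongly_measurable M
        (\<lambda>x. \<Sum>v\<in>s i ` space M. indicator (s i -` {v} \<inter> space M) x *\<^sub>R T x v)"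
      using s(1)[of i] simple_functionD(2)[OF s(1)]
      by (intro strongly_measurable_sum strongly_measurable_scaleR T borel_measurable_indicator) auto
    ultimately show ?thesis by (simp cong: strongly_measurable_cong)
  qed
  then show ?thesis
    by (rule strongly_measurable_LIMSEQ) (auto intro: bounded_linear.tendsto[OF lin] s(2))
qed

lemma strongly_measurable_dominated_sequence:
  fixes f :: "'b \<Rightarrow> 'a::real_normed_vector"
  assumes f: "strongly_measurable M f"
  shows "\<exists>s. (\<forall>i. simple_function M (s i)) \<and> (\<forall>x\<in>space M. (\<lambda>i. s i x) \<longlonglongrightarrow> f x) \<and>
    (\<forall>i x. norm (s i x) \<le> 2 * norm (f x))"
proof -
  obtain t where t: "\<And>i. simple_function M (t i)" "\<And>x. x \<in> space M \<Longrightarrow> (\<lambda>i. t i x) \<longlonglongrightarrow> f x"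
    using assms(1) unfolding strongly_measurable_def by metis
  \<comment> \<open>The truncation keeps the limit: where \<open>f x\<close> is nonzero its
    condition holds eventually, and where \<open>f x = 0\<close> it forces the value
    \<open>0\<close>.\<close>
  define s where "s i x = (if norm (t i x) \<le> 2 * norm (f x) then t i x else 0)" for i x
  have [measurable]: "(\<lambda>x. norm (f x)) \<in> borel_measurable M" "(\<lambda>x. norm (t i x)) \<in> borel_measurable M" for i
    using strongly_measurable_norm[OF f]
      borel_measurable_simple_function[OF simple_function_compose1[OF t(1)]] by auto
  have "simple_function M (s i)" for i
    unfolding s_def
    by (rule simple_function_If) (auto intro: t(1))
  moreover have "(\<lambda>i. s i x) \<longlonglongrightarrow> f x" if x: "x \<in> space M" for x
  proof (cases "f x = 0")
    case True
    then show ?thesis by (simp add: s_def cong: if_cong)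
  next
    case False
    have "(\<lambda>i. norm (t i x)) \<longlonglongrightarrow> norm (f x)" by (intro tendsto_norm t x)
    then have "\<forall>\<^sub>F i in sequentially. norm (t i x) < 2 * norm (f x)"
      by (rule order_tendstoD) (use False in auto)
    then have "\<forall>\<^sub>F i in sequentially. t i x = s i x"
      by eventually_elim (simp add: s_def)
    then show ?thesis using t(2)[OF x] by (rule Lim_transform_eventually[rotated])
  qed
  moreover have "norm (s i x) \<le> 2 * norm (f x)" for i x by (simp add: s_def)
  ultimately show ?thesis by (intro exI[of _ s]) simp
qed

section \<open>The strong integral\<close>

abbreviation "simple_bochner_integrable \<equiv> Bochner_Integration.simple_bochner_integrable"
abbreviation "simple_bochner_integral \<equiv> Bochner_Integration.simple_bochner_integral"

text \<open>In a Banach space this is equivalent to the existence of the integral, see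
  \<open>has_strong_integral_iff\<close>, and it is the form in which integrability gets
  checked.\<close>

definition strongly_integrable :: "'b measure \<Rightarrow> ('b \<Rightarrow> 'a::real_normed_vector) \<Rightarrow> bool" where
  "strongly_integrable M f \<longleftrightarrow>
     strongly_measurable M f \<and> L1_norm M f < \<infinity>"

lemma simple_bochner_simple:
  "simple_bochner_integrable M s \<Longrightarrow> simple_function M s"
  by (auto elim: simple_bochner_integrable.cases)

lemma simple_strongly_measurable:
  assumes "simple_bochner_integrable M s"
  shows "strongly_measurable M s"
  using simple_bochner_simple[OF assms]
  unfolding strongly_measurable_def by (intro exI[of _ "\<lambda>_. s"]) simp

lemma simple_bochner_integral_zero:
  "simple_bochner_integrable M (\<lambda>_. 0)" "simple_bochner_integral M (\<lambda>_. 0) = 0"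
  unfolding simple_bochner_integral_def
  by (auto intro: simple_bochner_integrable.intros intro!: sum.neutral)

lemma simple_bochner_integral_norm_le:
  assumes "simple_bochner_integrable M s"
  shows "enorm (simple_bochner_integral M s) \<le> L1_norm M s"
proof -
  have "simple_bochner_integrable M (\<lambda>x. norm (s x))"
    using simple_bochner_integrable_compose2[of "\<lambda>a _. norm a" M s s] assms by simp
  from simple_bochner_integral_eq_nn_integral[OF this] show ?thesis
    using ennreal_leI[OF simple_bochner_integral_norm_bound[OF assms]] by simp
qed

lemma nn_integral_norm_triangle:
  assumes f: "strongly_measurable M f" and g: "strongly_measurable M g"
    and h: "strongly_measurable M h"
  shows "L1_dist M f g \<le>
    L1_dist M h f + L1_dist M h g"
proof -
  note [measurable] = strongly_measurable_norm[OF strongly_measurable_diff[OF h f]]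
    strongly_measurable_norm[OF strongly_measurable_diff[OF h g]]
  have "norm (f x - g x) \<le> norm (h x - f x) + norm (h x - g x)" for x
    using norm_triangle_ineq4[of "h x - g x" "h x - f x"] by (simp add: norm_minus_commute)
  then have "L1_dist M f g \<le>
      (\<integral>\<^sup>+x. enorm (h x - f x) + enorm (h x - g x) \<partial>M)"
    by (intro nn_integral_mono) (simp flip: ennreal_plus)
  also have "\<dots> = L1_dist M h f + L1_dist M h g"
    by (rule nn_integral_add) auto
  finally show ?thesis .
qed

lemma simple_bochner_integral_dist_le:
  assumes f: "strongly_measurable M f"
    and s: "simple_bochner_integrable M s" and t: "simple_bochner_integrable M t"
  shows "enorm (simple_bochner_integral M s - simple_bochner_integral M t) \<le>
    L1_dist M f s + L1_dist M f t"
proof -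
  have "simple_bochner_integrable M (\<lambda>x. s x - t x)"
    using simple_bochner_integrable_compose2[of "(-)" M s t] s t by simp
  from simple_bochner_integral_norm_le[OF this]
  have "enorm (simple_bochner_integral M s - simple_bochner_integral M t) \<le>
      L1_dist M s t"
    by (simp add: simple_bochner_integral_diff[OF s t])
  also have "\<dots> \<le> L1_dist M f s + L1_dist M f t"
    by (rule nn_integral_norm_triangle[OF simple_strongly_measurable[OF s]
          simple_strongly_measurable[OF t] f])
  finally show ?thesis .
qed

lemma ennreal_norm_tendsto_zeroD:
  fixes f :: "nat \<Rightarrow> 'a::real_normed_vector"
  assumes "\<And>i. enorm (f i - l) \<le> e i" and "e \<longlonglongrightarrow> 0"
  shows "f \<longlonglongrightarrow> l"
proof -
  have "(\<lambda>i. enorm (f i - l)) \<longlonglongrightarrow> 0"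
    by (rule tendsto_sandwich[OF _ _ tendsto_const assms(2)]) (auto simp: assms(1))
  then have "(\<lambda>i. norm (f i - l)) \<longlonglongrightarrow> 0"
    using tendsto_ennreal_iff[of "\<lambda>i. norm (f i - l)" sequentially 0] by simp
  then show ?thesis
    by (rule LIM_zero_cancel[OF tendsto_norm_zero_cancel])
qed

lemma has_strong_integral_unique:
  assumes I: "has_strong_integral M f I" and J: "has_strong_integral M f J"
  shows "I = J"
proof -
  from I obtain s where f: "strongly_measurable M f"
    and s: "\<And>i. simple_bochner_integrable M (s i)"
      "(\<lambda>i. L1_dist M f (s i)) \<longlonglongrightarrow> 0"
      "(\<lambda>i. simple_bochner_integral M (s i)) \<longlonglongrightarrow> I"
    unfolding has_strong_integral_def by blast
  from J obtain t where
    t: "\<And>i. simple_bochner_integrable M (t i)"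
      "(\<lambda>i. L1_dist M f (t i)) \<longlonglongrightarrow> 0"
      "(\<lambda>i. simple_bochner_integral M (t i)) \<longlonglongrightarrow> J"
    unfolding has_strong_integral_def by blast
  have "(\<lambda>i. simple_bochner_integral M (s i) - simple_bochner_integral M (t i)) \<longlonglongrightarrow> 0"
    using simple_bochner_integral_dist_le[OF f s(1) t(1)] tendsto_add[OF s(2) t(2)]
    by (intro ennreal_norm_tendsto_zeroD) simp_all
  with tendsto_diff[OF s(3) t(3)] have "I - J = 0" by (rule LIMSEQ_unique)
  then show ?thesis by simp
qed

lemma strong_integral_eq:
  assumes "has_strong_integral M f I"
  shows "strong_integral M f = I"
proof -
  have "(THE I. has_strong_integral M f I) = I"
  proof (rule the_equality)
    show "has_strong_integral M f I" by fact
    show "J = I" if "has_strong_integral M f J" for J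
      using that assms by (rule has_strong_integral_unique)
  qed
  moreover have "\<exists>I. has_strong_integral M f I" using assms by blast
  ultimately show ?thesis unfolding strong_integral_def by (simp only: if_True)
qed

lemma has_strong_integralD:
  assumes "has_strong_integral M f I"
  shows "strongly_integrable M f"
proof -
  from assms obtain s where f: "strongly_measurable M f"
    and s: "\<And>i. simple_bochner_integrable M (s i)"
      "(\<lambda>i. L1_dist M f (s i)) \<longlonglongrightarrow> 0"
    unfolding has_strong_integral_def by blast
  have "\<forall>\<^sub>F i in sequentially. L1_dist M f (s i) < 1"
    by (rule order_tendstoD(2)[OF s(2)]) simp
  then obtain i where i: "L1_dist M f (s i) < 1"
    using eventually_happens' sequentially_bot by blast
  have "simple_bochner_integrable M (\<lambda>x. norm (s i x))"
    using simple_bochner_integrable_compose2[of "\<lambda>a _. norm a" M "s i" "s i"] s(1) by simp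
  from simple_bochner_integral_eq_nn_integral[OF this, symmetric]
  have "L1_norm M (\<lambda>x. s i x - 0) < \<infinity>"
    by simp
  moreover have "L1_norm M (\<lambda>x. f x - 0) \<le>
      L1_dist M (s i) f + L1_norm M (\<lambda>x. s i x - 0)"
    by (intro nn_integral_norm_triangle f strongly_measurable_const
        simple_strongly_measurable s)
  moreover have "L1_dist M (s i) f < \<infinity>"
    using less_trans[OF i, of \<infinity>] by (simp add: norm_minus_commute)
  ultimately have "L1_norm M f < \<infinity>"
    by (simp add: order_le_less_trans)
  with f show ?thesis by (simp add: strongly_integrable_def)
qed

lemma strongly_integrable_approx:
  fixes f :: "'b \<Rightarrow> 'a::real_normed_vector"
  assumes "strongly_integrable M f"
  shows "\<exists>s. (\<forall>i. simple_bochner_integrable M (s i)) \<and>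
    (\<forall>x\<in>space M. (\<lambda>i. s i x) \<longlonglongrightarrow> f x) \<and> (\<forall>i x. norm (s i x) \<le> 2 * norm (f x)) \<and>
    (\<lambda>i. L1_dist M f (s i)) \<longlonglongrightarrow> 0"
proof -
  from assms have f: "strongly_measurable M f" and fin: "L1_norm M f < \<infinity>"
    by (auto simp: strongly_integrable_def)
  obtain s where s: "\<And>i. simple_function M (s i)" "\<And>x. x \<in> space M \<Longrightarrow> (\<lambda>i. s i x) \<longlonglongrightarrow> f x"
    "\<And>i x. norm (s i x) \<le> 2 * norm (f x)"
    using strongly_measurable_dominated_sequence[OF f] by blast
  note [measurable] = strongly_measurable_norm[OF f]
  \<comment> \<open>The factor \<open>3\<close> covers both
    \<open>norm (s i x) <= 2 * norm (f x)\<close> and the resulting bound for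
    \<open>norm (f x - s i x)\<close>.\<close>
  have fin': "(\<integral>\<^sup>+x. ennreal (3 * norm (f x)) \<partial>M) < \<infinity>"
    using fin by (simp add: ennreal_mult nn_integral_cmult ennreal_mult_less_top)
  have sbi: "simple_bochner_integrable M (s i)" for i
  proof (rule simple_bochner_integrableI_bounded[OF s(1)])
    have "L1_norm M (\<lambda>x. s i x) \<le> (\<integral>\<^sup>+x. ennreal (3 * norm (f x)) \<partial>M)"
      by (intro nn_integral_mono ennreal_leI order_trans[OF s(3)]) simp
    then show "L1_norm M (\<lambda>x. s i x) < \<infinity>" using fin' by simp
  qed
  have "(\<lambda>i. L1_dist M f (s i)) \<longlonglongrightarrow> (\<integral>\<^sup>+x. 0 \<partial>M)"
  proof (rule nn_integral_dominated_convergence[where w="\<lambda>x. ennreal (3 * norm (f x))"])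
    show "(\<lambda>x. enorm (f x - s i x)) \<in> borel_measurable M" for i
      using strongly_measurable_norm[OF strongly_measurable_diff[OF f
            simple_strongly_measurable[OF sbi]]] by simp
    show "AE x in M. enorm (f x - s i x) \<le> ennreal (3 * norm (f x))" for i
    proof (intro AE_I2 ennreal_leI)
      show "norm (f x - s i x) \<le> 3 * norm (f x)" for x
        using s(3)[of i x] norm_triangle_ineq4[of "f x" "s i x"] by simp
    qed
    show "AE x in M. (\<lambda>i. enorm (f x - s i x)) \<longlonglongrightarrow> 0"
    proof (intro AE_I2)
      fix x assume "x \<in> space M"
      then have "(\<lambda>i. norm (f x - s i x)) \<longlonglongrightarrow> norm (f x - f x)"
        by (intro tendsto_intros s(2))
      from tendsto_ennrealI[OF this] show "(\<lambda>i. enorm (f x - s i x)) \<longlonglongrightarrow> 0"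
        by simp
    qed
  qed (use fin' in auto)
  with sbi s(2,3) show ?thesis by (intro exI[of _ s]) auto
qed

lemma strong_integralI:
  fixes f :: "'b \<Rightarrow> 'a::banach"
  assumes "strongly_integrable M f"
  shows "has_strong_integral M f (strong_integral M f)"
proof -
  from assms have f: "strongly_measurable M f" by (auto simp: strongly_integrable_def)
  obtain s where sbi: "\<And>i. simple_bochner_integrable M (s i)"
    and "\<And>x. x \<in> space M \<Longrightarrow> (\<lambda>i. s i x) \<longlonglongrightarrow> f x" "\<And>i x. norm (s i x) \<le> 2 * norm (f x)"
    and lim: "(\<lambda>i. L1_dist M f (s i)) \<longlonglongrightarrow> 0"
    using strongly_integrable_approx[OF assms] by blast
  have "Cauchy (\<lambda>i. simple_bochner_integral M (s i))"
  proof (rule CauchyI)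
    fix e :: real assume "0 < e"
    then have "\<forall>\<^sub>F i in sequentially. L1_dist M f (s i) < ennreal (e / 2)"
      by (intro order_tendstoD[OF lim]) simp
    then obtain N where N: "\<And>i. N \<le> i \<Longrightarrow> L1_dist M f (s i) < ennreal (e / 2)"
      by (auto simp: eventually_sequentially)
    have "norm (simple_bochner_integral M (s m) - simple_bochner_integral M (s n)) < e"
      if "N \<le> m" "N \<le> n" for m n
    proof -
      have "enorm (simple_bochner_integral M (s m) - simple_bochner_integral M (s n)) <
          ennreal (e / 2) + ennreal (e / 2)"
        using simple_bochner_integral_dist_le[OF f sbi sbi] add_strict_mono[OF N[OF that(1)] N[OF that(2)]]
        by (rule order_le_less_trans)
      also have "\<dots> = ennreal e" using \<open>0 < e\<close> by (simp flip: ennreal_plus)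
      finally show ?thesis using \<open>0 < e\<close> by (simp add: ennreal_less_iff)
    qed
    then show "\<exists>N. \<forall>m\<ge>N. \<forall>n\<ge>N.
        norm (simple_bochner_integral M (s m) - simple_bochner_integral M (s n)) < e" by blast
  qed
  then obtain I where "(\<lambda>i. simple_bochner_integral M (s i)) \<longlonglongrightarrow> I"
    using Cauchy_convergent convergent_def by blast
  with f sbi lim have "has_strong_integral M f I"
    unfolding has_strong_integral_def by blast
  then show ?thesis by (simp add: strong_integral_eq)
qed

text \<open>The default value \<open>0\<close> matters in Fubini's theorem: it makes the inner
  integral measurable also on the null set where a section is not integrable.\<close>

lemma strong_integral_not_integrable:
  "\<not> strongly_integrable M f \<Longrightarrow> strong_integral M f = 0"
  using has_strong_integralD by (auto simp: strong_integral_def)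

lemma has_strong_integral_simple:
  assumes "simple_bochner_integrable M s"
  shows "has_strong_integral M s (simple_bochner_integral M s)"
  unfolding has_strong_integral_def
  using assms simple_strongly_measurable[OF assms]
  by (intro conjI exI[of _ "\<lambda>_. s"]) auto

lemma has_strong_integral_norm_le:
  assumes "has_strong_integral M f I"
  shows "enorm I \<le> L1_norm M f"
proof -
  from assms obtain s where f: "strongly_measurable M f"
    and s: "\<And>i. simple_bochner_integrable M (s i)"
      "(\<lambda>i. L1_dist M f (s i)) \<longlonglongrightarrow> 0"
      "(\<lambda>i. simple_bochner_integral M (s i)) \<longlonglongrightarrow> I"
    unfolding has_strong_integral_def by blast
  have "enorm (simple_bochner_integral M (s i)) \<le>
      L1_dist M f (s i) + L1_norm M f" for i
    using simple_bochner_integral_dist_le[OF f s(1)[of i] simple_bochner_integral_zero(1)]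
    by (simp add: simple_bochner_integral_zero)
  moreover have "(\<lambda>i. L1_dist M f (s i) + L1_norm M f)
      \<longlonglongrightarrow> 0 + L1_norm M f"
    by (intro tendsto_add s tendsto_const)
  moreover have "(\<lambda>i. enorm (simple_bochner_integral M (s i))) \<longlonglongrightarrow> enorm I"
    by (intro tendsto_ennrealI tendsto_norm s)
  ultimately show ?thesis
    by (metis (no_types, lifting) LIMSEQ_le add.left_neutral)
qed

section \<open>Linearity, change of variables and dominated convergence\<close>

lemma has_strong_integral_linear:
  assumes "has_strong_integral M f I" and T: "bounded_linear T"
  shows "has_strong_integral M (\<lambda>x. T (f x)) (T I)"
proof -
  interpret T: bounded_linear T by fact
  from assms obtain s where f: "strongly_measurable M f"
    and s: "\<And>i. simple_bochner_integrable M (s i)"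
      "(\<lambda>i. L1_dist M f (s i)) \<longlonglongrightarrow> 0"
      "(\<lambda>i. simple_bochner_integral M (s i)) \<longlonglongrightarrow> I"
    unfolding has_strong_integral_def by blast
  obtain K where K: "0 < K" "\<And>x. norm (T x) \<le> norm x * K" using T.pos_bounded by auto
  have meas[measurable]: "(\<lambda>x. norm (f x - s i x)) \<in> borel_measurable M" for i
    by (intro strongly_measurable_norm strongly_measurable_diff f
        simple_strongly_measurable s)
  show ?thesis
    unfolding has_strong_integral_def
  proof (intro conjI exI[of _ "\<lambda>i x. T (s i x)"] allI)
    show "strongly_measurable M (\<lambda>x. T (f x))"
      using f by (rule strongly_measurable_continuous) (rule linear_continuous_on[OF T])
    show "simple_bochner_integrable M (\<lambda>x. T (s i x))" for i
      using simple_bochner_integrable_compose2[of "\<lambda>a _. T a" M "s i" "s i"] s(1)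
      by (simp add: T.zero)
    show "(\<lambda>i. simple_bochner_integral M (\<lambda>x. T (s i x))) \<longlonglongrightarrow> T I"
      using T.tendsto[OF s(3)] by (simp add: simple_bochner_integral_linear[OF T.linear s(1)])
    have "(\<lambda>i. ennreal K * L1_dist M f (s i)) \<longlonglongrightarrow> ennreal K * 0"
      using K by (intro ennreal_tendsto_cmult s) simp_all
    then have lim: "(\<lambda>i. ennreal K * L1_dist M f (s i)) \<longlonglongrightarrow> 0" by simp
    show "(\<lambda>i. L1_norm M (\<lambda>x. T (f x) - T (s i x))) \<longlonglongrightarrow> 0"
    proof (rule tendsto_sandwich[OF _ _ tendsto_const lim])
      show "\<forall>\<^sub>F i in sequentially. L1_norm M (\<lambda>x. T (f x) - T (s i x)) \<le>
          ennreal K * L1_dist M f (s i)"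
        using K
        by (intro always_eventually allI)
           (auto simp: T.diff[symmetric] mult.commute nn_integral_cmult[symmetric] ennreal_mult'[symmetric]
             intro!: nn_integral_mono ennreal_leI)
    qed simp
  qed
qed

lemma has_strong_integral_add:
  assumes "has_strong_integral M f I" "has_strong_integral M g J"
  shows "has_strong_integral M (\<lambda>x. f x + g x) (I + J)"
proof -
  from assms(1) obtain s where f: "strongly_measurable M f"
    and s: "\<And>i. simple_bochner_integrable M (s i)"
      "(\<lambda>i. L1_dist M f (s i)) \<longlonglongrightarrow> 0"
      "(\<lambda>i. simple_bochner_integral M (s i)) \<longlonglongrightarrow> I"
    unfolding has_strong_integral_def by blast
  from assms(2) obtain t where g: "strongly_measurable M g" and
    t: "\<And>i. simple_bochner_integrable M (t i)"
      "(\<lambda>i. L1_dist M g (t i)) \<longlonglongrightarrow> 0"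
      "(\<lambda>i. simple_bochner_integral M (t i)) \<longlonglongrightarrow> J"
    unfolding has_strong_integral_def by blast
  show ?thesis
    unfolding has_strong_integral_def
  proof (intro conjI exI[of _ "\<lambda>i x. s i x + t i x"] allI)
    show "strongly_measurable M (\<lambda>x. f x + g x)" using f g by (rule strongly_measurable_add)
    show "simple_bochner_integrable M (\<lambda>x. s i x + t i x)" for i
      using simple_bochner_integrable_compose2[of "(+)" M "s i" "t i"] s(1) t(1) by simp
    show "(\<lambda>i. simple_bochner_integral M (\<lambda>x. s i x + t i x)) \<longlonglongrightarrow> I + J"
      using tendsto_add[OF s(3) t(3)] by (simp add: simple_bochner_integral_add s t)
    have "(\<lambda>i. L1_dist M f (s i) + L1_dist M g (t i)) \<longlonglongrightarrow> 0"
      using tendsto_add[OF s(2) t(2)] by simp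
    note lim = this
    show "(\<lambda>i. L1_norm M (\<lambda>x. f x + g x - (s i x + t i x))) \<longlonglongrightarrow> 0"
    proof (rule tendsto_sandwich[OF _ _ tendsto_const lim])
      have "L1_norm M (\<lambda>x. f x + g x - (s i x + t i x)) \<le>
          L1_dist M f (s i) + L1_dist M g (t i)" for i
        using nn_integral_norm_triangle[of M "\<lambda>x. f x + g x" "\<lambda>x. s i x + t i x" "\<lambda>x. f x + t i x"]
          f g simple_strongly_measurable[OF s(1)]
          simple_strongly_measurable[OF t(1)]
        by (simp add: strongly_measurable_add norm_minus_commute[of "t i _"] add.commute)
      then show "\<forall>\<^sub>F i in sequentially. L1_norm M (\<lambda>x. f x + g x - (s i x + t i x)) \<le>
          L1_dist M f (s i) + L1_dist M g (t i)"
        by simp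
    qed simp
  qed
qed

lemma has_strong_integral_diff:
  assumes f: "has_strong_integral M f I" and g: "has_strong_integral M g J"
  shows "has_strong_integral M (\<lambda>x. f x - g x) (I - J)"
  using has_strong_integral_add[OF f
      has_strong_integral_linear[OF g bounded_linear_minus[OF bounded_linear_ident]]]
  by simp

lemma has_strong_integral_zero: "has_strong_integral M (\<lambda>_. 0) 0"
  using has_strong_integral_simple[OF simple_bochner_integral_zero(1)]
  by (simp add: simple_bochner_integral_zero)

lemma has_strong_integral_sum:
  assumes "\<And>i. i \<in> A \<Longrightarrow> has_strong_integral M (f i) (I i)"
  shows "has_strong_integral M (\<lambda>x. \<Sum>i\<in>A. f i x) (\<Sum>i\<in>A. I i)"
  using assms
  by (induction A rule: infinite_finite_induct)
     (auto intro: has_strong_integral_zero has_strong_integral_add)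

lemma has_strong_integral_cong_AE:
  assumes "has_strong_integral M f I" and g: "strongly_measurable M g"
    and ae: "AE x in M. f x = g x"
  shows "has_strong_integral M g I"
proof -
  have "L1_dist M g s = L1_dist M f s" for s
    using ae by (intro nn_integral_cong_AE) (auto elim: eventually_mono)
  with assms(1) g show ?thesis
    unfolding has_strong_integral_def by simp
qed

text \<open>The approximating simple functions may be composed with \<open>T\<close> because
  \<open>T\<close> preserves the measure of every level set. It is applied to translations, to the
  coordinate swap and to the change of coordinates in the triple integral.\<close>

lemma has_strong_integral_distr:
  fixes f :: "'b \<Rightarrow> 'a::real_normed_vector"
  assumes f: "has_strong_integral N f I" and T: "T \<in> measurable M N" and N: "distr M N T = N"
  shows "has_strong_integral M (\<lambda>x. f (T x)) I"
proof -
  from assms(1) obtain s where f: "strongly_measurable N f"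
    and s: "\<And>i. simple_bochner_integrable N (s i)"
      "(\<lambda>i. L1_dist N f (s i)) \<longlonglongrightarrow> 0"
      "(\<lambda>i. simple_bochner_integral N (s i)) \<longlonglongrightarrow> I"
    unfolding has_strong_integral_def by blast
  have em: "emeasure M (T -` A \<inter> space M) = emeasure N A" if "A \<in> sets N" for A
    using emeasure_distr[OF T that] N by simp
  have simp: "simple_function N (s i)" for i
    using s(1) by (rule simple_bochner_simple)
  then have [measurable]: "s i \<in> measurable N (count_space UNIV)" for i
    by (rule measurable_simple_function)
  have sf: "simple_function M (\<lambda>x. s i (T x))" for i
    using simple_function_comp[OF T simp] by (simp add: comp_def)
  have vimage: "T -` {x \<in> space N. s i x = y} \<inter> space M = {x \<in> space M. s i (T x) = y}"
    and vimage0: "T -` {x \<in> space N. s i x \<noteq> 0} \<inter> space M = {x \<in> space M. s i (T x) \<noteq> 0}" for i y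
    using measurable_space[OF T] by auto
  have sets: "{x \<in> space N. s i x = y} \<in> sets N" "{x \<in> space N. s i x \<noteq> 0} \<in> sets N" for i y
    by measurable
  have meas: "measure M {x \<in> space M. s i (T x) = y} = measure N {x \<in> space N. s i x = y}" for i y
    using em[OF sets(1)] unfolding vimage by (simp add: measure_def)
  have "simple_bochner_integrable M (\<lambda>x. s i (T x))" for i
    using em[OF sets(2)] s(1)[of i] sf unfolding vimage0
    by (simp add: simple_bochner_integrable.simps)
  moreover have "simple_bochner_integral M (\<lambda>x. s i (T x)) = simple_bochner_integral N (s i)" for i
    unfolding simple_bochner_integral_def
  proof (rule sum.mono_neutral_cong_left)
    show "finite (s i ` space N)" using simp by (simp add: simple_function_def)
    show "(\<lambda>x. s i (T x)) ` space M \<subseteq> s i ` space N" using measurable_space[OF T] by auto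
    \<comment> \<open>A value of \<open>s i\<close> that is not attained along \<open>T\<close> has
      a level set with empty preimage, hence of measure zero.\<close>
    show "\<forall>y\<in>s i ` space N - (\<lambda>x. s i (T x)) ` space M. measure N {x \<in> space N. s i x = y} *\<^sub>R y = 0"
    proof
      fix y assume "y \<in> s i ` space N - (\<lambda>x. s i (T x)) ` space M"
      then have "{x \<in> space M. s i (T x) = y} = {}" by blast
      then show "measure N {x \<in> space N. s i x = y} *\<^sub>R y = 0"
        unfolding meas[symmetric] by (simp only: measure_empty scaleR_zero_left)
    qed
  qed (simp add: meas)
  moreover have "L1_norm M (\<lambda>x. f (T x) - s i (T x)) =
      L1_dist N f (s i)" for i
  proof -
    have [measurable]: "(\<lambda>x. norm (f x - s i x)) \<in> borel_measurable N"
      by (intro strongly_measurable_norm strongly_measurable_diff f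
          simple_strongly_measurable s)
    have "(\<integral>\<^sup>+x. enorm (f x - s i x) \<partial>distr M N T) =
        L1_norm M (\<lambda>x. f (T x) - s i (T x))"
      by (rule nn_integral_distr[OF T]) simp
    then show ?thesis by (simp add: N)
  qed
  ultimately show ?thesis
    unfolding has_strong_integral_def using s(2,3) strongly_measurable_compose[OF f T]
    by (intro conjI exI[of _ "\<lambda>i x. s i (T x)"]) auto
qed

text \<open>The scalar factor is real-valued, so the Bochner integral is available for it; the
  bounded linear map that sends a real number to its multiple of \<open>v\<close> transfers the
  result.\<close>

lemma has_strong_integral_scaleR_const:
  fixes g :: "'b \<Rightarrow> real" and v :: "'a::real_normed_vector"
  assumes "integrable M g"
  shows "has_strong_integral M (\<lambda>x. g x *\<^sub>R v) ((\<integral>x. g x \<partial>M) *\<^sub>R v)"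
proof -
  have "has_bochner_integral M g (\<integral>x. g x \<partial>M)"
    using assms by (rule has_bochner_integral_integrable)
  then have "has_strong_integral M g (\<integral>x. g x \<partial>M)"
    unfolding has_strong_integral_def has_bochner_integral.simps
    by (auto intro: strongly_measurable_real)
  from has_strong_integral_linear[OF this bounded_linear_scaleR_left] show ?thesis .
qed

lemma strongly_integrable_bound:
  assumes "strongly_integrable M f" "strongly_measurable M g" "AE x in M. norm (g x) \<le> norm (f x)"
  shows "strongly_integrable M g"
proof -
  have "L1_norm M g \<le> L1_norm M f"
    using assms(3) by (intro nn_integral_mono_AE) (auto elim: eventually_mono intro: ennreal_leI)
  with assms show ?thesis by (auto simp: strongly_integrable_def)
qed

lemma strong_integral_tendsto:
  assumes "\<And>i. has_strong_integral M (f i) (J i)" and "has_strong_integral M g I"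
    and lim: "(\<lambda>i. L1_dist M g (f i)) \<longlonglongrightarrow> 0"
  shows "J \<longlonglongrightarrow> I"
proof (rule ennreal_norm_tendsto_zeroD[OF _ lim])
  show "enorm (J i - I) \<le> L1_dist M g (f i)" for i
    using has_strong_integral_norm_le[OF has_strong_integral_diff[OF assms(2,1)]]
    by (simp add: norm_minus_commute)
qed

lemma nn_integral_norm_dominated_convergence:
  assumes f: "\<And>i. strongly_measurable M (f i)" and g: "strongly_measurable M g"
    and lim: "AE x in M. (\<lambda>i. f i x) \<longlonglongrightarrow> g x"
    and w: "w \<in> borel_measurable M" "(\<integral>\<^sup>+x. ennreal (w x) \<partial>M) < \<infinity>"
    and bound: "\<And>i. AE x in M. norm (f i x) \<le> w x"
  shows "AE x in M. norm (g x) \<le> w x"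
    "(\<lambda>i. L1_dist M g (f i)) \<longlonglongrightarrow> 0"
proof -
  have "AE x in M. \<forall>i. norm (f i x) \<le> w x"
    using bound by (simp add: AE_all_countable)
  with lim show gw: "AE x in M. norm (g x) \<le> w x"
    by eventually_elim (auto intro: LIMSEQ_le_const2[OF tendsto_norm])
  have "(\<lambda>i. L1_dist M g (f i)) \<longlonglongrightarrow> (\<integral>\<^sup>+x. 0 \<partial>M)"
  proof (rule nn_integral_dominated_convergence[where w="\<lambda>x. ennreal (2 * w x)"])
    show "(\<lambda>x. enorm (g x - f i x)) \<in> borel_measurable M" for i
      using strongly_measurable_norm[OF strongly_measurable_diff[OF g f]] by simp
    show "(\<lambda>x. ennreal (2 * w x)) \<in> borel_measurable M" using w by simp
    have "(\<lambda>x. ennreal (2 * w x)) = (\<lambda>x. 2 * ennreal (w x))"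
      by (simp add: fun_eq_iff ennreal_mult')
    then show "(\<integral>\<^sup>+x. ennreal (2 * w x) \<partial>M) < \<infinity>"
      using w by (simp add: nn_integral_cmult ennreal_mult_less_top)
    show "AE x in M. enorm (g x - f i x) \<le> ennreal (2 * w x)" for i
      using gw bound[of i]
    proof eventually_elim
      case (elim x)
      then show ?case using norm_triangle_ineq4[of "g x" "f i x"] by (intro ennreal_leI) simp
    qed
    show "AE x in M. (\<lambda>i. enorm (g x - f i x)) \<longlonglongrightarrow> 0"
      using lim
    proof eventually_elim
      case (elim x)
      then have "(\<lambda>i. norm (g x - f i x)) \<longlonglongrightarrow> norm (g x - g x)"
        by (intro tendsto_intros)
      from tendsto_ennrealI[OF this] show "(\<lambda>i. enorm (g x - f i x)) \<longlonglongrightarrow> 0"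
        by simp
    qed
  qed simp
  then show "(\<lambda>i. L1_dist M g (f i)) \<longlonglongrightarrow> 0" by simp
qed

lemma strong_integral_dominated_convergence:
  fixes f :: "nat \<Rightarrow> 'b \<Rightarrow> 'a::banach"
  assumes f: "\<And>i. has_strong_integral M (f i) (J i)" and g: "strongly_measurable M g"
    and lim: "AE x in M. (\<lambda>i. f i x) \<longlonglongrightarrow> g x"
    and w: "w \<in> borel_measurable M" "(\<integral>\<^sup>+x. ennreal (w x) \<partial>M) < \<infinity>"
    and bound: "\<And>i. AE x in M. norm (f i x) \<le> w x"
  shows "strongly_integrable M g" "J \<longlonglongrightarrow> strong_integral M g"
proof -
  have fm: "strongly_measurable M (f i)" for i using f by (simp add: has_strong_integral_def)
  note dominated = nn_integral_norm_dominated_convergence[OF fm g lim w bound]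
  have "L1_norm M g \<le> (\<integral>\<^sup>+x. ennreal (w x) \<partial>M)"
    using dominated(1) by (intro nn_integral_mono_AE) (auto elim: eventually_mono intro: ennreal_leI)
  with g w show *: "strongly_integrable M g" by (auto simp: strongly_integrable_def)
  show "J \<longlonglongrightarrow> strong_integral M g"
    using strong_integral_tendsto[OF f strong_integralI[OF *] dominated(2)] .
qed

lemma strongly_integrable_diff:
  fixes f g :: "'b \<Rightarrow> 'a::banach"
  assumes "strongly_integrable M f" "strongly_integrable M g"
  shows "strongly_integrable M (\<lambda>x. f x - g x)"
  using has_strong_integralD[OF has_strong_integral_diff[OF
      strong_integralI[OF assms(1)] strong_integralI[OF assms(2)]]] .

lemma strongly_integrable_add:
  fixes f g :: "'b \<Rightarrow> 'a::banach"
  assumes "strongly_integrable M f" "strongly_integrable M g"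
  shows "strongly_integrable M (\<lambda>x. f x + g x)"
  using has_strong_integralD[OF has_strong_integral_add[OF
      strong_integralI[OF assms(1)] strong_integralI[OF assms(2)]]] .

lemma has_strong_integral_AE_zero:
  assumes "has_strong_integral M f I" and "AE x in M. f x = 0"
  shows "I = 0"
  using has_strong_integral_cong_AE[OF assms(1) strongly_measurable_const assms(2)]
    has_strong_integral_zero has_strong_integral_unique by metis

lemma has_strong_integral_cong:
  assumes "\<And>x. x \<in> space M \<Longrightarrow> f x = g x"
  shows "has_strong_integral M f I \<longleftrightarrow> has_strong_integral M g I"
proof -
  have *: "has_strong_integral M g I"
    if "has_strong_integral M f I" "\<And>x. x \<in> space M \<Longrightarrow> f x = g x" for f g :: "'a \<Rightarrow> 'b"
    using that(1)
  proof (rule has_strong_integral_cong_AE)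
    show "strongly_measurable M g"
      using that strongly_measurable_cong[of M f g] by (auto simp: has_strong_integral_def)
  qed (auto intro: AE_I2 that(2))
  show ?thesis using *[of f g] *[of g f] assms by auto
qed

lemma has_strong_integral_iff:
  fixes f :: "'b \<Rightarrow> 'a::banach"
  shows "has_strong_integral M f I \<longleftrightarrow> strongly_integrable M f \<and> strong_integral M f = I"
  using strong_integralI strong_integral_eq has_strong_integralD
  by metis

section \<open>Fubini's theorem for the strong integral\<close>

lemma strongly_measurable_Pair1:
  assumes "strongly_measurable (M1 \<Otimes>\<^sub>M M2) F" "x \<in> space M1"
  shows "strongly_measurable M2 (\<lambda>y. F (x, y))"
  using strongly_measurable_compose[OF assms(1) measurable_Pair1'[OF assms(2)]] .

context pair_sigma_finite
begin

text \<open>The level set of a nonzero value has finite measure, so Fubini's theorem applies to its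
  real indicator; the finitely many values are then summed.\<close>

lemma has_strong_integral_simple_fst:
  assumes s: "simple_bochner_integrable (M1 \<Otimes>\<^sub>M M2) s"
  shows "has_strong_integral M1 (\<lambda>x. simple_bochner_integral M2 (\<lambda>y. s (x, y)))
    (simple_bochner_integral (M1 \<Otimes>\<^sub>M M2) s)"
proof -
  let ?P = "M1 \<Otimes>\<^sub>M M2"
  have sf: "simple_function ?P s" and fin: "emeasure ?P {p \<in> space ?P. s p \<noteq> 0} \<noteq> \<infinity>"
    using s by (auto simp: simple_bochner_integrable.simps)
  have [simp]: "finite (s ` space ?P)" using sf by (simp add: simple_function_def)
  have [measurable]: "s \<in> measurable ?P (count_space UNIV)"
    using sf by (rule measurable_simple_function)
  have "has_strong_integral M1 (\<lambda>x. measure M2 {y \<in> space M2. s (x, y) = v} *\<^sub>R v)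
      (measure ?P {p \<in> space ?P. s p = v} *\<^sub>R v)" for v
  proof (cases "v = 0")
    case True
    then show ?thesis by (simp add: has_strong_integral_zero)
  next
    case False
    define A where "A = {p \<in> space ?P. s p = v}"
    have A[measurable]: "A \<in> sets ?P" unfolding A_def by measurable
    have "emeasure ?P A \<le> emeasure ?P {p \<in> space ?P. s p \<noteq> 0}"
      using False by (intro emeasure_mono) (auto simp: A_def)
    then have "emeasure ?P A < \<infinity>" using fin by (simp add: less_top top_unique)
    then have int: "integrable ?P (indicator A :: _ \<Rightarrow> real)" by simp
    have eq: "(\<integral>y. indicator A (x, y) \<partial>M2) = measure M2 {y \<in> space M2. s (x, y) = v}"
      if "x \<in> space M1" for x
    proof -
      have "(\<integral>y. indicator A (x, y) \<partial>M2) = (\<integral>y. indicat_real {y \<in> space M2. s (x, y) = v} y \<partial>M2)"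
        using that by (intro Bochner_Integration.integral_cong)
          (auto simp: A_def indicator_def space_pair_measure)
      then show ?thesis by (auto intro!: arg_cong[where f="measure M2"])
    qed
    have "has_strong_integral M1 (\<lambda>x. (\<integral>y. indicator A (x, y) \<partial>M2) *\<^sub>R v)
        ((\<integral>x. (\<integral>y. indicator A (x, y) \<partial>M2) \<partial>M1) *\<^sub>R v)"
      by (intro has_strong_integral_scaleR_const integrable_fst' int)
    moreover have "(\<integral>x. (\<integral>y. indicator A (x, y) \<partial>M2) \<partial>M1) = measure ?P A"
      using integral_fst'[OF int] sets.sets_into_space[OF A] by (simp add: Int_absorb2)
    ultimately have "has_strong_integral M1 (\<lambda>x. (\<integral>y. indicator A (x, y) \<partial>M2) *\<^sub>R v)
        (measure ?P A *\<^sub>R v)"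
      by simp
    then show ?thesis
      unfolding A_def[symmetric] by (simp add: eq cong: has_strong_integral_cong)
  qed
  then have "has_strong_integral M1
      (\<lambda>x. \<Sum>v\<in>s ` space ?P. measure M2 {y \<in> space M2. s (x, y) = v} *\<^sub>R v)
      (simple_bochner_integral ?P s)"
    unfolding simple_bochner_integral_def by (rule has_strong_integral_sum)
  moreover have "simple_bochner_integral M2 (\<lambda>y. s (x, y)) =
      (\<Sum>v\<in>s ` space ?P. measure M2 {y \<in> space M2. s (x, y) = v} *\<^sub>R v)" if x: "x \<in> space M1" for x
    unfolding simple_bochner_integral_def
  proof (rule sum.mono_neutral_left)
    show "(\<lambda>y. s (x, y)) ` space M2 \<subseteq> s ` space ?P"
      using x by (auto simp: space_pair_measure)
    show "\<forall>v\<in>s ` space ?P - (\<lambda>y. s (x, y)) ` space M2.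
        measure M2 {y \<in> space M2. s (x, y) = v} *\<^sub>R v = 0"
    proof
      fix v assume "v \<in> s ` space ?P - (\<lambda>y. s (x, y)) ` space M2"
      then have "{y \<in> space M2. s (x, y) = v} = {}" by blast
      then show "measure M2 {y \<in> space M2. s (x, y) = v} *\<^sub>R v = 0"
        by (simp only: measure_empty scaleR_zero_left)
    qed
  qed simp
  ultimately show ?thesis by (simp cong: has_strong_integral_cong)
qed

text \<open>Dominated convergence is used twice along simple functions with
  \<open>norm (s i p) <= 2 * norm (F p)\<close>: in \<open>y\<close> for fixed \<open>x\<close>, and
  then in \<open>x\<close>.\<close>

theorem has_strong_integral_fst:
  fixes F :: "'a \<times> 'b \<Rightarrow> 'c::banach"
  assumes F: "strongly_integrable (M1 \<Otimes>\<^sub>M M2) F"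
  shows "has_strong_integral M1 (\<lambda>x. strong_integral M2 (\<lambda>y. F (x, y)))
    (strong_integral (M1 \<Otimes>\<^sub>M M2) F)"
proof -
  let ?P = "M1 \<Otimes>\<^sub>M M2"
  from F have Fm: "strongly_measurable ?P F"
    and fin: "(\<integral>\<^sup>+p. enorm (F p) \<partial>?P) < \<infinity>"
    by (auto simp: strongly_integrable_def)
  note [measurable] = strongly_measurable_norm[OF Fm]
  obtain s where s: "\<And>i. simple_bochner_integrable ?P (s i)"
    "\<And>p. p \<in> space ?P \<Longrightarrow> (\<lambda>i. s i p) \<longlonglongrightarrow> F p" "\<And>i p. norm (s i p) \<le> 2 * norm (F p)"
    "(\<lambda>i. \<integral>\<^sup>+p. enorm (F p - s i p) \<partial>?P) \<longlonglongrightarrow> 0"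
    using strongly_integrable_approx[OF F] by blast
  define w where "w x = L1_norm M2 (\<lambda>y. F (x, y))" for x
  define G where "G = {x \<in> space M1. w x < \<infinity>}"
  define J where "J x = strong_integral M2 (\<lambda>y. F (x, y))" for x
  define Js where "Js i x = simple_bochner_integral M2 (\<lambda>y. s i (x, y))" for i x
  have w[measurable]: "w \<in> borel_measurable M1"
    unfolding w_def by measurable
  have G[measurable]: "G \<in> sets M1" unfolding G_def by measurable
  have w_int: "(\<integral>\<^sup>+x. w x \<partial>M1) < \<infinity>"
    using fin M2.nn_integral_fst[of "\<lambda>p. enorm (F p)" M1] unfolding w_def by simp
  then have AE_G: "AE x in M1. x \<in> G"
    using nn_integral_noteq_infinite[OF w] by (auto simp: G_def less_top)
  have sm: "strongly_measurable M2 (\<lambda>y. F (x, y))" if "x \<in> space M1" for x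
    using strongly_measurable_Pair1[OF Fm that] .
  have s_le: "enorm (s i p) \<le> 2 * enorm (F p)" for i p
    using ennreal_leI[OF s(3)[of i p]] by (simp add: ennreal_mult')
  have Js: "has_strong_integral M2 (\<lambda>y. s i (x, y)) (Js i x)" if "x \<in> G" for i x
    unfolding Js_def
  proof (intro has_strong_integral_simple simple_bochner_integrableI_bounded)
    have x: "x \<in> space M1" using that by (simp add: G_def)
    show "simple_function M2 (\<lambda>y. s i (x, y))"
      using simple_function_comp[OF measurable_Pair1'[OF x] simple_bochner_simple[OF s(1)]]
      by (simp add: comp_def)
    have "L1_norm M2 (\<lambda>y. s i (x, y)) \<le> (\<integral>\<^sup>+y. 2 * enorm (F (x, y)) \<partial>M2)"
      by (intro nn_integral_mono s_le)
    also have "\<dots> = 2 * w x"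
      unfolding w_def using strongly_measurable_norm[OF sm[OF x]] by (simp add: nn_integral_cmult)
    also have "\<dots> < \<infinity>" using that by (simp add: G_def ennreal_mult_less_top)
    finally show "L1_norm M2 (\<lambda>y. s i (x, y)) < \<infinity>" .
  qed
  have lim: "(\<lambda>i. Js i x) \<longlonglongrightarrow> J x" and Jx: "strongly_integrable M2 (\<lambda>y. F (x, y))" if "x \<in> G" for x
  proof -
    have x: "x \<in> space M1" using that by (simp add: G_def)
    note 1 = strongly_measurable_norm[OF sm[OF x]]
    have 2: "(\<integral>\<^sup>+y. ennreal (2 * norm (F (x, y))) \<partial>M2) < \<infinity>"
      using that 1 by (simp add: G_def w_def ennreal_mult' nn_integral_cmult ennreal_mult_less_top)
    have "AE y in M2. (\<lambda>i. s i (x, y)) \<longlonglongrightarrow> F (x, y)"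
      using x by (intro AE_I2 s(2)) (simp add: space_pair_measure)
    from strong_integral_dominated_convergence[OF Js[OF that] sm[OF x] this _ 2] 1 s(3)
    show "(\<lambda>i. Js i x) \<longlonglongrightarrow> J x" "strongly_integrable M2 (\<lambda>y. F (x, y))"
      by (auto simp: J_def)
  qed
  have Js_int: "has_strong_integral M1 (Js i) (simple_bochner_integral ?P (s i))" for i
    unfolding Js_def by (rule has_strong_integral_simple_fst[OF s(1)])
  have J_sm: "strongly_measurable M1 J"
  proof (rule strongly_measurable_LIMSEQ)
    show "strongly_measurable M1 (\<lambda>x. indicat_real G x *\<^sub>R Js i x)" for i
      using Js_int[of i] by (intro strongly_measurable_scaleR) (auto simp: has_strong_integral_def)
    \<comment> \<open>Off \<open>G\<close> the section is not integrable, and the default value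
      \<open>0\<close> of \<open>J\<close> agrees with the cut-off; so the limit holds at every
      point and not just almost everywhere.\<close>
    show "(\<lambda>i. indicat_real G x *\<^sub>R Js i x) \<longlonglongrightarrow> J x" if "x \<in> space M1" for x
    proof (cases "x \<in> G")
      case True
      then show ?thesis using lim by simp
    next
      case False
      then have "\<not> strongly_integrable M2 (\<lambda>y. F (x, y))"
        using that by (auto simp: G_def strongly_integrable_def w_def)
      with False show ?thesis by (simp add: J_def strong_integral_not_integrable)
    qed
  qed
  \<comment> \<open>\<open>enn2real\<close> produces a real dominating function; on
    \<open>G\<close>, where \<open>w\<close> is finite, it loses nothing.\<close>
  define W where "W x = enn2real (2 * w x)" for x
  have W: "(\<integral>\<^sup>+x. ennreal (W x) \<partial>M1) < \<infinity>"
  proof -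
    have "(\<integral>\<^sup>+x. ennreal (W x) \<partial>M1) \<le> (\<integral>\<^sup>+x. 2 * w x \<partial>M1)"
      by (intro nn_integral_mono) (simp add: W_def ennreal_enn2real_if)
    also have "\<dots> < \<infinity>" using w_int by (simp add: nn_integral_cmult ennreal_mult_less_top)
    finally show ?thesis .
  qed
  have bound: "AE x in M1. norm (Js i x) \<le> W x" for i
    using AE_G
  proof eventually_elim
    case (elim x)
    have "enorm (Js i x) \<le> L1_norm M2 (\<lambda>y. s i (x, y))"
      using Js[OF elim] by (rule has_strong_integral_norm_le)
    also have "\<dots> \<le> (\<integral>\<^sup>+y. 2 * enorm (F (x, y)) \<partial>M2)"
      by (intro nn_integral_mono s_le)
    also have "\<dots> = 2 * w x"
      unfolding w_def using strongly_measurable_norm[OF sm] elim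
      by (simp add: nn_integral_cmult G_def)
    finally have "enorm (Js i x) \<le> 2 * w x" .
    moreover have "2 * w x < \<infinity>" using elim by (simp add: G_def ennreal_mult_less_top)
    ultimately show ?case
      unfolding W_def by (metis enn2real_ennreal enn2real_mono infinity_ennreal_def norm_ge_zero)
  qed
  have W_meas: "W \<in> borel_measurable M1" unfolding W_def by measurable
  have limAE: "AE x in M1. (\<lambda>i. Js i x) \<longlonglongrightarrow> J x"
    using AE_G by eventually_elim (rule lim)
  note DCT = strong_integral_dominated_convergence[OF Js_int J_sm limAE W_meas W bound]
  moreover have "(\<lambda>i. simple_bochner_integral ?P (s i)) \<longlonglongrightarrow> strong_integral ?P F"
    using strong_integralI[OF F] s(4)
    by (rule strong_integral_tendsto[OF has_strong_integral_simple[OF s(1)]])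
  ultimately have "strong_integral M1 J = strong_integral ?P F"
    using LIMSEQ_unique by blast
  then show ?thesis
    using strong_integralI[OF DCT(1)] by (simp add: J_def[abs_def])
qed

lemma AE_strongly_integrable_fst:
  assumes F: "strongly_integrable (M1 \<Otimes>\<^sub>M M2) F"
  shows "AE x in M1. strongly_integrable M2 (\<lambda>y. F (x, y))"
proof -
  have Fm: "strongly_measurable (M1 \<Otimes>\<^sub>M M2) F"
    and fin: "L1_norm (M1 \<Otimes>\<^sub>M M2) (\<lambda>p. F p) < \<infinity>"
    using F by (auto simp: strongly_integrable_def)
  note [measurable] = strongly_measurable_norm[OF Fm]
  have w[measurable]: "(\<lambda>x. L1_norm M2 (\<lambda>y. F (x, y))) \<in> borel_measurable M1"
    by measurable
  have "(\<integral>\<^sup>+x. L1_norm M2 (\<lambda>y. F (x, y)) \<partial>M1) < \<infinity>"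
    using fin M2.nn_integral_fst[of "\<lambda>p. enorm (F p)" M1] by simp
  then have "AE x in M1. L1_norm M2 (\<lambda>y. F (x, y)) \<noteq> \<infinity>"
    by (intro nn_integral_noteq_infinite) auto
  then show ?thesis
    using AE_space
    by eventually_elim (auto simp: strongly_integrable_def less_top strongly_measurable_Pair1[OF Fm])
qed

end

section \<open>Functions with vanishing integrals\<close>

lemma strongly_integrable_indicator:
  assumes "strongly_integrable M f" and [measurable]: "A \<in> sets M"
  shows "strongly_integrable M (\<lambda>x. indicat_real A x *\<^sub>R f x)"
  using assms(1)
proof (rule strongly_integrable_bound)
  show "strongly_measurable M (\<lambda>x. indicat_real A x *\<^sub>R f x)"
    using assms by (intro strongly_measurable_scaleR) (auto simp: strongly_integrable_def)
qed (auto simp: indicator_def)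

text \<open>On \<open>E d\<close> the function \<open>K\<close> stays within
  \<open>norm d / 2\<close> of \<open>d\<close>, so a vanishing integral forces
  \<open>measure N (E d) * norm d\<close> to be at most half of itself. The range of
  \<open>K\<close> is separable, hence countably many \<open>E d\<close> cover the set where
  \<open>K\<close> is nonzero.\<close>

lemma AE_zero_if_strong_integrals_zero:
  fixes K :: "'b \<Rightarrow> 'a::banach"
  assumes K: "strongly_integrable N K"
    and zero: "\<And>D. D \<in> sets N \<Longrightarrow> strong_integral N (\<lambda>x. indicat_real D x *\<^sub>R K x) = 0"
  shows "AE x in N. K x = 0"
proof -
  from K have Km: "strongly_measurable N K" and fin: "L1_norm N K < \<infinity>"
    by (auto simp: strongly_integrable_def)
  obtain D where D: "countable D" "K ` space N \<subseteq> closure D"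
    using strongly_measurable_separable[OF Km] .
  define E where "E d = {x \<in> space N. norm (K x - d) < norm d / 2}" for d
  have [measurable]: "E d \<in> sets N" for d
    unfolding E_def
    using strongly_measurable_norm[OF strongly_measurable_diff[OF Km strongly_measurable_const]]
    by measurable
  have "emeasure N (E d) = 0" for d
  proof (cases "d = 0")
    case True
    then show ?thesis by (simp add: E_def)
  next
    case False
    define r where "r = norm d / 2"
    have r: "0 < r" using False by (simp add: r_def)
    have "ennreal r * emeasure N (E d) = (\<integral>\<^sup>+x. ennreal r * indicator (E d) x \<partial>N)"
      by (simp add: nn_integral_cmult)
    \<comment> \<open>\<open>norm (K x)\<close> is at least \<open>norm d / 2\<close> on
      \<open>E d\<close>, so integrability of \<open>K\<close> makes the measure of
      \<open>E d\<close> finite.\<close>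
    also have "\<dots> \<le> L1_norm N K"
    proof (rule nn_integral_mono)
      fix x
      have "r \<le> norm (K x)" if "x \<in> E d"
        using that norm_triangle_ineq2[of d "d - K x"] by (simp add: E_def r_def norm_minus_commute)
      then show "ennreal r * indicator (E d) x \<le> enorm (K x)"
        by (auto simp: indicator_def ennreal_leI)
    qed
    also note fin
    finally have finE: "emeasure N (E d) < \<infinity>"
      using r by (auto simp: ennreal_mult_less_top)
    then have "has_strong_integral N (\<lambda>x. indicat_real (E d) x *\<^sub>R d) (measure N (E d) *\<^sub>R d)"
      using has_strong_integral_scaleR_const[of N "indicat_real (E d)" d]
        sets.sets_into_space[of "E d" N] by (simp add: Int_absorb2)
    moreover have "has_strong_integral N (\<lambda>x. indicat_real (E d) x *\<^sub>R K x) 0"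
      using strong_integralI[OF strongly_integrable_indicator[OF K, of "E d"]]
        zero[of "E d"] by simp
    ultimately have "has_strong_integral N
        (\<lambda>x. indicat_real (E d) x *\<^sub>R K x - indicat_real (E d) x *\<^sub>R d) (0 - measure N (E d) *\<^sub>R d)"
      by (rule has_strong_integral_diff[rotated])
    from has_strong_integral_norm_le[OF this]
    have "ennreal (measure N (E d) * norm d) \<le>
        L1_norm N (\<lambda>x. indicat_real (E d) x *\<^sub>R K x - indicat_real (E d) x *\<^sub>R d)"
      by simp
    also have "\<dots> \<le> (\<integral>\<^sup>+x. ennreal r * indicator (E d) x \<partial>N)"
      by (intro nn_integral_mono) (auto simp: indicator_def E_def r_def intro!: ennreal_leI)
    also have "\<dots> = ennreal (r * measure N (E d))"
      using finE r by (simp add: nn_integral_cmult emeasure_eq_ennreal_measure less_top ennreal_mult')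
    finally have "measure N (E d) * norm d \<le> r * measure N (E d)"
      using r by (simp add: ennreal_le_iff)
    then have "measure N (E d) = 0"
      using r unfolding r_def by (simp add: mult.commute[of "norm d"] mult_le_0_iff measure_le_0_iff)
    with finE show ?thesis by (simp add: emeasure_eq_ennreal_measure less_top)
  qed
  then have "AE x in N. \<forall>d\<in>D. x \<notin> E d"
    using D(1) by (intro AE_ball_countable[THEN iffD2] ballI AE_not_in null_setsI) auto
  with AE_space show ?thesis
  proof eventually_elim
    case (elim x)
    show ?case
    proof (rule ccontr)
      assume "K x \<noteq> 0"
      have "K x \<in> closure D" using D(2) elim(1) by auto
      \<comment> \<open>With \<open>1/3\<close> the norm of \<open>d\<close> exceeds two thirds of
        \<open>norm (K x)\<close>, so \<open>K x\<close> lies within \<open>norm d / 2\<close> of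
        \<open>d\<close>.\<close>
      then obtain d where d: "d \<in> D" "dist d (K x) < norm (K x) / 3"
        using \<open>K x \<noteq> 0\<close> unfolding closure_approachable by (metis divide_pos_pos zero_less_norm_iff zero_less_numeral)
      then have "norm (K x - d) < norm d / 2"
        using norm_triangle_ineq2[of "K x" "K x - d"] by (simp add: dist_norm norm_minus_commute)
      with elim d(1) show False by (auto simp: E_def)
    qed
  qed
qed

text \<open>A pi-lambda argument: complements are handled by \<open>\<Omega>\<close> lying in
  \<open>G\<close>, disjoint unions by dominated convergence. The map \<open>T\<close> allows it to
  be run on one factor of a product at a time.\<close>

lemma strong_integral_zero_sigma_sets:
  fixes K :: "'b \<Rightarrow> 'a::banach"
  assumes K: "strongly_integrable N K"
    and G: "Int_stable G" "G \<subseteq> Pow \<Omega>" "\<Omega> \<in> G"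
    and T: "T \<in> measurable N (sigma \<Omega> G)"
    and zero: "\<And>B. B \<in> G \<Longrightarrow> strong_integral N (\<lambda>x. indicat_real B (T x) *\<^sub>R K x) = 0"
    and B: "B \<in> sigma_sets \<Omega> G"
  shows "strong_integral N (\<lambda>x. indicat_real B (T x) *\<^sub>R K x) = 0"
proof -
  have TO: "T x \<in> \<Omega>" if "x \<in> space N" for x
    using measurable_space[OF T that] G(2) by (simp add: space_measure_of)
  have int: "strongly_integrable N (\<lambda>x. indicat_real B (T x) *\<^sub>R K x)"
    if "B \<in> sigma_sets \<Omega> G" for B
  proof -
    have "T -` B \<inter> space N \<in> sets N"
      using measurable_sets[OF T, of B] that G(2) by (simp add: sets_measure_of)
    note 1 = strongly_integrable_indicator[OF K this]
    have eq: "indicat_real (T -` B \<inter> space N) x *\<^sub>R K x = indicat_real B (T x) *\<^sub>R K x"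
      if "x \<in> space N" for x
      using that by (simp add: indicator_def)
    show ?thesis
    proof (rule strongly_integrable_bound[OF 1])
      show "strongly_measurable N (\<lambda>x. indicat_real B (T x) *\<^sub>R K x)"
        using 1 strongly_measurable_cong[of N, OF eq] by (simp add: strongly_integrable_def)
      show "AE x in N. norm (indicat_real B (T x) *\<^sub>R K x) \<le> norm (indicat_real (T -` B \<inter> space N) x *\<^sub>R K x)"
        by (intro AE_I2) (simp add: eq)
    qed
  qed
  let ?P = "\<lambda>B. has_strong_integral N (\<lambda>x. indicat_real B (T x) *\<^sub>R K x) 0"
  have "?P B"
    using G(1,2) B
  proof (induction rule: sigma_sets_induct_disjoint)
    case (basic A)
    then show ?case
      using zero[of A] int[of A] by (simp add: has_strong_integral_iff sigma_sets.Basic)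
  next
    case empty
    then show ?case by (simp add: has_strong_integral_zero)
  next
    case (compl A)
    have "?P \<Omega>"
      using zero[OF G(3)] int[of \<Omega>] G(3) by (simp add: has_strong_integral_iff sigma_sets.Basic)
    from has_strong_integral_diff[OF this compl(2)]
    have "has_strong_integral N (\<lambda>x. indicat_real \<Omega> (T x) *\<^sub>R K x - indicat_real A (T x) *\<^sub>R K x) 0"
      by simp
    moreover have "indicat_real \<Omega> (T x) *\<^sub>R K x - indicat_real A (T x) *\<^sub>R K x =
        indicat_real (\<Omega> - A) (T x) *\<^sub>R K x" if "x \<in> space N" for x
      using TO[OF that] by (auto simp: indicator_def)
    ultimately show ?case by (simp cong: has_strong_integral_cong)
  next
    case (union A)
    have UN: "(\<Union>i. A i) \<in> sigma_sets \<Omega> G" using union(2) by (auto intro: sigma_sets.Union)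
    have 1: "has_strong_integral N (\<lambda>x. \<Sum>i<n. indicat_real (A i) (T x) *\<^sub>R K x) 0" for n
      using has_strong_integral_sum[of "{..<n}" N "\<lambda>i x. indicat_real (A i) (T x) *\<^sub>R K x" "\<lambda>_. 0"]
        union(3) by simp
    have sums: "(\<Sum>i<n. indicat_real (A i) (T x) *\<^sub>R K x) = indicat_real (\<Union>i<n. A i) (T x) *\<^sub>R K x" for n x
      using union(1)
      by (simp add: indicator_UN_disjoint disjoint_family_on_def flip: scaleR_sum_left)
    have lim: "(\<lambda>n. \<Sum>i<n. indicat_real (A i) (T x) *\<^sub>R K x) \<longlonglongrightarrow> indicat_real (\<Union>i. A i) (T x) *\<^sub>R K x" for x
      unfolding sums by (intro tendsto_scaleR tendsto_const LIMSEQ_indicator_UN)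
    have "(\<lambda>n::nat. 0) \<longlonglongrightarrow> strong_integral N (\<lambda>x. indicat_real (\<Union>i. A i) (T x) *\<^sub>R K x)"
    proof (rule strong_integral_dominated_convergence(2)[OF 1])
      show "strongly_measurable N (\<lambda>x. indicat_real (\<Union>i. A i) (T x) *\<^sub>R K x)"
        using int[OF UN] by (simp add: strongly_integrable_def)
      show "AE x in N. (\<lambda>n. \<Sum>i<n. indicat_real (A i) (T x) *\<^sub>R K x) \<longlonglongrightarrow>
          indicat_real (\<Union>i. A i) (T x) *\<^sub>R K x"
        by (intro AE_I2 lim)
      show "(\<lambda>x. norm (K x)) \<in> borel_measurable N" "L1_norm N K < \<infinity>"
        using K by (auto simp: strongly_integrable_def strongly_measurable_norm)
      show "AE x in N. norm (\<Sum>i<n. indicat_real (A i) (T x) *\<^sub>R K x) \<le> norm (K x)" for n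
        unfolding sums by (intro AE_I2) (simp add: indicator_def)
    qed
    then have "strong_integral N (\<lambda>x. indicat_real (\<Union>i. A i) (T x) *\<^sub>R K x) = 0"
      by (simp add: LIMSEQ_const_iff)
    with int[OF UN] show ?case by (simp add: has_strong_integral_iff)
  qed
  then show ?thesis by (rule strong_integral_eq)
qed

lemma sigma_pair_measure:
  "sigma_sets (space A \<times> space B) {a \<times> b | a b. a \<in> sets A \<and> b \<in> sets B} = sets (A \<Otimes>\<^sub>M B)"
  "sets (sigma (space A \<times> space B) {a \<times> b | a b. a \<in> sets A \<and> b \<in> sets B}) = sets (A \<Otimes>\<^sub>M B)"
  using pair_measure_closed[of A B] by (simp_all add: sets_pair_measure)

section \<open>Haar measure on a unimodular group\<close>

text \<open>The image of a countable dense subset of the domain is dense in the range, so the range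
  is separable whatever the target.\<close>

lemma strongly_measurable_continuous_on_UNIV:
  fixes f :: "'b::second_countable_topology \<Rightarrow> 'a::real_normed_vector"
  assumes f: "continuous_on UNIV f" and M: "sets M = sets borel"
  shows "strongly_measurable M f"
proof -
  obtain D :: "'b set" where D: "countable D" "\<And>X. open X \<Longrightarrow> X \<noteq> {} \<Longrightarrow> \<exists>d\<in>D. d \<in> X"
    by (erule countable_dense_setE)
  have "strongly_measurable borel f"
  proof (rule strongly_measurableI)
    show "f \<in> borel_measurable borel" using f by (rule borel_measurable_continuous_onI)
    show "countable (f ` D)" using D(1) by simp
    show "f ` space borel \<subseteq> closure (f ` D)"
    proof safe
      fix x
      show "f x \<in> closure (f ` D)"
        unfolding closure_approachable
      proof safe
        fix e :: real assume "0 < e"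
        have "open (f -` ball (f x) e)" using f by (intro open_vimage) auto
        moreover have "x \<in> f -` ball (f x) e" using \<open>0 < e\<close> by simp
        ultimately obtain d where "d \<in> D" "d \<in> f -` ball (f x) e" using D(2) by blast
        then show "\<exists>y\<in>f ` D. dist y (f x) < e" by (auto simp: dist_commute)
      qed
    qed
  qed
  then show ?thesis using strongly_measurable_cong_sets[OF M, of f] by simp
qed

text \<open>Cancellations between the coordinates \<open>z\<close>, \<open>- z + y\<close> and
  \<open>- y + x\<close> of the triple products.\<close>

lemma group_cancel:
  fixes x y z p :: "'g::group_add"
  shows "p + (- p + y) = y" "(- z + y) + (- y + x) = - z + x"
  "- (- z + y) + (- z + x) = - y + x"
  by (simp_all add: add.assoc minus_add)

locale unimodular_haar =
  fixes M :: "'g::{topological_group_add,t2_space,second_countable_topology} measure"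
  assumes locally_compact_group: "locally compact (UNIV :: 'g set)"
    and haar: "haar_measure M" and unimodular: "right_invariant M"
begin

lemma sets_M [measurable_cong]: "sets M = sets borel"
  using haar by (simp add: haar_measure_def)

lemma space_M [simp]: "space M = UNIV"
  using sets_eq_imp_space_eq[OF sets_M] by simp

lemma measurable_uminus_group [measurable (raw)]:
  fixes f :: "'b \<Rightarrow> 'g"
  assumes "f \<in> borel_measurable N"
  shows "(\<lambda>x. - f x) \<in> borel_measurable N"
  by (rule borel_measurable_continuous_on[OF _ assms]) (intro continuous_intros)

lemma norm_borel:
  "strongly_measurable M f \<Longrightarrow> (\<lambda>x. norm (f x)) \<in> borel_measurable borel"
  unfolding measurable_cong_sets[OF sets_M[symmetric] refl] by (rule strongly_measurable_norm)

lemma emeasure_compact: "compact K \<Longrightarrow> emeasure M K < \<infinity>"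
  using haar by (simp add: haar_measure_def)

lemma emeasure_open: "open U \<Longrightarrow> U \<noteq> {} \<Longrightarrow> 0 < emeasure M U"
  using haar by (simp add: haar_measure_def)

text \<open>Lindelof's theorem is applied to the open sets that lie in a compact subset of
  \<open>W\<close>. The case \<open>W = UNIV\<close> gives sigma-finiteness; general
  \<open>W\<close> gives exhaustion by compact sets from inside.\<close>

lemma open_cover_compact:
  fixes W :: "'g set"
  assumes "open W"
  obtains u v :: "nat \<Rightarrow> 'g set" where "\<And>i. open (u i)" "\<And>i. compact (v i)" "\<And>i. u i \<subseteq> v i"
    "\<And>i. v i \<subseteq> W" "(\<Union>i. u i) = W"
proof -
  define \<F> where "\<F> = {U. open U \<and> (\<exists>K. compact K \<and> U \<subseteq> K \<and> K \<subseteq> W)}"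
  have cover: "\<Union>\<F> = W"
  proof (intro set_eqI iffI)
    fix x assume "x \<in> W"
    then obtain U K where "openin (top_of_set UNIV) U" "compact K" "x \<in> U" "U \<subseteq> K" "K \<subseteq> W"
      using locally_compact_group assms unfolding locally_def by (metis openin_subtopology_self open_openin subtopology_UNIV)
    then show "x \<in> \<Union>\<F>" by (auto simp: \<F>_def)
  qed (auto simp: \<F>_def)
  obtain \<F>' where F': "\<F>' \<subseteq> \<F>" "countable \<F>'" "\<Union>\<F>' = \<Union>\<F>"
    by (rule Lindelof[of \<F>]) (auto simp: \<F>_def)
  \<comment> \<open>The inserted empty set keeps the enumeration valid when the cover is
    empty.\<close>
  define u where "u = from_nat_into (insert {} \<F>')"
  have range_u: "range u = insert {} \<F>'"
    unfolding u_def using F'(2) by (intro range_from_nat_into) auto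
  have "u i \<in> \<F>" for i
    using range_u F'(1) by (metis (no_types, lifting) \<F>_def compact_empty empty_subsetI insert_iff
        mem_Collect_eq open_empty rangeI subsetD)
  then have "\<forall>i. \<exists>K. open (u i) \<and> compact K \<and> u i \<subseteq> K \<and> K \<subseteq> W" by (auto simp: \<F>_def)
  then obtain v where "\<And>i. open (u i) \<and> compact (v i) \<and> u i \<subseteq> v i \<and> v i \<subseteq> W" by metis
  moreover have "(\<Union>i. u i) = W" using range_u F'(3) cover by simp
  ultimately show thesis by (intro that[of u v]) blast+
qed

lemma sigma_finite_M: "sigma_finite_measure M"
proof
  obtain u v :: "nat \<Rightarrow> 'g set" where uv: "\<And>i. open (u i)" "\<And>i. compact (v i)" "\<And>i. u i \<subseteq> v i"
    "\<And>i. v i \<subseteq> UNIV" "(\<Union>i. u i) = UNIV"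
    using open_cover_compact[OF open_UNIV] by blast
  show "\<exists>A. countable A \<and> A \<subseteq> sets M \<and> \<Union> A = space M \<and> (\<forall>a\<in>A. emeasure M a \<noteq> \<infinity>)"
  proof (intro exI conjI ballI)
    show "countable (range v)" by simp
    show "range v \<subseteq> sets M" using uv(2) by (auto simp: sets_M compact_imp_closed)
    show "\<Union> (range v) = space M" using UN_mono[of UNIV UNIV u v] uv(3,5) by auto
    show "emeasure M a \<noteq> \<infinity>" if "a \<in> range v" for a
      using that uv(2) emeasure_compact by (auto simp: less_top)
  qed
qed

sublocale sigma_finite_measure M
  by (rule sigma_finite_M)

sublocale pair_sigma_finite M M
  by (intro pair_sigma_finite.intro sigma_finite_M)

lemma sigma_finite_MM: "sigma_finite_measure (M \<Otimes>\<^sub>M M)"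
  by (rule sigma_finite_pair_measure) (rule sigma_finite_M)+

lemmas nn_integral_fst_M = sigma_finite_measure.nn_integral_fst[OF sigma_finite_M]
lemmas nn_integral_fst_MM = sigma_finite_measure.nn_integral_fst[OF sigma_finite_MM]

sublocale triple: pair_sigma_finite M "M \<Otimes>\<^sub>M M"
  by (intro pair_sigma_finite.intro sigma_finite_M sigma_finite_MM)

lemma distr_left: "distr M M (\<lambda>y. x + y) = M"
proof (rule measure_eqI)
  fix E assume "E \<in> sets (distr M M (\<lambda>y. x + y))"
  then have E: "E \<in> sets M" by simp
  have "(\<lambda>y. x + y) -` E \<inter> space M = (\<lambda>y. - x + y) ` E"
    by (auto intro: image_eqI[where x="x + _"])
  then show "emeasure (distr M M (\<lambda>y. x + y)) E = emeasure M E"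
    using haar E by (subst emeasure_distr) (auto simp: haar_measure_def)
qed simp

lemma distr_right: "distr M M (\<lambda>y. y + x) = M"
proof (rule measure_eqI)
  fix E assume "E \<in> sets (distr M M (\<lambda>y. y + x))"
  then have E: "E \<in> sets M" by simp
  have "(\<lambda>y. y + x) -` E \<inter> space M = (\<lambda>y. y + - x) ` E"
    by (auto intro: image_eqI[where x="_ + x"])
  then show "emeasure (distr M M (\<lambda>y. y + x)) E = emeasure M E"
    using unimodular E by (subst emeasure_distr) (auto simp: right_invariant_def simp del: add_uminus_conv_diff)
qed simp

lemma nn_integral_left:
  assumes "f \<in> borel_measurable borel"
  shows "(\<integral>\<^sup>+y. f (x + y) \<partial>M) = (\<integral>\<^sup>+y. f y \<partial>M)"
proof -
  have "(\<integral>\<^sup>+y. f y \<partial>distr M M (\<lambda>y. x + y)) = (\<integral>\<^sup>+y. f (x + y) \<partial>M)"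
    using assms by (intro nn_integral_distr) simp_all
  then show ?thesis by (simp add: distr_left)
qed

lemma nn_integral_right:
  assumes "f \<in> borel_measurable borel"
  shows "(\<integral>\<^sup>+y. f (y + x) \<partial>M) = (\<integral>\<^sup>+y. f y \<partial>M)"
proof -
  have "(\<integral>\<^sup>+y. f y \<partial>distr M M (\<lambda>y. y + x)) = (\<integral>\<^sup>+y. f (y + x) \<partial>M)"
    using assms by (intro nn_integral_distr) simp_all
  then show ?thesis by (simp add: distr_right)
qed

text \<open>For a fixed set \<open>U\<close> of finite positive measure, both sides of
  \<open>\<mu>(U) \<mu>(-E) = \<mu>(U) \<mu>(E)\<close> are \<open>\<integral>\<integral> 1\<^sub>U(x) 1\<^sub>E(-y) dx dy\<close>, by the substitutions
  \<open>x \<mapsto> y + x\<close> and then \<open>y \<mapsto> y - x\<close>.\<close>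

lemma distr_uminus: "distr M M uminus = M"
proof (rule measure_eqI)
  fix E assume "E \<in> sets (distr M M uminus)"
  then have E[measurable]: "E \<in> sets borel" by (simp add: sets_M)
  obtain u v :: "nat \<Rightarrow> 'g set" where uv: "\<And>i. open (u i)" "\<And>i. compact (v i)" "\<And>i. u i \<subseteq> v i"
    "\<And>i. v i \<subseteq> UNIV" "(\<Union>i. u i) = UNIV"
    using open_cover_compact[OF open_UNIV] by blast
  obtain i where i: "0 \<in> u i" using uv(5) by auto
  define U where "U = u i"
  have [measurable]: "U \<in> sets borel" using uv(1) by (simp add: U_def)
  have "0 < emeasure M U" unfolding U_def using uv(1) i by (intro emeasure_open) auto
  moreover have "emeasure M U < \<infinity>"
    using emeasure_mono[of U "v i" M] emeasure_compact[OF uv(2)[of i]] uv(3)[of i] uv(2)[of i]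
    by (auto simp: U_def sets_M compact_imp_closed)
  ultimately have U: "emeasure M U \<noteq> 0" "emeasure M U \<noteq> \<infinity>" by auto
  have mE: "emeasure M (uminus -` E) = (\<integral>\<^sup>+y. indicator E (- y) \<partial>M)"
  proof -
    have "uminus -` E \<in> sets M"
      using measurable_sets[OF measurable_uminus_group[OF measurable_ident_sets[OF sets_M]] E] by simp
    from nn_integral_indicator[OF this] show ?thesis
      by (simp add: indicator_def)
  qed
  have "emeasure M U * emeasure M (uminus -` E) =
      (\<integral>\<^sup>+y. (\<integral>\<^sup>+x. indicator U x * indicator E (- y) \<partial>M) \<partial>M)"
    by (simp add: mE nn_integral_cmult nn_integral_multc sets_M)
  also have "\<dots> = (\<integral>\<^sup>+y. (\<integral>\<^sup>+x. indicator U (y + x) * indicator E (- y) \<partial>M) \<partial>M)"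
    by (rule nn_integral_cong, rule nn_integral_left[symmetric]) measurable
  also have "\<dots> = (\<integral>\<^sup>+x. (\<integral>\<^sup>+y. indicator U (y + x) * indicator E (- y) \<partial>M) \<partial>M)"
    by (rule Fubini') measurable
  also have "\<dots> = (\<integral>\<^sup>+x. (\<integral>\<^sup>+y. indicator U y * indicator E (x - y) \<partial>M) \<partial>M)"
  proof (rule nn_integral_cong)
    fix x
    have "(\<integral>\<^sup>+y. indicator U (y + x) * indicator E (x + - (y + x)) \<partial>M) =
        (\<integral>\<^sup>+y. indicator U y * (indicator E (x + - y) :: ennreal) \<partial>M)"
      by (rule nn_integral_right) measurable
    moreover have "x + - (y + x) = - y" for y by (simp only: minus_add add_minus_cancel)
    ultimately show "(\<integral>\<^sup>+y. indicator U (y + x) * indicator E (- y) \<partial>M) =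
        (\<integral>\<^sup>+y. indicator U y * (indicator E (x - y) :: ennreal) \<partial>M)"
      by simp
  qed
  also have "\<dots> = (\<integral>\<^sup>+y. (\<integral>\<^sup>+x. indicator U y * indicator E (x + - y) \<partial>M) \<partial>M)"
    unfolding diff_conv_add_uminus by (rule Fubini') measurable
  also have "\<dots> = (\<integral>\<^sup>+y. (\<integral>\<^sup>+x. indicator U y * indicator E x \<partial>M) \<partial>M)"
    by (rule nn_integral_cong, rule nn_integral_right) measurable
  also have "\<dots> = emeasure M U * emeasure M E"
    by (simp add: nn_integral_cmult nn_integral_multc sets_M)
  finally have "emeasure M (uminus -` E) = emeasure M E"
    using U by (simp add: ennreal_mult_cancel_left)
  then show "emeasure (distr M M uminus) E = emeasure M E"
    using E by (subst emeasure_distr) (simp_all add: sets_M)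
qed simp

lemma nn_integral_convolution:
  assumes [measurable]: "a \<in> borel_measurable borel" "b \<in> borel_measurable borel"
  shows "(\<integral>\<^sup>+x. (\<integral>\<^sup>+y. a y * b (- y + x) \<partial>M) \<partial>M) = (\<integral>\<^sup>+y. a y \<partial>M) * (\<integral>\<^sup>+x. b x \<partial>M)"
proof -
  have "(\<integral>\<^sup>+x. (\<integral>\<^sup>+y. a y * b (- y + x) \<partial>M) \<partial>M) = (\<integral>\<^sup>+y. (\<integral>\<^sup>+x. a y * b (- y + x) \<partial>M) \<partial>M)"
    by (rule Fubini') measurable
  also have "\<dots> = (\<integral>\<^sup>+y. a y * (\<integral>\<^sup>+x. b (- y + x) \<partial>M) \<partial>M)"
    by (rule nn_integral_cong, rule nn_integral_cmult) measurable
  also have "\<dots> = (\<integral>\<^sup>+y. a y \<partial>M) * (\<integral>\<^sup>+x. b x \<partial>M)"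
    by (simp add: nn_integral_left nn_integral_multc)
  finally show ?thesis .
qed

text \<open>The map sends \<open>(p, q, r)\<close> to \<open>(x, z, y)\<close> with
  \<open>z = p\<close>, \<open>y = p + q\<close> and \<open>x = p + q + r\<close>. When
  \<open>r\<close> is integrated first and \<open>q\<close> next, each change of variable is a left
  translation by quantities that are still fixed.\<close>

lemma distr_translations:
  "distr (M \<Otimes>\<^sub>M (M \<Otimes>\<^sub>M M)) (M \<Otimes>\<^sub>M (M \<Otimes>\<^sub>M M)) (\<lambda>(p, q, r). (p + q + r, p, p + q)) =
    M \<Otimes>\<^sub>M (M \<Otimes>\<^sub>M M)" (is "distr ?N ?N ?S = ?N")
proof (rule measure_eqI)
  have S: "?S \<in> measurable ?N ?N" by measurable
  fix E assume "E \<in> sets (distr ?N ?N ?S)"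
  then have E[measurable]: "E \<in> sets ?N" by simp
  have "emeasure (distr ?N ?N ?S) E = (\<integral>\<^sup>+w. indicator E w \<partial>distr ?N ?N ?S)"
    by simp
  also have "\<dots> = (\<integral>\<^sup>+w. indicator E (?S w) \<partial>?N)"
    by (rule nn_integral_distr[OF S]) simp
  also have "\<dots> = (\<integral>\<^sup>+p. (\<integral>\<^sup>+q. (\<integral>\<^sup>+r. indicator E (p + q + r, p, p + q) \<partial>M) \<partial>M) \<partial>M)"
  proof -
    have m: "(\<lambda>w. indicator E (?S w) :: ennreal) \<in> borel_measurable ?N"
      by (rule measurable_compose[OF S]) simp
    have "(\<integral>\<^sup>+w. indicator E (?S w) \<partial>?N) = (\<integral>\<^sup>+p. (\<integral>\<^sup>+qr. indicator E (?S (p, qr)) \<partial>(M \<Otimes>\<^sub>M M)) \<partial>M)"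
      by (rule nn_integral_fst_MM[OF m, symmetric])
    also have "\<dots> = (\<integral>\<^sup>+p. (\<integral>\<^sup>+q. (\<integral>\<^sup>+r. indicator E (?S (p, q, r)) \<partial>M) \<partial>M) \<partial>M)"
      by (rule nn_integral_cong, rule nn_integral_fst_M[symmetric])
         (rule measurable_compose[OF measurable_Pair1' m])
    finally show ?thesis by simp
  qed
  also have "\<dots> = (\<integral>\<^sup>+p. (\<integral>\<^sup>+q. (\<integral>\<^sup>+x. indicator E (x, p, p + q) \<partial>M) \<partial>M) \<partial>M)"
    by (rule nn_integral_cong, rule nn_integral_cong, rule nn_integral_left) measurable
  also have "\<dots> = (\<integral>\<^sup>+p. (\<integral>\<^sup>+y. (\<integral>\<^sup>+x. indicator E (x, p, y) \<partial>M) \<partial>M) \<partial>M)"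
    by (rule nn_integral_cong, rule nn_integral_left) measurable
  also have "\<dots> = (\<integral>\<^sup>+py. (\<integral>\<^sup>+x. indicator E (x, py) \<partial>M) \<partial>(M \<Otimes>\<^sub>M M))"
    by (rule nn_integral_fst_M[of "\<lambda>py. \<integral>\<^sup>+x. indicator E (x, py) \<partial>M"]) measurable
  also have "\<dots> = (\<integral>\<^sup>+x. (\<integral>\<^sup>+py. indicator E (x, py) \<partial>(M \<Otimes>\<^sub>M M)) \<partial>M)"
    by (rule triple.Fubini') measurable
  also have "\<dots> = emeasure ?N E"
    by (simp add: nn_integral_fst_MM)
  finally show "emeasure (distr ?N ?N ?S) E = emeasure ?N E" .
qed simp

end

section \<open>Continuous functions of compact support are dense\<close>

lemma compact_closure_subset:
  "compact K \<Longrightarrow> closure S \<subseteq> K \<Longrightarrow> compact (closure S)"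
  using compact_Int_closed[of K "closure S"] by (simp add: Int_absorb1)

context unimodular_haar
begin

lemma cc_strongly_measurable: "f \<in> cc_functions \<Longrightarrow> strongly_measurable M f"
  by (rule strongly_measurable_continuous_on_UNIV) (auto simp: cc_functions_def sets_M)

lemma cc_functions_bounded:
  fixes f :: "'g \<Rightarrow> 'a::banach"
  assumes "f \<in> cc_functions"
  obtains B where "0 \<le> B" "\<And>x. norm (f x) \<le> B"
proof -
  let ?K = "closure {x. f x \<noteq> 0}"
  have "compact (f ` ?K)"
    using assms by (auto simp: cc_functions_def intro: compact_continuous_image continuous_on_subset)
  then obtain B where B: "\<And>x. x \<in> ?K \<Longrightarrow> norm (f x) \<le> B"
    using compact_imp_bounded bounded_iff by (metis imageI)
  have "norm (f x) \<le> max B 0" for x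
    using B[of x] closure_subset[of "{x. f x \<noteq> 0}"] by (cases "f x = 0") auto
  then show thesis by (intro that[of "max B 0"]) auto
qed

lemma cc_functions_strongly_integrable:
  fixes f :: "'g \<Rightarrow> 'a::banach"
  assumes f: "f \<in> cc_functions"
  shows "strongly_integrable M f"
proof -
  let ?K = "closure {x. f x \<noteq> 0}"
  obtain B where B: "0 \<le> B" "\<And>x. norm (f x) \<le> B" using cc_functions_bounded[OF f] by blast
  have K: "compact ?K" using f by (simp add: cc_functions_def)
  have "L1_norm M f \<le> (\<integral>\<^sup>+x. ennreal B * indicator ?K x \<partial>M)"
    using B closure_subset[of "{x. f x \<noteq> 0}"]
    by (intro nn_integral_mono) (auto simp: indicator_def intro: ennreal_leI)
  also have "\<dots> = ennreal B * emeasure M ?K"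
    using K by (intro nn_integral_cmult_indicator) (simp add: sets_M compact_imp_closed)
  also have "\<dots> < \<infinity>" using emeasure_compact[OF K] by (simp add: ennreal_mult_less_top)
  finally show ?thesis
    using cc_strongly_measurable[OF f] by (simp add: strongly_integrable_def)
qed

lemma crossed_product_strongly_integrable:
  fixes f :: "'g \<Rightarrow> 'a::banach"
  assumes "f \<in> crossed_product M"
  shows "strongly_integrable M f"
proof -
  from assms obtain s where f: "strongly_measurable M f" and s: "\<And>i. s i \<in> cc_functions"
    and lim: "(\<lambda>i. L1_dist M f (s i)) \<longlonglongrightarrow> 0"
    unfolding crossed_product_def by auto
  have "\<forall>\<^sub>F i in sequentially. L1_dist M f (s i) < 1"
    by (rule order_tendstoD(2)[OF lim]) simp
  then obtain i where i: "L1_dist M f (s i) < 1"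
    using eventually_happens' sequentially_bot by blast
  have "strongly_integrable M (\<lambda>x. f x - s i x)"
    using less_trans[OF i, of \<infinity>] f cc_strongly_measurable[OF s[of i]]
    by (auto simp: strongly_integrable_def intro: strongly_measurable_diff)
  from strongly_integrable_add[OF this cc_functions_strongly_integrable[OF s[of i]]]
  show ?thesis by simp
qed

text \<open>Replacing each \<open>g i\<close> by a continuous function of compact support within
  \<open>1 / Suc i\<close> of it shows that the completion is closed under limits in the L1
  distance.\<close>

lemma crossed_productI:
  fixes f :: "'g \<Rightarrow> 'a::banach"
  assumes f: "strongly_measurable M f" and g: "\<And>i. g i \<in> crossed_product M"
    and lim: "(\<lambda>i. L1_dist M f (g i)) \<longlonglongrightarrow> 0"
  shows "f \<in> crossed_product M"
proof -
  have "\<exists>s\<in>cc_functions. L1_dist M (g i) s < ennreal (1 / Suc i)" for i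
  proof -
    obtain s where s: "\<And>i. s i \<in> cc_functions"
      and lim: "(\<lambda>j. L1_dist M (g i) (s j)) \<longlonglongrightarrow> 0"
      using g[of i] unfolding crossed_product_def by auto
    have "\<forall>\<^sub>F j in sequentially. L1_dist M (g i) (s j) < ennreal (1 / Suc i)"
      by (rule order_tendstoD(2)[OF lim]) (simp del: of_nat_Suc)
    then show ?thesis
      using s eventually_happens' sequentially_bot by blast
  qed
  then obtain s where s: "\<And>i. s i \<in> cc_functions"
    and s_le: "\<And>i. L1_dist M (g i) (s i) < ennreal (1 / Suc i)" by metis
  have "(\<lambda>i. ennreal (1 / Suc i)) \<longlonglongrightarrow> 0"
    using tendsto_ennrealI[OF lim_1_over_n[THEN LIMSEQ_Suc]] by simp
  from tendsto_add[OF lim this]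
  have lim': "(\<lambda>i. L1_dist M f (g i) + ennreal (1 / Suc i)) \<longlonglongrightarrow> 0" by simp
  have "(\<lambda>i. L1_dist M f (s i)) \<longlonglongrightarrow> 0"
  proof (rule tendsto_sandwich[OF _ _ tendsto_const lim'])
    have "L1_dist M f (s i) \<le>
        L1_dist M f (g i) + ennreal (1 / Suc i)" for i
    proof -
      have "strongly_measurable M (g i)" using g[of i] by (simp add: crossed_product_def)
      from nn_integral_norm_triangle[OF f cc_strongly_measurable[OF s] this]
      have "L1_dist M f (s i) \<le>
          L1_dist M f (g i) + L1_dist M (g i) (s i)"
        by (simp add: norm_minus_commute[of "g i _" "f _"])
      also have "\<dots> \<le> L1_dist M f (g i) + ennreal (1 / Suc i)"
        using s_le[of i] by (intro add_left_mono) simp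
      finally show ?thesis .
    qed
    then show "\<forall>\<^sub>F i in sequentially. L1_dist M f (s i) \<le>
        L1_dist M f (g i) + ennreal (1 / Suc i)"
      by simp
  qed simp
  with f s show ?thesis by (auto simp: crossed_product_def)
qed

lemma crossed_product_dominated:
  fixes f :: "'g \<Rightarrow> 'a::banach"
  assumes g: "\<And>i. g i \<in> crossed_product M" and lim: "\<And>x. (\<lambda>i. g i x) \<longlonglongrightarrow> f x"
    and D: "D \<in> sets M" "emeasure M D < \<infinity>"
    and bound: "\<And>i x. norm (g i x) \<le> B * indicator D x"
  shows "f \<in> crossed_product M"
proof -
  have gm: "strongly_measurable M (g i)" for i using g[of i] by (simp add: crossed_product_def)
  have f: "strongly_measurable M f" using gm lim by (rule strongly_measurable_LIMSEQ)
  have "(\<integral>\<^sup>+x. ennreal (B * indicator D x) \<partial>M) = (\<integral>\<^sup>+x. ennreal B * indicator D x \<partial>M)"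
    by (intro nn_integral_cong) (simp add: indicator_def)
  also have "\<dots> < \<infinity>" using D by (simp add: nn_integral_cmult_indicator ennreal_mult_less_top)
  finally have fin: "(\<integral>\<^sup>+x. ennreal (B * indicator D x) \<partial>M) < \<infinity>" .
  show ?thesis
  proof (rule crossed_productI[OF f g])
    show "(\<lambda>i. L1_dist M f (g i)) \<longlonglongrightarrow> 0"
      using lim bound D(1)
      by (intro nn_integral_norm_dominated_convergence(2)[OF gm f _ _ fin]) auto
  qed
qed

lemma open_subset_compact:
  assumes "open V" "V \<subseteq> C" "compact C"
  shows "V \<in> sets M" "emeasure M V < \<infinity>"
  using assms emeasure_mono[OF assms(2), of M] emeasure_compact[OF assms(3)]
  by (simp_all add: sets_M compact_imp_closed)

lemma cc_crossed_product: "f \<in> cc_functions \<Longrightarrow> f \<in> crossed_product M"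
  unfolding crossed_product_def
  by (auto intro!: cc_strongly_measurable exI[of _ "\<lambda>_. f"])

lemma cc_functions_diff:
  fixes f g :: "'g \<Rightarrow> 'a::banach"
  assumes "f \<in> cc_functions" "g \<in> cc_functions"
  shows "(\<lambda>x. f x - g x) \<in> cc_functions"
proof -
  have "closure {x. f x - g x \<noteq> 0} \<subseteq> closure {x. f x \<noteq> 0} \<union> closure {x. g x \<noteq> 0}"
    unfolding closure_Un[symmetric] by (rule closure_mono) auto
  moreover have "compact (closure {x. f x \<noteq> 0} \<union> closure {x. g x \<noteq> 0})"
    using assms by (auto simp: cc_functions_def intro: compact_Un)
  ultimately have "compact (closure {x. f x - g x \<noteq> 0})"
    using compact_closure_subset by blast
  with assms show ?thesis by (auto simp: cc_functions_def intro!: continuous_intros)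
qed

lemma crossed_product_diff:
  fixes f g :: "'g \<Rightarrow> 'a::banach"
  assumes "f \<in> crossed_product M" "g \<in> crossed_product M"
  shows "(\<lambda>x. f x - g x) \<in> crossed_product M"
proof -
  from assms(1) obtain s where f: "strongly_measurable M f" and s: "\<And>i. s i \<in> cc_functions"
    "(\<lambda>i. L1_dist M f (s i)) \<longlonglongrightarrow> 0"
    unfolding crossed_product_def by auto
  from assms(2) obtain t where g: "strongly_measurable M g" and t: "\<And>i. t i \<in> cc_functions"
    "(\<lambda>i. L1_dist M g (t i)) \<longlonglongrightarrow> 0"
    unfolding crossed_product_def by auto
  show ?thesis
  proof (rule crossed_productI)
    show "strongly_measurable M (\<lambda>x. f x - g x)" using f g by (rule strongly_measurable_diff)
    show "(\<lambda>x. s i x - t i x) \<in> crossed_product M" for i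
      by (intro cc_crossed_product cc_functions_diff s t)
    have lim: "(\<lambda>i. L1_dist M f (s i) + L1_dist M g (t i)) \<longlonglongrightarrow> 0"
      using tendsto_add[OF s(2) t(2)] by simp
    show "(\<lambda>i. L1_norm M (\<lambda>x. f x - g x - (s i x - t i x))) \<longlonglongrightarrow> 0"
    proof (rule tendsto_sandwich[OF _ _ tendsto_const lim])
      have "L1_norm M (\<lambda>x. f x - g x - (s i x - t i x)) \<le>
          L1_dist M f (s i) + L1_dist M g (t i)" for i
        using nn_integral_norm_triangle[of M "\<lambda>x. f x - g x" "\<lambda>x. s i x - t i x" "\<lambda>x. f x - t i x"]
          f g cc_strongly_measurable[OF s(1)] cc_strongly_measurable[OF t(1)]
        by (simp add: strongly_measurable_diff add.commute)
      then show "\<forall>\<^sub>F i in sequentially. L1_norm M (\<lambda>x. f x - g x - (s i x - t i x)) \<le>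
          L1_dist M f (s i) + L1_dist M g (t i)"
        by simp
    qed simp
  qed
qed

lemma crossed_product_add:
  fixes f g :: "'g \<Rightarrow> 'a::banach"
  assumes f: "f \<in> crossed_product M" and g: "g \<in> crossed_product M"
  shows "(\<lambda>x. f x + g x) \<in> crossed_product M"
  \<comment> \<open>\<open>f + g\<close> is \<open>f - ((g - g) - g)\<close>, so closure under
    differences is enough.\<close>
  using crossed_product_diff[OF f crossed_product_diff[OF crossed_product_diff[OF g g] g]] by simp

text \<open>Locally compact Hausdorff spaces are completely regular, which supplies the bump
  function; the compact set \<open>C\<close> around \<open>V\<close> contains its support.\<close>

lemma Urysohn_cc:
  fixes K V C :: "'g set"
  assumes K: "compact K" "K \<subseteq> V" and V: "open V" "V \<subseteq> C" "compact C"
  shows "\<exists>\<psi>. (\<forall>a::'a::banach. (\<lambda>x. \<psi> x *\<^sub>R a) \<in> cc_functions) \<and>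
    (\<forall>x. 0 \<le> \<psi> x \<and> \<psi> x \<le> indicat_real V x) \<and> (\<forall>x\<in>K. \<psi> x = 1)"
proof -
  have "locally_compact_space (euclidean :: 'g topology)"
    unfolding locally_compact_space_def
  proof
    fix x :: 'g
    obtain u v :: "nat \<Rightarrow> 'g set" where uv: "\<And>i. open (u i)" "\<And>i. compact (v i)" "\<And>i. u i \<subseteq> v i"
      "\<And>i. v i \<subseteq> UNIV" "(\<Union>i. u i) = UNIV"
      using open_cover_compact[OF open_UNIV] by blast
    obtain i where "x \<in> u i" using uv(5) by blast
    then show "\<exists>U K. openin euclidean U \<and> compactin euclidean K \<and> x \<in> U \<and> U \<subseteq> K"
      using uv by (intro exI[of _ "u i"] exI[of _ "v i"]) auto
  qed
  then have "completely_regular_space (euclidean :: 'g topology)"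
  proof (rule locally_compact_regular_imp_completely_regular_space)
    have "Hausdorff_space (euclidean :: 'g topology)"
      unfolding Hausdorff_space_def disjnt_def open_openin[symmetric] using hausdorff by metis
    then show "Hausdorff_space (euclidean :: 'g topology) \<or> regular_space (euclidean :: 'g topology)" ..
  qed
  then obtain f where f: "continuous_map euclidean (top_of_set {0..1::real}) f"
    "f ` (- V) \<subseteq> {0}" "f ` K \<subseteq> {1}"
    using Urysohn_completely_regular_compact_closed[of 0 1 euclidean K "- V"] K V
    by (auto simp: disjnt_iff)
  have cont: "continuous_on UNIV f" and bounds: "\<And>x. 0 \<le> f x" "\<And>x. f x \<le> 1"
    using f(1) by (auto simp: continuous_map_in_subtopology Pi_iff)
  show ?thesis
  proof (intro exI[of _ f] conjI allI ballI)
    show "0 \<le> f x" for x by (rule bounds)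
    show "f x \<le> indicator V x" for x using bounds f(2) by (auto simp: indicator_def)
    show "f x = 1" if "x \<in> K" for x using f(3) that by auto
    show "(\<lambda>x. f x *\<^sub>R a) \<in> cc_functions" for a :: 'a
    proof -
      have "{x. f x *\<^sub>R a \<noteq> 0} \<subseteq> C" using f(2) V(2) by auto
      then have "closure {x. f x *\<^sub>R a \<noteq> 0} \<subseteq> C"
        using V(3) by (simp add: closure_minimal compact_imp_closed)
      then have "compact (closure {x. f x *\<^sub>R a \<noteq> 0})"
        by (rule compact_closure_subset[OF V(3)])
      then show ?thesis using cont by (auto simp: cc_functions_def intro!: continuous_intros)
    qed
  qed
qed

text \<open>Compact sets \<open>K n\<close> exhaust \<open>V\<close>; bump functions equal to
  \<open>1\<close> on \<open>K n\<close> converge pointwise to the indicator of \<open>V\<close> and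
  are dominated by it.\<close>

lemma indicator_open_crossed_product:
  fixes a :: "'a::banach"
  assumes V: "open V" "V \<subseteq> C" "compact C"
  shows "(\<lambda>x. indicat_real V x *\<^sub>R a) \<in> crossed_product M"
proof -
  obtain u v :: "nat \<Rightarrow> 'g set" where uv: "\<And>i. open (u i)" "\<And>i. compact (v i)" "\<And>i. u i \<subseteq> v i"
    "\<And>i. v i \<subseteq> V" "(\<Union>i. u i) = V"
    using open_cover_compact[OF V(1)] by blast
  define K where "K n = (\<Union>i\<le>n. v i)" for n :: nat
  have K: "compact (K n)" "K n \<subseteq> V" for n
    unfolding K_def using uv(2,4) by (blast intro: compact_UN)+
  have "\<exists>\<psi>. (\<lambda>x. \<psi> x *\<^sub>R a) \<in> cc_functions \<and> (\<forall>x. 0 \<le> \<psi> x \<and> \<psi> x \<le> indicat_real V x) \<and>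
      (\<forall>x\<in>K n. \<psi> x = 1)" for n
    using Urysohn_cc[OF K V, of n] by blast
  then obtain \<psi> where \<psi>: "\<And>n. (\<lambda>x. \<psi> n x *\<^sub>R a) \<in> cc_functions"
    "\<And>n x. 0 \<le> \<psi> n x" "\<And>n x. \<psi> n x \<le> indicat_real V x" "\<And>n x. x \<in> K n \<Longrightarrow> \<psi> n x = 1"
    by metis
  show ?thesis
  proof (rule crossed_product_dominated)
    show "(\<lambda>x. \<psi> n x *\<^sub>R a) \<in> crossed_product M" for n
      by (intro cc_crossed_product \<psi>)
    show "(\<lambda>n. \<psi> n x *\<^sub>R a) \<longlonglongrightarrow> indicat_real V x *\<^sub>R a" for x
    proof (cases "x \<in> V")
      case True
      then obtain i where "x \<in> v i" using uv by blast
      then have "\<forall>n\<ge>i. x \<in> K n" by (auto simp: K_def)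
      then have "\<forall>\<^sub>F n in sequentially. \<psi> n x *\<^sub>R a = indicat_real V x *\<^sub>R a"
        using True \<psi>(4) by (auto simp: eventually_sequentially intro!: exI[of _ i])
      then show ?thesis by (rule tendsto_eventually)
    next
      case False
      then have "\<psi> n x = 0" for n using \<psi>(2,3)[of n x] by simp
      with False show ?thesis by simp
    qed
    show "V \<in> sets M" "emeasure M V < \<infinity>" using open_subset_compact[OF V] by auto
    show "norm (\<psi> n x *\<^sub>R a) \<le> norm a * indicator V x" for n x
      using \<psi>(2,3)[of n x] by (simp add: mult.commute mult_left_mono)
  qed
qed

text \<open>Inside a relatively compact open \<open>V\<close> all indicators are dominated by an
  integrable one, so a pi-lambda argument leads from open sets to Borel sets; finite unions of
  relatively compact open sets then exhaust the group. This takes the place of an appeal to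
  regularity of \<open>M\<close>.\<close>

lemma indicator_crossed_product:
  fixes a :: "'a::banach"
  assumes D: "D \<in> sets M" "emeasure M D < \<infinity>"
  shows "(\<lambda>x. indicat_real D x *\<^sub>R a) \<in> crossed_product M"
proof -
  have local: "(\<lambda>x. indicat_real (D \<inter> V) x *\<^sub>R a) \<in> crossed_product M"
    if V: "open V" "V \<subseteq> C" "compact C" and "D \<in> sets borel" for V C D
  proof -
    from \<open>D \<in> sets borel\<close> have "D \<in> sigma_sets UNIV {S. open S}" by (simp add: borel_def)
    then show ?thesis
    proof (induction rule: sigma_sets_induct_disjoint[rotated 2, consumes 1])
      show "Int_stable {S :: 'g set. open S}" by (auto simp: Int_stable_def)
    next
      fix S :: "'g set" assume "S \<in> {S. open S}"
      then show "(\<lambda>x. indicat_real (S \<inter> V) x *\<^sub>R a) \<in> crossed_product M"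
        using V by (intro indicator_open_crossed_product[of _ C]) auto
    next
      show "(\<lambda>x. indicat_real ({} \<inter> V) x *\<^sub>R a) \<in> crossed_product M"
        using indicator_open_crossed_product[of "{}" C a] V by simp
    next
      fix S assume S: "(\<lambda>x. indicat_real (S \<inter> V) x *\<^sub>R a) \<in> crossed_product M"
      have "(\<lambda>x. indicat_real V x *\<^sub>R a - indicat_real (S \<inter> V) x *\<^sub>R a) \<in> crossed_product M"
        by (intro crossed_product_diff S indicator_open_crossed_product[OF V])
      also have "(\<lambda>x. indicat_real V x *\<^sub>R a - indicat_real (S \<inter> V) x *\<^sub>R a) =
          (\<lambda>x. indicat_real ((UNIV - S) \<inter> V) x *\<^sub>R a)"
        by (auto simp: indicator_def)
      finally show "(\<lambda>x. indicat_real ((UNIV - S) \<inter> V) x *\<^sub>R a) \<in> crossed_product M" .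
    next
      fix A :: "nat \<Rightarrow> 'g set"
      assume A: "disjoint_family A" "\<And>i. (\<lambda>x. indicat_real (A i \<inter> V) x *\<^sub>R a) \<in> crossed_product M"
      show "(\<lambda>x. indicat_real (\<Union> (range A) \<inter> V) x *\<^sub>R a) \<in> crossed_product M"
      proof (rule crossed_product_dominated)
        have sum: "(\<Sum>i<n. indicat_real (A i \<inter> V) x *\<^sub>R a) = indicat_real ((\<Union>i<n. A i) \<inter> V) x *\<^sub>R a" for n x
        proof -
          have "indicat_real (\<Union>i<n. A i \<inter> V) x = (\<Sum>i<n. indicat_real (A i \<inter> V) x)"
            using A(1) by (intro indicator_UN_disjoint) (auto simp: disjoint_family_on_def)
          then show ?thesis by (simp flip: scaleR_sum_left UN_extend_simps(4))
        qed
        have "(\<lambda>x. \<Sum>i<n. indicat_real (A i \<inter> V) x *\<^sub>R a) \<in> crossed_product M" for n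
        proof (induction n)
          case 0
          then show ?case using indicator_open_crossed_product[of "{}" C a] V by simp
        next
          case (Suc n)
          from crossed_product_add[OF this A(2)[of n]] show ?case by simp
        qed
        then show "(\<lambda>x. indicat_real ((\<Union>i<n. A i) \<inter> V) x *\<^sub>R a) \<in> crossed_product M" for n
          by (simp add: sum)
        show "(\<lambda>n. indicat_real ((\<Union>i<n. A i) \<inter> V) x *\<^sub>R a) \<longlonglongrightarrow> indicat_real (\<Union> (range A) \<inter> V) x *\<^sub>R a" for x
          unfolding indicator_inter_arith
          by (intro tendsto_scaleR tendsto_mult tendsto_const LIMSEQ_indicator_UN)
        show "V \<in> sets M" "emeasure M V < \<infinity>" using open_subset_compact[OF V] by auto
        show "norm (indicat_real ((\<Union>i<n. A i) \<inter> V) x *\<^sub>R a) \<le> norm a * indicator V x" for n x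
          by (simp add: indicator_def)
      qed
    qed simp
  qed
  obtain u v :: "nat \<Rightarrow> 'g set" where uv: "\<And>i. open (u i)" "\<And>i. compact (v i)" "\<And>i. u i \<subseteq> v i"
    "\<And>i. v i \<subseteq> UNIV" "(\<Union>i. u i) = UNIV"
    using open_cover_compact[OF open_UNIV] by blast
  show ?thesis
  proof (rule crossed_product_dominated)
    show "(\<lambda>x. indicat_real (D \<inter> (\<Union>i<n. u i)) x *\<^sub>R a) \<in> crossed_product M" for n
      using uv D(1) by (intro local[of _ "\<Union>i<n. v i"]) (force simp: sets_M intro!: compact_UN)+
    have "(\<lambda>n. indicat_real D x * indicat_real (\<Union>i<n. u i) x) \<longlonglongrightarrow> indicat_real D x * indicat_real (\<Union>i. u i) x" for x
      by (intro tendsto_mult tendsto_const LIMSEQ_indicator_UN)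
    then have "(\<lambda>n. indicat_real (D \<inter> (\<Union>i<n. u i)) x) \<longlonglongrightarrow> indicat_real D x" for x
      by (simp add: indicator_inter_arith uv(5))
    then show "(\<lambda>n. indicat_real (D \<inter> (\<Union>i<n. u i)) x *\<^sub>R a) \<longlonglongrightarrow> indicat_real D x *\<^sub>R a" for x
      by (intro tendsto_scaleR tendsto_const)
    show "D \<in> sets M" "emeasure M D < \<infinity>" by (rule D)+
    show "norm (indicat_real (D \<inter> (\<Union>i<n. u i)) x *\<^sub>R a) \<le> norm a * indicator D x" for n x
      by (simp add: indicator_def)
  qed
qed

text \<open>Integrable simple functions belong to the completion, and it is closed, so it is all of
  L1. Membership of convolutions and adjoints thereby becomes a matter of measurability and a norm
  bound.\<close>

theorem crossed_product_iff:
  fixes f :: "'g \<Rightarrow> 'a::banach"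
  shows "f \<in> crossed_product M \<longleftrightarrow> strongly_integrable M f"
proof
  assume f: "strongly_integrable M f"
  obtain s where s: "\<And>i. simple_bochner_integrable M (s i)"
    "(\<lambda>i. L1_dist M f (s i)) \<longlonglongrightarrow> 0"
    using strongly_integrable_approx[OF f] by blast
  show "f \<in> crossed_product M"
  proof (rule crossed_productI[OF _ _ s(2)])
    show "strongly_measurable M f" using f by (simp add: strongly_integrable_def)
    fix i
    have fin: "finite (range (s i))" and sf: "simple_function M (s i)"
      using simple_bochner_simple[OF s(1)[of i]] by (auto simp: simple_function_def)
    have "(\<lambda>x. \<Sum>v\<in>F. indicat_real (s i -` {v}) x *\<^sub>R v) \<in> crossed_product M"
      if "finite F" for F
      using that
    proof (induction F)
      case empty
      show ?case using indicator_crossed_product[of "{}" "0::'a"] by simp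
    next
      case (insert v F)
      have "(\<lambda>x. indicat_real (s i -` {v}) x *\<^sub>R v) \<in> crossed_product M"
      proof (cases "v = 0")
        case True
        then show ?thesis using indicator_crossed_product[of "{}" "0::'a"] by simp
      next
        case False
        have "{y \<in> space M. s i y \<noteq> 0} \<in> sets M"
          using measurable_simple_function[OF sf] by measurable
        then have "emeasure M (s i -` {v}) \<le> emeasure M {y \<in> space M. s i y \<noteq> 0}"
          using False by (intro emeasure_mono) auto
        also have "\<dots> < \<infinity>"
          using s(1)[of i] by (simp add: simple_bochner_integrable.simps less_top)
        finally show ?thesis
          using simple_functionD(2)[OF sf, of "{v}"] by (intro indicator_crossed_product) simp_all
      qed
      from crossed_product_add[OF this insert.IH] show ?case
        unfolding sum.insert[OF insert.hyps] .
    qed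
    from this[OF fin] have "(\<lambda>x. \<Sum>v\<in>range (s i). indicat_real (s i -` {v}) x *\<^sub>R v) \<in> crossed_product M" .
    also have "(\<lambda>x. \<Sum>v\<in>range (s i). indicat_real (s i -` {v}) x *\<^sub>R v) = s i"
    proof
      fix x
      have "(\<Sum>v\<in>range (s i). indicat_real (s i -` {v}) x *\<^sub>R v) =
          (\<Sum>v\<in>range (s i). if v = s i x then v else 0)"
        by (intro sum.cong) (auto simp: indicator_def)
      then show "(\<Sum>v\<in>range (s i). indicat_real (s i -` {v}) x *\<^sub>R v) = s i x"
        using fin by simp
    qed
    finally show "s i \<in> crossed_product M" .
  qed
qed (rule crossed_product_strongly_integrable)

end

section \<open>Twisted convolution and adjoint\<close>

text \<open>That \<open>\<phi>\<close> is a tricharacter means that its values are scalars;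
  \<open>phi\<close> expresses this through \<open>mscalar\<close>.\<close>

locale twisted_product = unimodular_haar M
  for M :: "'g::{topological_group_add,t2_space,second_countable_topology} measure" +
  fixes \<alpha> :: "'g \<Rightarrow> 'a::cstar_algebra \<Rightarrow> 'a"
    and u :: "'g \<Rightarrow> 'g \<Rightarrow> 'a multiplier"
    and \<phi> :: "'g \<Rightarrow> 'g \<Rightarrow> 'g \<Rightarrow> 'a multiplier"
    and \<omega> :: "'g \<Rightarrow> 'g \<Rightarrow> 'g \<Rightarrow> complex"
  assumes action: "twisted_action \<alpha> u"
    and associator: "associator_of \<alpha> u \<phi>"
    and tricharacter: "antisymmetric_tricharacter \<omega>"
    and phi: "\<phi> x y z = mscalar (\<omega> x y z)"
begin

lemma automorphism: "star_automorphism (\<alpha> x)"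
  using action by (simp add: twisted_action_def)

lemmas \<alpha>_simps = star_automorphism_simps[OF automorphism]
lemmas norm_\<alpha> [simp] = star_automorphism_norm[OF automorphism]

lemma unitary: "unitary_multiplier (u x y)"
  using action by (simp add: twisted_action_def)

lemmas u_mult = unitary_multiplierD(1)[OF unitary]
lemmas u_simps = multiplier_simps[OF u_mult]
lemmas u_inverse [simp] = unitary_multiplierD(3-6)[OF unitary]
lemmas norm_u [simp] = unitary_multiplier_norm[OF unitary]

lemma u_zero [simp]: "u x 0 = mone" "u 0 x = mone"
  using action by (auto simp: twisted_action_def)

lemma norm_\<omega> [simp]: "cmod (\<omega> x y z) = 1"
  using tricharacter unfolding antisymmetric_tricharacter_def group_character_def by blast

section \<open>Pointwise identities for the twist and the two triple integrands\<close>

text \<open>Multiplying the twisted composition law by \<open>u x y\<close> on the right cancels the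
  inverse contained in \<open>mad\<close>. This is the rule by which \<open>u\<close> moves across a
  factor.\<close>

lemma \<alpha>_\<alpha>_u: "\<alpha> x (\<alpha> y a) \<lhd> u x y = u x y \<rhd> \<alpha> (x + y) a"
proof -
  have "\<alpha> x (\<alpha> y a) = u x y \<rhd> (\<alpha> (x + y) a \<lhd> mstar (u x y))"
    using action by (simp add: twisted_action_def mad_def)
  then show ?thesis
    by (simp add: multiplier_assoc[OF u_mult u_mult])
qed

text \<open>Both sides of the associator equation act from the right on \<open>\<alpha> x b\<close>;
  the factor \<open>mlift\<close> moves inside \<open>\<alpha> x\<close>, and the scalar
  \<open>\<phi> x y z\<close> comes out in front.\<close>

lemma cocycle:
  "\<alpha> x (b \<lhd> u y z) \<lhd> u x (y + z) = \<omega> x y z *\<^sub>C ((\<alpha> x b \<lhd> u x y) \<lhd> u (x + y) z)"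
proof -
  have "\<phi> x y z \<odot> u x y \<odot> u (x + y) z = mlift (\<alpha> x) (u y z) \<odot> u x (y + z)"
    using associator by (simp add: associator_of_def)
  then have "\<alpha> x b \<lhd> (mlift (\<alpha> x) (u y z) \<odot> u x (y + z)) =
      \<alpha> x b \<lhd> (\<phi> x y z \<odot> u x y \<odot> u (x + y) z)" by simp
  moreover have "\<alpha> x b \<lhd> mlift (\<alpha> x) (u y z) = \<alpha> x (b \<lhd> u y z)"
    using automorphism[of x]
    by (simp add: mlift_def rmul_def star_automorphism_def bij_is_inj)
  ultimately show ?thesis
    by (simp add: mtimes_apply phi u_simps)
qed

text \<open>\<open>K1\<close> is the integrand of \<open>(f \<diamondop> g) \<diamondop> h\<close>,
  whose inner product is evaluated at \<open>p + q\<close>; \<open>K2\<close> is that of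
  \<open>f \<diamondop> (g \<diamondop> h)\<close>, with inner argument
  \<open>q + r\<close>.\<close>

definition K1 :: "('g \<Rightarrow> 'a) \<Rightarrow> ('g \<Rightarrow> 'a) \<Rightarrow> ('g \<Rightarrow> 'a) \<Rightarrow> 'g \<Rightarrow> 'g \<Rightarrow> 'g \<Rightarrow> 'a" where
  "K1 f g h p q r = ((f p * \<alpha> p (g q)) \<lhd> u p q) * \<alpha> (p + q) (h r) \<lhd> u (p + q) r"

definition K2 :: "('g \<Rightarrow> 'a) \<Rightarrow> ('g \<Rightarrow> 'a) \<Rightarrow> ('g \<Rightarrow> 'a) \<Rightarrow> 'g \<Rightarrow> 'g \<Rightarrow> 'g \<Rightarrow> 'a" where
  "K2 f g h p q r = f p * \<alpha> p (g q * \<alpha> q (h r) \<lhd> u q r) \<lhd> u p (q + r)"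

text \<open>Collecting \<open>g\<close> and \<open>h\<close> under a single
  \<open>\<alpha> p\<close> gives \<open>K1\<close> the shape to which \<open>cocycle\<close>
  applies with \<open>b = g q * \<alpha> q (h r)\<close>; the norm bound can also be read off from
  it.\<close>

lemma K1_eq: "K1 f g h p q r = f p * ((\<alpha> p (g q * \<alpha> q (h r)) \<lhd> u p q) \<lhd> u (p + q) r)"
proof -
  have "\<alpha> p (g q * \<alpha> q (h r)) \<lhd> u p q = \<alpha> p (g q) * (u p q \<rhd> \<alpha> (p + q) (h r))"
    by (simp only: \<alpha>_simps u_simps(6) \<alpha>_\<alpha>_u)
  also have "\<dots> = (\<alpha> p (g q) \<lhd> u p q) * \<alpha> (p + q) (h r)" by (rule u_simps(7))
  finally show ?thesis
    unfolding K1_def by (simp add: u_simps(6) mult.assoc)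
qed

lemma K2_eq: "K2 f g h p q r = \<omega> p q r *\<^sub>C K1 f g h p q r"
  by (simp only: K1_eq K2_def u_simps(6)[where a="f p"] cocycle scaleC_mult_right)

lemma norm_K1_le: "norm (K1 f g h p q r) \<le> norm (f p) * norm (g q) * norm (h r)"
proof -
  have "norm (K1 f g h p q r) \<le> norm (f p) * norm (g q * \<alpha> q (h r))"
    unfolding K1_eq
    using norm_mult_ineq[of "f p" "(\<alpha> p (g q * \<alpha> q (h r)) \<lhd> u p q) \<lhd> u (p + q) r"] by simp
  also have "\<dots> \<le> norm (f p) * (norm (g q) * norm (h r))"
    using norm_mult_ineq[of "g q" "\<alpha> q (h r)"] by (intro mult_left_mono) simp_all
  finally show ?thesis by (simp add: mult.assoc)
qed

lemma norm_K2_le: "norm (K2 f g h p q r) \<le> norm (f p) * norm (g q) * norm (h r)"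
  using norm_K1_le by (simp add: K2_eq norm_scaleC)

section \<open>Measurability and integrability of convolution and adjoint\<close>

lemma strongly_measurable_group_fun:
  assumes "strongly_measurable M f" and "p \<in> borel_measurable N"
  shows "strongly_measurable N (\<lambda>w. f (p w))"
  using assms by (intro strongly_measurable_compose[OF assms(1)]) simp

lemma strongly_measurable_\<alpha>:
  assumes p: "p \<in> borel_measurable N" and F: "strongly_measurable N F"
  shows "strongly_measurable N (\<lambda>w. \<alpha> (p w) (F w))"
proof (rule strongly_measurable_apply[OF _ _ F])
  show "strongly_measurable N (\<lambda>w. \<alpha> (p w) a)" for a
  proof (rule strongly_measurable_compose[OF _ p])
    show "strongly_measurable borel (\<lambda>x. \<alpha> x a)"
      using action unfolding twisted_action_def by blast
  qed
  show "bounded_linear (\<alpha> (p w))" for w by (rule star_automorphism_bounded_linear[OF automorphism])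
qed

lemma strongly_measurable_u:
  assumes p: "p \<in> borel_measurable N" and q: "q \<in> borel_measurable N" and F: "strongly_measurable N F"
  shows "strongly_measurable N (\<lambda>w. F w \<lhd> u (p w) (q w))"
proof (rule strongly_measurable_apply[OF _ _ F])
  have pq: "(\<lambda>w. (p w, q w)) \<in> borel_measurable N"
    using p q by (rule borel_measurable_Pair)
  show "strongly_measurable N (\<lambda>w. a \<lhd> u (p w) (q w))" for a
  proof -
    have "strongly_measurable borel (\<lambda>(x, y). a \<lhd> u x y)"
      using action unfolding twisted_action_def by blast
    from strongly_measurable_compose[OF this pq] show ?thesis by simp
  qed
  show "bounded_linear (\<lambda>a. a \<lhd> u (p w) (q w))" for w
    by (rule multiplier_bounded_linear(2)[OF u_mult])
qed

lemmas product_measurability = strongly_measurable_u strongly_measurable_\<alpha> strongly_measurable_mult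

lemma strongly_measurable_K1:
  assumes f: "strongly_measurable M f" and g: "strongly_measurable M g" and h: "strongly_measurable M h"
    and [measurable]: "p \<in> borel_measurable N" "q \<in> borel_measurable N" "r \<in> borel_measurable N"
  shows "strongly_measurable N (\<lambda>w. K1 f g h (p w) (q w) (r w))"
  unfolding K1_def
  by (intro product_measurability strongly_measurable_group_fun[OF f] strongly_measurable_group_fun[OF g]
      strongly_measurable_group_fun[OF h]) measurable

lemma strongly_measurable_K2:
  assumes f: "strongly_measurable M f" and g: "strongly_measurable M g" and h: "strongly_measurable M h"
    and [measurable]: "p \<in> borel_measurable N" "q \<in> borel_measurable N" "r \<in> borel_measurable N"
  shows "strongly_measurable N (\<lambda>w. K2 f g h (p w) (q w) (r w))"
  unfolding K2_def
  by (intro product_measurability strongly_measurable_group_fun[OF f] strongly_measurable_group_fun[OF g]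
      strongly_measurable_group_fun[OF h]) measurable

abbreviation convolution (infixl \<open>\<diamondop>\<close> 70) where "f \<diamondop> g \<equiv> twisted_conv M \<alpha> u f g"
abbreviation "invol \<equiv> twisted_adj \<alpha> u"

lemma norm_conv_le: "enorm (a * \<alpha> y b) \<le> enorm a * enorm b"
  using ennreal_leI[OF norm_mult_ineq[of a "\<alpha> y b"]] by (simp add: ennreal_mult)

lemma strongly_integrable_conv_at:
  assumes f: "strongly_measurable M f" and g: "strongly_measurable M g"
    and fin: "(\<integral>\<^sup>+y. enorm (f y) * enorm (g (- y + x)) \<partial>M) < \<infinity>"
  shows "strongly_integrable M (\<lambda>y. f y * \<alpha> y (g (- y + x)) \<lhd> u y (- y + x))"
proof -
  have "strongly_measurable M (\<lambda>y. f y * \<alpha> y (g (- y + x)) \<lhd> u y (- y + x))"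
    by (intro product_measurability strongly_measurable_group_fun[OF f] strongly_measurable_group_fun[OF g]) measurable
  moreover have "L1_norm M (\<lambda>y. f y * \<alpha> y (g (- y + x)) \<lhd> u y (- y + x)) \<le>
      (\<integral>\<^sup>+y. enorm (f y) * enorm (g (- y + x)) \<partial>M)"
    by (intro nn_integral_mono) (simp add: norm_conv_le)
  ultimately show ?thesis using fin by (auto simp: strongly_integrable_def)
qed

lemma strongly_integrable_conv_kernel:
  assumes f: "strongly_integrable M f" and g: "strongly_integrable M g"
  shows "strongly_integrable (M \<Otimes>\<^sub>M M) (\<lambda>(x, y). f y * \<alpha> y (g (- y + x)) \<lhd> u y (- y + x))"
proof -
  have fm: "strongly_measurable M f" and gm: "strongly_measurable M g"
    using f g by (auto simp: strongly_integrable_def)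
  note [measurable] = fm[THEN norm_borel]
    gm[THEN norm_borel]
  have "strongly_measurable (M \<Otimes>\<^sub>M M)
      (\<lambda>w. f (snd w) * \<alpha> (snd w) (g (- snd w + fst w)) \<lhd> u (snd w) (- snd w + fst w))"
    by (intro product_measurability strongly_measurable_group_fun[OF fm] strongly_measurable_group_fun[OF gm]) measurable
  then have m: "strongly_measurable (M \<Otimes>\<^sub>M M) (\<lambda>(x, y). f y * \<alpha> y (g (- y + x)) \<lhd> u y (- y + x))"
    by (simp add: case_prod_unfold)
  have "L1_norm (M \<Otimes>\<^sub>M M) (\<lambda>w. case w of (x, y) \<Rightarrow> f y * \<alpha> y (g (- y + x)) \<lhd> u y (- y + x)) \<le>
      (\<integral>\<^sup>+w. enorm (f (snd w)) * enorm (g (- snd w + fst w)) \<partial>(M \<Otimes>\<^sub>M M))"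
    by (intro nn_integral_mono) (simp add: case_prod_unfold norm_conv_le)
  also have "\<dots> = (\<integral>\<^sup>+x. (\<integral>\<^sup>+y. enorm (f y) * enorm (g (- y + x)) \<partial>M) \<partial>M)"
  proof -
    have "(\<lambda>w. enorm (f (snd w)) * enorm (g (- snd w + fst w))) \<in> borel_measurable (M \<Otimes>\<^sub>M M)"
      by measurable
    from nn_integral_fst_M[OF this] show ?thesis by simp
  qed
  also have "\<dots> = L1_norm M f * L1_norm M g"
    by (rule nn_integral_convolution) measurable
  also have "\<dots> < \<infinity>" using f g by (simp add: strongly_integrable_def ennreal_mult_less_top)
  finally show ?thesis using m by (simp add: strongly_integrable_def)
qed

lemma strongly_integrable_conv:
  assumes "strongly_integrable M f" "strongly_integrable M g"
  shows "strongly_integrable M (f \<diamondop> g)"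
  using has_strong_integralD[OF
      has_strong_integral_fst[OF strongly_integrable_conv_kernel[OF assms]]]
  by (simp add: twisted_conv_def[abs_def])

text \<open>Invariance of \<open>M\<close> under inversion preserves the norm. Writing the value as
  \<open>star\<close> of a right action of \<open>u\<close> makes
  \<open>strongly_measurable_u\<close> applicable.\<close>

lemma strongly_integrable_adj:
  assumes f: "strongly_integrable M f"
  shows "strongly_integrable M (invol f)"
proof -
  have fm: "strongly_measurable M f" using f by (simp add: strongly_integrable_def)
  have "invol f x = star (\<alpha> x (f (- x)) \<lhd> u x (- x))" for x
    by (simp add: twisted_adj_def star_mult_apply)
  then have eq: "invol f = (\<lambda>x. star (\<alpha> x (f (- x)) \<lhd> u x (- x)))" by blast
  have m: "strongly_measurable M (invol f)"
    unfolding eq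
    by (intro strongly_measurable_star strongly_measurable_u strongly_measurable_\<alpha>
        strongly_measurable_group_fun[OF fm]) measurable
  have "L1_norm M (\<lambda>x. invol f x) = L1_norm M (\<lambda>x. f (- x))"
    by (simp add: eq)
  also have "\<dots> = (\<integral>\<^sup>+x. enorm (f x) \<partial>distr M M uminus)"
    using strongly_measurable_norm[OF fm] by (intro nn_integral_distr[symmetric]) simp_all
  also have "\<dots> < \<infinity>" using f by (simp add: distr_uminus strongly_integrable_def)
  finally show ?thesis using m by (simp add: strongly_integrable_def)
qed

text \<open>With \<open>w = x + y\<close> and \<open>z = - w\<close>, the integrand of \<open>(f \<diamondop> g)\<^sup>*\<close> involves \<open>\<omega> x y z\<close> and that of
  \<open>g\<^sup>* \<diamondop> f\<^sup>*\<close> involves \<open>\<omega> w (- y) y\<close>; both are products of values \<open>\<omega> s s t\<close> and their inverses.\<close>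

lemma adj_conv_integrand:
  assumes one: "\<And>s t. \<omega> s s t = 1"
  shows "mstar (u x (- x)) \<rhd> star (\<alpha> x (f y * \<alpha> y (g (- y + - x)) \<lhd> u y (- y + - x))) =
    invol g (x + y) * \<alpha> (x + y) (invol f (- (x + y) + x)) \<lhd> u (x + y) (- (x + y) + x)"
proof -
  define w z where "w = x + y" and "z = - y + - x"
  have wz: "- w = z" "y + z = - x" "w + - y = x" "- w + x = - y"
    by (simp_all only: w_def z_def minus_add add.assoc add.left_inverse add.right_inverse
        add_0_right add_minus_cancel add_0)
  note char = tricharacter[unfolded antisymmetric_tricharacter_def group_character_def]
  have cyc: "\<omega> b c a = \<omega> a b c" for a b c
    using char by blast
  have add: "\<omega> a b (c + d) = \<omega> a b c * \<omega> a b d" for a b c d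
    using char by blast
  have neg: "\<omega> a b (- c) = inverse (\<omega> a b c)" for a b c
  proof -
    have "\<omega> a b 0 * \<omega> a b 0 = \<omega> a b 0" using add[of a b 0 0] by simp
    moreover have "\<omega> a b 0 \<noteq> 0" using norm_\<omega>[of a b 0] by (metis norm_zero zero_neq_one)
    ultimately have "\<omega> a b 0 = 1" by simp
    then have "\<omega> a b c * \<omega> a b (- c) = 1" using add[of a b c "- c"] by simp
    then show ?thesis by (rule inverse_unique[symmetric])
  qed
  have "\<omega> x y z = \<omega> x y (- y) * \<omega> x y (- x)" by (simp only: z_def add)
  also have "\<dots> = inverse (\<omega> y y x) * inverse (\<omega> x x y)"
    using cyc[where a=x and b=y and c=y] cyc[where a=x and b=x and c=y] by (simp only: neg)
  finally have \<omega>1: "\<omega> x y z = 1" by (simp add: one)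
  have "\<omega> w (- y) y = \<omega> y w (- y)" by (rule cyc)
  also have "\<dots> = inverse (\<omega> y y w)" using cyc[where a=y and b=y and c=w] by (simp only: neg)
  finally have \<omega>2: "\<omega> w (- y) y = 1" by (simp add: one)
  have "mstar (u x (- x)) \<rhd> star (\<alpha> x (f y * \<alpha> y (g z) \<lhd> u y z)) =
      star (\<alpha> x (f y * \<alpha> y (g z) \<lhd> u y z) \<lhd> u x (y + z))"
    by (simp add: star_mult_apply wz)
  also have "\<dots> = star ((\<alpha> x (f y * \<alpha> y (g z)) \<lhd> u x y) \<lhd> u w z)"
    by (simp only: cocycle \<omega>1 scaleC_one w_def)
  also have "\<alpha> x (f y * \<alpha> y (g z)) \<lhd> u x y = (\<alpha> x (f y) \<lhd> u x y) * \<alpha> w (g z)"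
    by (simp only: \<alpha>_simps u_simps(6) \<alpha>_\<alpha>_u u_simps(7) w_def)
  \<comment> \<open>Since \<open>z = - w\<close>, the factor containing \<open>g\<close> is exactly
    \<open>invol g w\<close>.\<close>
  also have "star (\<dots> \<lhd> u w z) = invol g w * star (\<alpha> x (f y) \<lhd> u x y)"
    by (simp add: u_simps(6) star_mult star_mult_apply twisted_adj_def wz)
  finally have 1: "mstar (u x (- x)) \<rhd> star (\<alpha> x (f y * \<alpha> y (g z) \<lhd> u y z)) =
      invol g w * star (\<alpha> x (f y) \<lhd> u x y)" .
  have "invol f (- y) = star (\<alpha> (- y) (f y) \<lhd> u (- y) y)"
    by (simp add: twisted_adj_def star_mult_apply)
  \<comment> \<open>The factor \<open>u w (- y + y)\<close> is the identity, inserted to form the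
    left side of \<open>cocycle\<close>.\<close>
  then have "\<alpha> w (invol f (- y)) = star (\<alpha> w (\<alpha> (- y) (f y) \<lhd> u (- y) y) \<lhd> u w (- y + y))"
    by (simp add: \<alpha>_simps)
  also have "\<dots> = star ((u w (- y) \<rhd> \<alpha> x (f y)) \<lhd> u x y)"
    by (simp only: cocycle \<omega>2 scaleC_one \<alpha>_\<alpha>_u wz)
  also have "\<dots> = star (\<alpha> x (f y) \<lhd> u x y) \<lhd> mstar (u w (- y))"
    by (simp only: multiplier_assoc[OF u_mult u_mult] star_mult_apply(1))
  finally have "\<alpha> w (invol f (- y)) \<lhd> u w (- y) = star (\<alpha> x (f y) \<lhd> u x y)"
    by simp
  with 1 show ?thesis
    unfolding w_def[symmetric] z_def[symmetric] wz(4) by (simp only: u_simps(6))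
qed

text \<open>For fixed \<open>x\<close> the adjoint is a bounded real-linear function of the value
  \<open>(f \<diamondop> g) (- x)\<close>, so it passes under a convergent integral; a left
  translation by \<open>- x\<close> then turns the integrand into that of the other side.\<close>

lemma adj_conv:
  assumes one: "\<And>s t. \<omega> s s t = 1" and f: "strongly_integrable M f" and g: "strongly_integrable M g"
  shows "AE x in M. invol (f \<diamondop> g) x = (invol g \<diamondop> invol f) x"
proof -
  have "AE x in M. strongly_integrable M (\<lambda>y. f y * \<alpha> y (g (- y + x)) \<lhd> u y (- y + x))"
    using AE_strongly_integrable_fst[OF strongly_integrable_conv_kernel[OF f g]] by simp
  \<comment> \<open>Convergence is wanted at \<open>- x\<close>, and inversion preserves null
    sets.\<close>
  then have "AE x in distr M M uminus.
      strongly_integrable M (\<lambda>y. f y * \<alpha> y (g (- y + x)) \<lhd> u y (- y + x))"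
    unfolding distr_uminus .
  then have "AE x in M. strongly_integrable M (\<lambda>y. f y * \<alpha> y (g (- y + - x)) \<lhd> u y (- y + - x))"
    by (rule AE_distrD[rotated]) measurable
  then show ?thesis
  proof eventually_elim
    case (elim x)
    have "has_strong_integral M (\<lambda>y. f y * \<alpha> y (g (- y + - x)) \<lhd> u y (- y + - x)) ((f \<diamondop> g) (- x))"
      using strong_integralI[OF elim] by (simp add: twisted_conv_def)
    moreover have "bounded_linear (\<lambda>a. mstar (u x (- x)) \<rhd> star (\<alpha> x a))"
      by (intro bounded_linear_compose[OF multiplier_bounded_linear(1)]
          bounded_linear_compose[OF bounded_linear_star] unitary_multiplierD(2) unitary
          star_automorphism_bounded_linear automorphism)
    ultimately have "has_strong_integral M (\<lambda>y. mstar (u x (- x)) \<rhd>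
        star (\<alpha> x (f y * \<alpha> y (g (- y + - x)) \<lhd> u y (- y + - x)))) (invol (f \<diamondop> g) x)"
      unfolding twisted_adj_def by (rule has_strong_integral_linear)
    then have "has_strong_integral M (\<lambda>y. invol g (x + y) * \<alpha> (x + y) (invol f (- (x + y) + x)) \<lhd>
        u (x + y) (- (x + y) + x)) (invol (f \<diamondop> g) x)"
      unfolding adj_conv_integrand[OF one] .
    from has_strong_integral_distr[OF this _ distr_left[of "- x"]]
    have "has_strong_integral M (\<lambda>y. invol g y * \<alpha> y (invol f (- y + x)) \<lhd> u y (- y + x)) (invol (f \<diamondop> g) x)"
      by (simp only: add_minus_cancel) simp
    then show ?case
      unfolding twisted_conv_def[of M \<alpha> u "invol g"] by (rule strong_integral_eq[symmetric])
  qed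
qed

section \<open>The two triple products\<close>

lemma nn_integral_convolution_pair:
  assumes [measurable]: "a \<in> borel_measurable borel" "b \<in> borel_measurable borel"
  shows "(\<integral>\<^sup>+w. a (fst w) * b (- fst w + snd w) \<partial>(M \<Otimes>\<^sub>M M)) = (\<integral>\<^sup>+y. a y \<partial>M) * (\<integral>\<^sup>+x. b x \<partial>M)"
proof -
  have "(\<lambda>w. a (fst w) * b (- fst w + snd w)) \<in> borel_measurable (M \<Otimes>\<^sub>M M)" by measurable
  from nn_integral_snd[OF this] nn_integral_convolution[OF assms] show ?thesis by simp
qed

abbreviation triple_norm :: "('g \<Rightarrow> 'a) \<Rightarrow> ('g \<Rightarrow> 'a) \<Rightarrow> ('g \<Rightarrow> 'a) \<Rightarrow> 'g \<Rightarrow> 'g \<times> 'g \<Rightarrow> ennreal" where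
  "triple_norm f g h x w \<equiv>
     enorm (f (fst w)) * enorm (g (- fst w + snd w)) * enorm (h (- snd w + x))"

text \<open>Absolute convergence of the double integral at one point. This isolates the pointwise
  argument from the question of which \<open>x\<close> qualify: almost all for integrable functions,
  all when \<open>h\<close> is continuous of compact support.\<close>

definition finite_at :: "('g \<Rightarrow> 'a) \<Rightarrow> ('g \<Rightarrow> 'a) \<Rightarrow> ('g \<Rightarrow> 'a) \<Rightarrow> 'g \<Rightarrow> bool" where
  "finite_at f g h x \<longleftrightarrow> (\<integral>\<^sup>+w. triple_norm f g h x w \<partial>(M \<Otimes>\<^sub>M M)) < \<infinity>"

lemma strongly_integrable_K:
  assumes f: "strongly_measurable M f" and g: "strongly_measurable M g" and h: "strongly_measurable M h"
    and fin: "finite_at f g h x"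
  shows "strongly_integrable (M \<Otimes>\<^sub>M M) (\<lambda>(z, y). K1 f g h z (- z + y) (- y + x))"
    "strongly_integrable (M \<Otimes>\<^sub>M M) (\<lambda>(z, y). K2 f g h z (- z + y) (- y + x))"
proof -
  have bound: "L1_norm (M \<Otimes>\<^sub>M M) (\<lambda>w. K (fst w) (- fst w + snd w) (- snd w + x)) < \<infinity>"
    if "\<And>p q r. norm (K p q r :: 'a) \<le> norm (f p) * norm (g q) * norm (h r)" for K
  proof -
    have "L1_norm (M \<Otimes>\<^sub>M M) (\<lambda>w. K (fst w) (- fst w + snd w) (- snd w + x)) \<le>
        (\<integral>\<^sup>+w. triple_norm f g h x w \<partial>(M \<Otimes>\<^sub>M M))"
      using that by (intro nn_integral_mono) (simp add: ennreal_leI flip: ennreal_mult)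
    with fin show ?thesis by (simp add: finite_at_def)
  qed
  show "strongly_integrable (M \<Otimes>\<^sub>M M) (\<lambda>(z, y). K1 f g h z (- z + y) (- y + x))"
    unfolding case_prod_unfold strongly_integrable_def
    using bound[of "K1 f g h", OF norm_K1_le] by (auto intro!: strongly_measurable_K1 f g h)
  show "strongly_integrable (M \<Otimes>\<^sub>M M) (\<lambda>(z, y). K2 f g h z (- z + y) (- y + x))"
    unfolding case_prod_unfold strongly_integrable_def
    using bound[of "K2 f g h", OF norm_K2_le] by (auto intro!: strongly_measurable_K2 f g h)
qed

text \<open>In \<open>ennreal\<close> a zero factor hides an infinite one, so Tonelli's theorem
  yields finiteness of a section only where the remaining factor is nonzero.\<close>

lemma finite_at_sections:
  assumes f: "strongly_measurable M f" and g: "strongly_measurable M g" and h: "strongly_measurable M h"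
    and fin: "finite_at f g h x"
  shows "AE z in M. f z \<noteq> 0 \<longrightarrow>
      (\<integral>\<^sup>+y. enorm (g (- z + y)) * enorm (h (- y + x)) \<partial>M) < \<infinity>"
    "AE y in M. h (- y + x) \<noteq> 0 \<longrightarrow>
      (\<integral>\<^sup>+z. enorm (f z) * enorm (g (- z + y)) \<partial>M) < \<infinity>"
proof -
  note [measurable] = f[THEN norm_borel]
    g[THEN norm_borel] h[THEN norm_borel]
  have m: "(\<lambda>w. triple_norm f g h x w) \<in> borel_measurable (M \<Otimes>\<^sub>M M)"
    by measurable
  have "(\<integral>\<^sup>+z. (\<integral>\<^sup>+y. triple_norm f g h x (z, y) \<partial>M) \<partial>M) < \<infinity>"
    using fin nn_integral_fst_M[OF m] by (simp add: finite_at_def)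
  then have "AE z in M. (\<integral>\<^sup>+y. triple_norm f g h x (z, y) \<partial>M) \<noteq> \<infinity>"
    using nn_integral_noteq_infinite[OF sigma_finite_measure.borel_measurable_nn_integral_fst[OF sigma_finite_M m]]
    by simp
  then show "AE z in M. f z \<noteq> 0 \<longrightarrow>
      (\<integral>\<^sup>+y. enorm (g (- z + y)) * enorm (h (- y + x)) \<partial>M) < \<infinity>"
  proof eventually_elim
    case (elim z)
    have "(\<integral>\<^sup>+y. triple_norm f g h x (z, y) \<partial>M) =
        enorm (f z) * (\<integral>\<^sup>+y. enorm (g (- z + y)) * enorm (h (- y + x)) \<partial>M)"
      unfolding mult.assoc fst_conv snd_conv by (rule nn_integral_cmult) measurable
    with elim show ?case by (auto simp: less_top ennreal_mult_less_top)
  qed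
  have "(\<integral>\<^sup>+y. (\<integral>\<^sup>+z. triple_norm f g h x (z, y) \<partial>M) \<partial>M) < \<infinity>"
    using fin nn_integral_snd[OF m] by (simp add: finite_at_def)
  then have "AE y in M. (\<integral>\<^sup>+z. triple_norm f g h x (z, y) \<partial>M) \<noteq> \<infinity>"
    using nn_integral_noteq_infinite[OF sigma_finite_measure.borel_measurable_nn_integral_fst[OF
          sigma_finite_M measurable_pair_swap[OF m]]]
    by (simp add: case_prod_unfold)
  then show "AE y in M. h (- y + x) \<noteq> 0 \<longrightarrow>
      (\<integral>\<^sup>+z. enorm (f z) * enorm (g (- z + y)) \<partial>M) < \<infinity>"
  proof eventually_elim
    case (elim y)
    have "(\<integral>\<^sup>+z. triple_norm f g h x (z, y) \<partial>M) =
        (\<integral>\<^sup>+z. enorm (f z) * enorm (g (- z + y)) \<partial>M) * enorm (h (- y + x))"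
      unfolding fst_conv snd_conv by (rule nn_integral_multc) measurable
    with elim show ?case by (auto simp: less_top ennreal_mult_less_top)
  qed
qed

text \<open>Fubini's theorem is used with \<open>y\<close> outermost, hence the coordinate swap. The
  inner integral over \<open>z\<close> is \<open>(f \<diamondop> g) y\<close>, and the factors
  depending only on \<open>y\<close> form a bounded linear map applied to it.\<close>

lemma has_strong_integral_K1:
  assumes f: "strongly_integrable M f" and g: "strongly_integrable M g" and h: "strongly_integrable M h"
    and fin: "finite_at f g h x"
  shows "has_strong_integral (M \<Otimes>\<^sub>M M) (\<lambda>(z, y). K1 f g h z (- z + y) (- y + x)) (((f \<diamondop> g) \<diamondop> h) x)"
proof -
  let ?K = "\<lambda>(z, y). K1 f g h z (- z + y) (- y + x)"
  let ?I = "strong_integral (M \<Otimes>\<^sub>M M) ?K"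
  have fm: "strongly_measurable M f" and gm: "strongly_measurable M g" and hm: "strongly_measurable M h"
    using f g h by (auto simp: strongly_integrable_def)
  have K: "has_strong_integral (M \<Otimes>\<^sub>M M) ?K ?I"
    by (rule strong_integralI[OF strongly_integrable_K(1)[OF fm gm hm fin]])
  have swap: "(\<lambda>(y, z). (z, y)) \<in> measurable (M \<Otimes>\<^sub>M M) (M \<Otimes>\<^sub>M M)" by measurable
  have "has_strong_integral (M \<Otimes>\<^sub>M M) (\<lambda>w. ?K (case w of (y, z) \<Rightarrow> (z, y))) ?I"
    by (rule has_strong_integral_distr[OF K swap distr_pair_swap[symmetric]])
  then have K': "strongly_integrable (M \<Otimes>\<^sub>M M) (\<lambda>w. ?K (case w of (y, z) \<Rightarrow> (z, y)))"
    and I: "strong_integral (M \<Otimes>\<^sub>M M) (\<lambda>w. ?K (case w of (y, z) \<Rightarrow> (z, y))) = ?I"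
    by (simp_all only: has_strong_integral_iff)
  have J: "has_strong_integral M (\<lambda>y. strong_integral M (\<lambda>z. K1 f g h z (- z + y) (- y + x))) ?I"
    using has_strong_integral_fst[OF K'] unfolding I by simp
  have "has_strong_integral M (\<lambda>y. (f \<diamondop> g) y * \<alpha> y (h (- y + x)) \<lhd> u y (- y + x)) ?I"
  proof (rule has_strong_integral_cong_AE[OF J])
    have "strongly_measurable M (f \<diamondop> g)"
      using strongly_integrable_conv[OF f g] by (simp add: strongly_integrable_def)
    then show "strongly_measurable M (\<lambda>y. (f \<diamondop> g) y * \<alpha> y (h (- y + x)) \<lhd> u y (- y + x))"
      by (intro product_measurability strongly_measurable_group_fun[OF hm]) measurable
    show "AE y in M. strong_integral M (\<lambda>z. K1 f g h z (- z + y) (- y + x)) =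
        (f \<diamondop> g) y * \<alpha> y (h (- y + x)) \<lhd> u y (- y + x)"
      using finite_at_sections(2)[OF fm gm hm fin]
    proof eventually_elim
      case (elim y)
      show ?case
      \<comment> \<open>If \<open>h (- y + x)\<close> vanishes, the inner convolution may diverge,
        but both sides are then \<open>0\<close>.\<close>
      proof (cases "h (- y + x) = 0")
        case True
        have "strong_integral M (\<lambda>z. K1 f g h z (- z + y) (- y + x)) = strong_integral M (\<lambda>_. 0)"
          using norm_K1_le[of f g h _ _ "- y + x"] True by simp
        also have "\<dots> = 0" by (rule strong_integral_eq[OF has_strong_integral_zero])
        finally show ?thesis
          using True linear_0[OF bounded_linear.linear[OF multiplier_bounded_linear(2)[OF u_mult]]]
          by (simp add: \<alpha>_simps)
      next
        case False
        have "has_strong_integral M (\<lambda>z. f z * \<alpha> z (g (- z + y)) \<lhd> u z (- z + y)) ((f \<diamondop> g) y)"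
          unfolding twisted_conv_def
          using elim False by (intro strong_integralI strongly_integrable_conv_at fm gm) auto
        moreover have "bounded_linear (\<lambda>a. a * \<alpha> y (h (- y + x)) \<lhd> u y (- y + x))"
          by (rule bounded_linear_compose[OF multiplier_bounded_linear(2)[OF u_mult] bounded_linear_mult_left])
        ultimately have "has_strong_integral M
            (\<lambda>z. (f z * \<alpha> z (g (- z + y)) \<lhd> u z (- z + y)) * \<alpha> y (h (- y + x)) \<lhd> u y (- y + x))
            ((f \<diamondop> g) y * \<alpha> y (h (- y + x)) \<lhd> u y (- y + x))"
          by (rule has_strong_integral_linear)
        then show ?thesis
          unfolding K1_def group_cancel(1) by (rule strong_integral_eq)
      qed
    qed
  qed
  then have "((f \<diamondop> g) \<diamondop> h) x = ?I"
    unfolding twisted_conv_def[of M \<alpha> u "f \<diamondop> g"] by (rule strong_integral_eq)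
  with K show ?thesis by simp
qed

text \<open>Here \<open>z\<close> is outermost and the factors depending on it form the linear map;
  the substitution \<open>w = - z + y\<close> identifies the inner integral with
  \<open>(g \<diamondop> h) (- z + x)\<close>.\<close>

lemma has_strong_integral_K2:
  assumes f: "strongly_integrable M f" and g: "strongly_integrable M g" and h: "strongly_integrable M h"
    and fin: "finite_at f g h x"
  shows "has_strong_integral (M \<Otimes>\<^sub>M M) (\<lambda>(z, y). K2 f g h z (- z + y) (- y + x)) ((f \<diamondop> (g \<diamondop> h)) x)"
proof -
  let ?K = "\<lambda>(z, y). K2 f g h z (- z + y) (- y + x)"
  let ?I = "strong_integral (M \<Otimes>\<^sub>M M) ?K"
  have fm: "strongly_measurable M f" and gm: "strongly_measurable M g" and hm: "strongly_measurable M h"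
    using f g h by (auto simp: strongly_integrable_def)
  have Ki: "strongly_integrable (M \<Otimes>\<^sub>M M) ?K"
    by (rule strongly_integrable_K(2)[OF fm gm hm fin])
  have J: "has_strong_integral M (\<lambda>z. strong_integral M (\<lambda>y. K2 f g h z (- z + y) (- y + x))) ?I"
    using has_strong_integral_fst[OF Ki] by simp
  have "has_strong_integral M (\<lambda>z. f z * \<alpha> z ((g \<diamondop> h) (- z + x)) \<lhd> u z (- z + x)) ?I"
  proof (rule has_strong_integral_cong_AE[OF J])
    have ghm: "strongly_measurable M (g \<diamondop> h)"
      using strongly_integrable_conv[OF g h] by (simp add: strongly_integrable_def)
    show "strongly_measurable M (\<lambda>z. f z * \<alpha> z ((g \<diamondop> h) (- z + x)) \<lhd> u z (- z + x))"
      by (intro product_measurability strongly_measurable_group_fun[OF ghm] fm) measurable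
    show "AE z in M. strong_integral M (\<lambda>y. K2 f g h z (- z + y) (- y + x)) =
        f z * \<alpha> z ((g \<diamondop> h) (- z + x)) \<lhd> u z (- z + x)"
      using finite_at_sections(1)[OF fm gm hm fin]
    proof eventually_elim
      case (elim z)
      show ?case
      proof (cases "f z = 0")
        case True
        have "strong_integral M (\<lambda>y. K2 f g h z (- z + y) (- y + x)) = strong_integral M (\<lambda>_. 0)"
          using norm_K2_le[of f g h z] True by simp
        also have "\<dots> = 0" by (rule strong_integral_eq[OF has_strong_integral_zero])
        finally show ?thesis
          using True linear_0[OF bounded_linear.linear[OF multiplier_bounded_linear(2)[OF u_mult]]]
          by simp
      next
        case False
        note [measurable] = gm[THEN norm_borel]
          hm[THEN norm_borel]
        have "(\<integral>\<^sup>+w. enorm (g w) * enorm (h (- w + (- z + x))) \<partial>M) =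
            (\<integral>\<^sup>+y. enorm (g (- z + y)) * enorm (h (- (- z + y) + (- z + x))) \<partial>M)"
          by (rule nn_integral_left[symmetric]) measurable
        also have "\<dots> < \<infinity>" unfolding group_cancel(3) using elim False by simp
        finally have "has_strong_integral M
            (\<lambda>w. g w * \<alpha> w (h (- w + (- z + x))) \<lhd> u w (- w + (- z + x))) ((g \<diamondop> h) (- z + x))"
          unfolding twisted_conv_def
          by (intro strong_integralI strongly_integrable_conv_at gm hm)
        from has_strong_integral_distr[OF this _ distr_left[of "- z"]]
        have "has_strong_integral M
            (\<lambda>y. g (- z + y) * \<alpha> (- z + y) (h (- y + x)) \<lhd> u (- z + y) (- y + x)) ((g \<diamondop> h) (- z + x))"
          by (simp only: group_cancel(3)) simp
        moreover have "bounded_linear (\<lambda>a. f z * \<alpha> z a \<lhd> u z (- z + x))"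
          by (intro bounded_linear_compose[OF multiplier_bounded_linear(2)[OF u_mult]]
              bounded_linear_compose[OF bounded_linear_mult_right] star_automorphism_bounded_linear
              automorphism)
        ultimately have "has_strong_integral M
            (\<lambda>y. f z * \<alpha> z (g (- z + y) * \<alpha> (- z + y) (h (- y + x)) \<lhd> u (- z + y) (- y + x)) \<lhd> u z (- z + x))
            (f z * \<alpha> z ((g \<diamondop> h) (- z + x)) \<lhd> u z (- z + x))"
          by (rule has_strong_integral_linear)
        then show ?thesis
          unfolding K2_def group_cancel(2) by (rule strong_integral_eq)
      qed
    qed
  qed
  then have "(f \<diamondop> (g \<diamondop> h)) x = ?I"
    unfolding twisted_conv_def[of M \<alpha> u f "g \<diamondop> h"] by (rule strong_integral_eq)
  with strong_integralI[OF Ki] show ?thesis by simp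
qed

text \<open>Integrating over \<open>x\<close> first replaces the factor with \<open>h\<close> by its
  norm, so by Tonelli the total is the product of the three norms.\<close>

lemma triple_finite:
  assumes f: "strongly_integrable M f" and g: "strongly_integrable M g" and h: "strongly_integrable M h"
  shows "(\<integral>\<^sup>+(x, z, y). triple_norm f g h x (z, y)
      \<partial>(M \<Otimes>\<^sub>M (M \<Otimes>\<^sub>M M))) < \<infinity>"
    "AE x in M. finite_at f g h x"
proof -
  have fm: "strongly_measurable M f" and gm: "strongly_measurable M g" and hm: "strongly_measurable M h"
    using f g h by (auto simp: strongly_integrable_def)
  note [measurable] = fm[THEN norm_borel]
    gm[THEN norm_borel] hm[THEN norm_borel]
  define F where "F x w = triple_norm f g h x w" for x w
  have Fm: "(\<lambda>(x, w). F x w) \<in> borel_measurable (M \<Otimes>\<^sub>M (M \<Otimes>\<^sub>M M))"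
    unfolding F_def by measurable
  have "(\<integral>\<^sup>+x. (\<integral>\<^sup>+w. F x w \<partial>(M \<Otimes>\<^sub>M M)) \<partial>M) = (\<integral>\<^sup>+w. (\<integral>\<^sup>+x. F x w \<partial>M) \<partial>(M \<Otimes>\<^sub>M M))"
    using triple.Fubini'[OF Fm] by simp
  also have "\<dots> = (\<integral>\<^sup>+w. enorm (f (fst w)) * enorm (g (- fst w + snd w)) *
      L1_norm M h \<partial>(M \<Otimes>\<^sub>M M))"
  proof (rule nn_integral_cong)
    fix w :: "'g \<times> 'g"
    have "L1_norm M (\<lambda>x. h (- snd w + x)) = L1_norm M h"
      by (rule nn_integral_left) measurable
    then show "(\<integral>\<^sup>+x. F x w \<partial>M) = enorm (f (fst w)) * enorm (g (- fst w + snd w)) *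
        L1_norm M h"
      unfolding F_def by (subst nn_integral_cmult) simp_all
  qed
  also have "\<dots> = (\<integral>\<^sup>+w. enorm (f (fst w)) * enorm (g (- fst w + snd w)) \<partial>(M \<Otimes>\<^sub>M M)) *
      L1_norm M h"
    by (rule nn_integral_multc) measurable
  also have "(\<integral>\<^sup>+w. enorm (f (fst w)) * enorm (g (- fst w + snd w)) \<partial>(M \<Otimes>\<^sub>M M)) =
      L1_norm M f * L1_norm M g"
    by (rule nn_integral_convolution_pair) measurable
  also have "\<dots> * L1_norm M h < \<infinity>"
    using f g h by (simp add: strongly_integrable_def ennreal_mult_less_top)
  finally have fin: "(\<integral>\<^sup>+x. (\<integral>\<^sup>+w. F x w \<partial>(M \<Otimes>\<^sub>M M)) \<partial>M) < \<infinity>" .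
  have "(\<lambda>x. \<integral>\<^sup>+w. F x w \<partial>(M \<Otimes>\<^sub>M M)) \<in> borel_measurable M"
    using sigma_finite_measure.borel_measurable_nn_integral[OF sigma_finite_MM Fm] .
  from nn_integral_noteq_infinite[OF this] fin
  have "AE x in M. (\<integral>\<^sup>+w. F x w \<partial>(M \<Otimes>\<^sub>M M)) \<noteq> \<infinity>" by auto
  then show "AE x in M. finite_at f g h x"
    by eventually_elim (simp add: finite_at_def F_def less_top)
  show "(\<integral>\<^sup>+(x, z, y). triple_norm f g h x (z, y)
      \<partial>(M \<Otimes>\<^sub>M (M \<Otimes>\<^sub>M M))) < \<infinity>"
    using fin nn_integral_fst_MM[OF Fm]
    by (simp add: F_def case_prod_unfold)
qed

text \<open>A bound \<open>B\<close> for \<open>h\<close> replaces the only factor that depends on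
  \<open>x\<close>, so convergence holds at every \<open>x\<close>.\<close>

lemma finite_at_cc_functions:
  assumes f: "strongly_integrable M f" and g: "strongly_integrable M g"
    and h: "h \<in> cc_functions"
  shows "finite_at f g h x"
proof -
  have fm: "strongly_measurable M f" and gm: "strongly_measurable M g"
    using f g by (auto simp: strongly_integrable_def)
  note [measurable] = fm[THEN norm_borel]
    gm[THEN norm_borel]
  obtain B where B: "0 \<le> B" "\<And>x. norm (h x) \<le> B" using cc_functions_bounded[OF h] by blast
  have "(\<integral>\<^sup>+w. triple_norm f g h x w \<partial>(M \<Otimes>\<^sub>M M)) \<le>
      (\<integral>\<^sup>+w. enorm (f (fst w)) * enorm (g (- fst w + snd w)) * ennreal B \<partial>(M \<Otimes>\<^sub>M M))"
    using B by (intro nn_integral_mono mult_left_mono ennreal_leI) auto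
  also have "\<dots> = (\<integral>\<^sup>+w. enorm (f (fst w)) * enorm (g (- fst w + snd w)) \<partial>(M \<Otimes>\<^sub>M M)) * ennreal B"
    by (rule nn_integral_multc) measurable
  also have "(\<integral>\<^sup>+w. enorm (f (fst w)) * enorm (g (- fst w + snd w)) \<partial>(M \<Otimes>\<^sub>M M)) =
      L1_norm M f * L1_norm M g"
    by (rule nn_integral_convolution_pair) measurable
  also have "\<dots> * ennreal B < \<infinity>"
    using f g by (simp add: strongly_integrable_def ennreal_mult_less_top)
  finally show ?thesis by (simp add: finite_at_def)
qed

section \<open>Associativity forces the associator to be trivial\<close>

lemma strongly_integrable_K_triple:
  assumes f: "strongly_integrable M f" and g: "strongly_integrable M g" and h: "strongly_integrable M h"
  shows "strongly_integrable (M \<Otimes>\<^sub>M (M \<Otimes>\<^sub>M M))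
    (\<lambda>(x, z, y). K1 f g h z (- z + y) (- y + x) - K2 f g h z (- z + y) (- y + x))"
proof -
  let ?N = "M \<Otimes>\<^sub>M (M \<Otimes>\<^sub>M M)"
  have fm: "strongly_measurable M f" and gm: "strongly_measurable M g" and hm: "strongly_measurable M h"
    using f g h by (auto simp: strongly_integrable_def)
  have bound: "(\<integral>\<^sup>+w. enorm (K (fst (snd w)) (- fst (snd w) + snd (snd w)) (- snd (snd w) + fst w)) \<partial>?N) < \<infinity>"
    if "\<And>p q r. norm (K p q r :: 'a) \<le> norm (f p) * norm (g q) * norm (h r)" for K
  proof -
    have "(\<integral>\<^sup>+w. enorm (K (fst (snd w)) (- fst (snd w) + snd (snd w)) (- snd (snd w) + fst w)) \<partial>?N) \<le>
        (\<integral>\<^sup>+(x, z, y). triple_norm f g h x (z, y) \<partial>?N)"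
      using that by (intro nn_integral_mono) (simp add: case_prod_unfold ennreal_leI flip: ennreal_mult)
    with triple_finite(1)[OF f g h] show ?thesis by simp
  qed
  have "strongly_integrable ?N (\<lambda>w. K1 f g h (fst (snd w)) (- fst (snd w) + snd (snd w)) (- snd (snd w) + fst w))"
    "strongly_integrable ?N (\<lambda>w. K2 f g h (fst (snd w)) (- fst (snd w) + snd (snd w)) (- snd (snd w) + fst w))"
    unfolding strongly_integrable_def
    using bound[of "K1 f g h", OF norm_K1_le] bound[of "K2 f g h", OF norm_K2_le]
    by (auto intro!: strongly_measurable_K1 strongly_measurable_K2 fm gm hm)
  from strongly_integrable_diff[OF this] show ?thesis by (simp add: case_prod_unfold)
qed

text \<open>The difference of the triple products at \<open>x\<close> is an integral over
  \<open>(z, y)\<close>; it vanishes for almost every \<open>x\<close>, so by Fubini the integral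
  over all three variables is \<open>0\<close>. \<open>distr_translations\<close> rewrites it in the
  coordinates \<open>p\<close>, \<open>q\<close>, \<open>r\<close>.\<close>

lemma has_strong_integral_associator:
  assumes f: "strongly_integrable M f" and g: "strongly_integrable M g" and h: "strongly_integrable M h"
    and assoc: "AE x in M. ((f \<diamondop> g) \<diamondop> h) x = (f \<diamondop> (g \<diamondop> h)) x"
  shows "has_strong_integral (M \<Otimes>\<^sub>M (M \<Otimes>\<^sub>M M)) (\<lambda>(p, q, r). K1 f g h p q r - K2 f g h p q r) 0"
proof -
  let ?N = "M \<Otimes>\<^sub>M (M \<Otimes>\<^sub>M M)"
  let ?D = "\<lambda>(x, z, y). K1 f g h z (- z + y) (- y + x) - K2 f g h z (- z + y) (- y + x)"
  note D = strongly_integrable_K_triple[OF f g h]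
  have "AE x in M. strong_integral (M \<Otimes>\<^sub>M M) (\<lambda>w. ?D (x, w)) = 0"
    using triple_finite(2)[OF f g h] assoc
  proof eventually_elim
    case (elim x)
    have "has_strong_integral (M \<Otimes>\<^sub>M M) (\<lambda>w. ?D (x, w)) (((f \<diamondop> g) \<diamondop> h) x - (f \<diamondop> (g \<diamondop> h)) x)"
      using has_strong_integral_diff[OF has_strong_integral_K1[OF f g h elim(1)]
          has_strong_integral_K2[OF f g h elim(1)]]
      by (simp add: case_prod_unfold)
    from strong_integral_eq[OF this] show ?case using elim(2) by simp
  qed
  with triple.has_strong_integral_fst[OF D] have "strong_integral ?N ?D = 0"
    by (rule has_strong_integral_AE_zero)
  with strong_integralI[OF D] have "has_strong_integral ?N ?D 0" by simp
  from has_strong_integral_distr[OF this _ distr_translations]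
  have "has_strong_integral ?N (\<lambda>w. ?D (case w of (p, q, r) \<Rightarrow> (p + q + r, p, p + q))) 0"
    by simp
  moreover have "- (p + q) + (p + q + r) = r" "- p + (p + q) = q" for p q r :: 'g
    by (rule minus_add_cancel)+
  ultimately show ?thesis by (simp add: case_prod_unfold)
qed

lemma u_scaleR: "(c *\<^sub>R a) \<lhd> u x y = c *\<^sub>R (a \<lhd> u x y)"
  using bounded_linear.linear[OF multiplier_bounded_linear(2)[OF u_mult]] by (rule linear_scale)

text \<open>With indicators for \<open>a\<close>, \<open>b\<close>, \<open>c\<close>, cutting off
  the three functions amounts to restricting the kernel to a box.\<close>

lemma K1_scaleR:
  "K1 (\<lambda>p. a p *\<^sub>R f p) (\<lambda>q. b q *\<^sub>R g q) (\<lambda>r. c r *\<^sub>R h r) p q r = (a p * b q * c r) *\<^sub>R K1 f g h p q r"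
  unfolding K1_eq
  by (simp only: \<alpha>_simps(5) mult_scaleR_left mult_scaleR_right u_scaleR scaleR_scaleR mult_ac)

lemma K2_scaleR:
  "K2 (\<lambda>p. a p *\<^sub>R f p) (\<lambda>q. b q *\<^sub>R g q) (\<lambda>r. c r *\<^sub>R h r) p q r = (a p * b q * c r) *\<^sub>R K2 f g h p q r"
  by (simp add: K2_eq K1_scaleR scaleC_scaleR)

text \<open>Associativity of functions cut off to \<open>A\<close>, \<open>B\<close>,
  \<open>C\<close> gives a zero integral over the box. The extension takes two passes: with
  \<open>A\<close> fixed, from \<open>B \<times> C\<close> to all measurable sets of pairs, and then
  from \<open>A \<times> E\<close> to all measurable sets of triples.\<close>

lemma AE_K1_eq_K2:
  assumes f: "strongly_integrable M f" and g: "strongly_integrable M g" and h: "strongly_integrable M h"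
    and assoc: "\<And>f g h. strongly_integrable M f \<Longrightarrow> strongly_integrable M g \<Longrightarrow>
      strongly_integrable M h \<Longrightarrow> AE x in M. ((f \<diamondop> g) \<diamondop> h) x = (f \<diamondop> (g \<diamondop> h)) x"
  shows "AE (p, q, r) in M \<Otimes>\<^sub>M (M \<Otimes>\<^sub>M M). K1 f g h p q r = K2 f g h p q r"
proof -
  let ?N = "M \<Otimes>\<^sub>M (M \<Otimes>\<^sub>M M)"
  let ?K = "\<lambda>(p, q, r). K1 f g h p q r - K2 f g h p q r"
  have K: "strongly_integrable ?N ?K"
    using has_strong_integral_associator[OF f g h assoc[OF f g h]]
    by (rule has_strong_integralD)
  have rect: "strong_integral ?N (\<lambda>w. indicat_real (B \<times> C) (snd w) *\<^sub>R (indicat_real A (fst w) *\<^sub>R ?K w)) = 0"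
    if A: "A \<in> sets M" and B: "B \<in> sets M" and C: "C \<in> sets M" for A B C
  proof -
    let ?f = "\<lambda>p. indicat_real A p *\<^sub>R f p" and ?g = "\<lambda>q. indicat_real B q *\<^sub>R g q"
      and ?h = "\<lambda>r. indicat_real C r *\<^sub>R h r"
    note fgh = strongly_integrable_indicator[OF f A] strongly_integrable_indicator[OF g B]
      strongly_integrable_indicator[OF h C]
    have "(\<lambda>(p, q, r). K1 ?f ?g ?h p q r - K2 ?f ?g ?h p q r) =
        (\<lambda>w. indicat_real (B \<times> C) (snd w) *\<^sub>R (indicat_real A (fst w) *\<^sub>R ?K w))"
      by (auto simp: fun_eq_iff K1_scaleR K2_scaleR indicator_times scaleR_diff_right mult_ac)
    with strong_integral_eq[OF has_strong_integral_associator[OF fgh assoc[OF fgh]]]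
    show ?thesis by simp
  qed
  have step: "strong_integral ?N (\<lambda>w. indicat_real D (snd w) *\<^sub>R (indicat_real A (fst w) *\<^sub>R ?K w)) = 0"
    if A: "A \<in> sets M" and D: "D \<in> sets (M \<Otimes>\<^sub>M M)" for A D
  proof (rule strong_integral_zero_sigma_sets)
    have "strongly_integrable ?N (\<lambda>w. indicat_real (A \<times> space (M \<Otimes>\<^sub>M M)) w *\<^sub>R ?K w)"
      using A by (intro strongly_integrable_indicator K) simp
    then show "strongly_integrable ?N (\<lambda>w. indicat_real A (fst w) *\<^sub>R ?K w)"
      by (simp add: indicator_times case_prod_unfold space_pair_measure)
    show "Int_stable {a \<times> b | a b. a \<in> sets M \<and> b \<in> sets M}"
      by (rule Int_stable_pair_measure_generator)
    show "{a \<times> b | a b. a \<in> sets M \<and> b \<in> sets M} \<subseteq> Pow (space M \<times> space M)"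
      by (rule pair_measure_closed)
    show "space M \<times> space M \<in> {a \<times> b | a b. a \<in> sets M \<and> b \<in> sets M}" by blast
    show "snd \<in> measurable ?N (sigma (space M \<times> space M) {a \<times> b | a b. a \<in> sets M \<and> b \<in> sets M})"
      using measurable_snd[of M "M \<Otimes>\<^sub>M M"] measurable_cong_sets[OF refl sigma_pair_measure(2)[of M M]] by blast
    show "D \<in> sigma_sets (space M \<times> space M) {a \<times> b | a b. a \<in> sets M \<and> b \<in> sets M}"
      unfolding sigma_pair_measure by (rule D)
    show "strong_integral ?N (\<lambda>w. indicat_real X (snd w) *\<^sub>R (indicat_real A (fst w) *\<^sub>R ?K w)) = 0"
      if "X \<in> {a \<times> b | a b. a \<in> sets M \<and> b \<in> sets M}" for X
      using that rect[OF A] by blast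
  qed
  have "AE w in ?N. ?K w = 0"
  proof (rule AE_zero_if_strong_integrals_zero[OF K])
    fix D assume D: "D \<in> sets ?N"
    let ?G = "{a \<times> b | a b. a \<in> sets M \<and> b \<in> sets (M \<Otimes>\<^sub>M M)}"
    show "strong_integral ?N (\<lambda>w. indicat_real D w *\<^sub>R ?K w) = 0"
    proof (rule strong_integral_zero_sigma_sets[OF K])
      show "Int_stable ?G" by (rule Int_stable_pair_measure_generator)
      show "?G \<subseteq> Pow (space M \<times> space (M \<Otimes>\<^sub>M M))" by (rule pair_measure_closed)
      show "space M \<times> space (M \<Otimes>\<^sub>M M) \<in> ?G" by blast
      show "(\<lambda>w. w) \<in> measurable ?N (sigma (space M \<times> space (M \<Otimes>\<^sub>M M)) ?G)"
        unfolding measurable_cong_sets[OF refl sigma_pair_measure(2)]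
        by (rule measurable_ident_sets[OF refl])
      show "D \<in> sigma_sets (space M \<times> space (M \<Otimes>\<^sub>M M)) ?G"
        unfolding sigma_pair_measure by (rule D)
      fix X assume "X \<in> ?G"
      then obtain A E where X: "X = A \<times> E" "A \<in> sets M" "E \<in> sets (M \<Otimes>\<^sub>M M)" by blast
      have "(\<lambda>w. indicat_real X w *\<^sub>R ?K w) =
          (\<lambda>w. indicat_real E (snd w) *\<^sub>R (indicat_real A (fst w) *\<^sub>R ?K w))"
        by (auto simp: X(1) fun_eq_iff indicator_times)
      with step[OF X(2,3)] show "strong_integral ?N (\<lambda>w. indicat_real X w *\<^sub>R ?K w) = 0" by simp
    qed
  qed
  then show ?thesis by eventually_elim auto
qed

lemma AE_character_one:
  assumes "continuous_on UNIV c" and "AE x in M. c x = (1::complex)"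
  shows "c x = 1"
proof (rule ccontr)
  assume "c x \<noteq> 1"
  have "open (c -` (- {1}))" using assms(1) by (intro open_vimage) auto
  moreover have "x \<in> c -` (- {1})" using \<open>c x \<noteq> 1\<close> by simp
  ultimately have "0 < emeasure M (c -` (- {1}))" by (intro emeasure_open) auto
  moreover have "emeasure M (c -` (- {1})) = 0"
  proof -
    have "{x \<in> space M. \<not> c x = 1} = c -` (- {1})" by auto
    moreover have "c -` (- {1}) \<in> sets M"
      using \<open>open (c -` (- {1}))\<close> by (simp add: sets_M)
    ultimately show ?thesis using AE_E2[OF assms(2)] by simp
  qed
  ultimately show False by simp
qed

text \<open>With \<open>f p = \<alpha> p e\<close>, \<open>g q = \<alpha> q (star a)\<close> and \<open>h r = a\<close> (cut off to a set of finite measure)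
  the kernel \<open>K1\<close> has the norm of \<open>e * \<alpha> q (star a * a)\<close>.  Since the range of
  \<open>q \<mapsto> star (\<alpha> q (star a * a))\<close> is separable, countably many \<open>e\<close> suffice to make this nonzero for
  every \<open>q\<close>, even if \<open>A\<close> is not separable.\<close>

lemma \<omega>_eq_one:
  fixes a :: 'a
  assumes a: "a \<noteq> 0"
    and assoc: "\<And>f g h. strongly_integrable M f \<Longrightarrow> strongly_integrable M g \<Longrightarrow>
      strongly_integrable M h \<Longrightarrow> AE x in M. ((f \<diamondop> g) \<diamondop> h) x = (f \<diamondop> (g \<diamondop> h)) x"
  shows "\<omega> x y z = 1"
proof -
  let ?N = "M \<Otimes>\<^sub>M (M \<Otimes>\<^sub>M M)"
  define k where "k = star a * a"
  have norm_k: "norm k = (norm a)\<^sup>2" by (simp add: k_def cstar_identity)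
  then have k: "0 < norm k" using a by simp
  have \<alpha>m: "strongly_measurable M (\<lambda>x. \<alpha> x b)" for b
    by (intro strongly_measurable_\<alpha> strongly_measurable_const) (simp add: sets_M)
  obtain E where E: "countable E" "(\<lambda>x. star (\<alpha> x k)) ` space M \<subseteq> closure E"
    using strongly_measurable_separable[OF strongly_measurable_star[OF \<alpha>m[of k]]] by blast
  obtain V :: "nat \<Rightarrow> 'g set" where V: "range V \<subseteq> sets M" "(\<Union>i. V i) = space M"
    "\<And>i. emeasure M (V i) \<noteq> \<infinity>" "incseq V"
    using sigma_finite_measure.sigma_finite_incseq[OF sigma_finite_M] by blast
  define cut where "cut n F x = indicat_real (V n) x *\<^sub>R F x" for n and F :: "'g \<Rightarrow> 'a" and x
  have cut: "strongly_integrable M (cut n F)"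
    if F: "strongly_measurable M F" and bound: "\<And>x. norm (F x) \<le> B" for n F B
  proof -
    have Vn: "V n \<in> sets M" using V(1) by auto
    have "L1_norm M (\<lambda>x. cut n F x) \<le> (\<integral>\<^sup>+x. ennreal B * indicator (V n) x \<partial>M)"
      by (intro nn_integral_mono) (auto simp: cut_def indicator_def intro!: ennreal_leI bound)
    also have "\<dots> = ennreal B * emeasure M (V n)"
      using Vn by (rule nn_integral_cmult_indicator)
    also have "\<dots> < \<infinity>" using V(3)[of n] by (simp add: ennreal_mult_less_top less_top)
    finally show ?thesis
      using Vn F by (simp add: strongly_integrable_def cut_def[abs_def] strongly_measurable_scaleR)
  qed
  \<comment> \<open>Only countably many \<open>n\<close> and \<open>e\<close> occur, so a single
    null set serves for all of them.\<close>
  have "AE (p, q, r) in ?N. \<forall>n. \<forall>e\<in>E.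
      K1 (cut n (\<lambda>p. \<alpha> p e)) (cut n (\<lambda>q. \<alpha> q (star a))) (cut n (\<lambda>_. a)) p q r =
      K2 (cut n (\<lambda>p. \<alpha> p e)) (cut n (\<lambda>q. \<alpha> q (star a))) (cut n (\<lambda>_. a)) p q r"
  proof -
    have "AE w in ?N. \<forall>n. \<forall>e\<in>E. case w of (p, q, r) \<Rightarrow>
      K1 (cut n (\<lambda>p. \<alpha> p e)) (cut n (\<lambda>q. \<alpha> q (star a))) (cut n (\<lambda>_. a)) p q r =
      K2 (cut n (\<lambda>p. \<alpha> p e)) (cut n (\<lambda>q. \<alpha> q (star a))) (cut n (\<lambda>_. a)) p q r"
      unfolding AE_all_countable
      by (intro allI AE_ball_countable[OF E(1), THEN iffD2] ballI AE_K1_eq_K2 cut[OF \<alpha>m]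
          cut[OF strongly_measurable_const] assoc) auto
    then show ?thesis by eventually_elim auto
  qed
  then have "AE (p, q, r) in ?N. \<omega> p q r = 1"
  proof eventually_elim
    case (elim w)
    obtain p q r where w: "w = (p, q, r)" by (cases w)
    have "p \<in> (\<Union>i. V i)" "q \<in> (\<Union>i. V i)" "r \<in> (\<Union>i. V i)" using V(2) by simp_all
    then obtain i j l where "p \<in> V i" "q \<in> V j" "r \<in> V l" by blast
    then obtain n where n: "p \<in> V n" "q \<in> V n" "r \<in> V n"
      using incseqD[OF V(4)] by (metis max.cobounded1 max.cobounded2 subsetD)
    have "star (\<alpha> q k) \<in> closure E" using E(2) by auto
    \<comment> \<open>The tolerance \<open>norm k\<close> suffices: an \<open>e\<close> with
      \<open>e * \<alpha> q k = 0\<close> would be at distance at least \<open>norm k\<close> from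
      \<open>star (\<alpha> q k)\<close>.\<close>
    then obtain e where e: "e \<in> E" "dist e (star (\<alpha> q k)) < norm k"
      using k unfolding closure_approachable by blast
    have "K1 (cut n (\<lambda>p. \<alpha> p e)) (cut n (\<lambda>q. \<alpha> q (star a))) (cut n (\<lambda>_. a)) p q r =
        K2 (cut n (\<lambda>p. \<alpha> p e)) (cut n (\<lambda>q. \<alpha> q (star a))) (cut n (\<lambda>_. a)) p q r"
      using elim e(1) by (simp add: w)
    moreover have "cut n F = (\<lambda>x. indicat_real (V n) x *\<^sub>R F x)" for F
      by (simp add: cut_def fun_eq_iff)
    ultimately have "(indicat_real (V n) p * indicat_real (V n) q * indicat_real (V n) r) *\<^sub>R
          K1 (\<lambda>p. \<alpha> p e) (\<lambda>q. \<alpha> q (star a)) (\<lambda>_. a) p q r =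
        (indicat_real (V n) p * indicat_real (V n) q * indicat_real (V n) r) *\<^sub>R
          K2 (\<lambda>p. \<alpha> p e) (\<lambda>q. \<alpha> q (star a)) (\<lambda>_. a) p q r"
      by (simp only: K1_scaleR K2_scaleR)
    then have eq: "K1 (\<lambda>p. \<alpha> p e) (\<lambda>q. \<alpha> q (star a)) (\<lambda>_. a) p q r =
        \<omega> p q r *\<^sub>C K1 (\<lambda>p. \<alpha> p e) (\<lambda>q. \<alpha> q (star a)) (\<lambda>_. a) p q r"
      unfolding K2_eq[symmetric] using n by (simp only: indicator_simps mult_1 scaleR_one)
    have "K1 (\<lambda>p. \<alpha> p e) (\<lambda>q. \<alpha> q (star a)) (\<lambda>_. a) p q r = (\<alpha> p (e * \<alpha> q k) \<lhd> u p q) \<lhd> u (p + q) r"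
      by (simp add: K1_eq k_def \<alpha>_simps u_simps(6))
    then have norm_K1: "norm (K1 (\<lambda>p. \<alpha> p e) (\<lambda>q. \<alpha> q (star a)) (\<lambda>_. a) p q r) = norm (e * \<alpha> q k)"
      by simp
    have "norm (e * \<alpha> q k) \<noteq> 0"
    proof
      assume "norm (e * \<alpha> q k) = 0"
      then have "star (\<alpha> q k) * \<alpha> q k = (star (\<alpha> q k) - e) * \<alpha> q k"
        by (simp add: left_diff_distrib)
      then have "(norm k)\<^sup>2 \<le> norm (star (\<alpha> q k) - e) * norm k"
        using cstar_identity[of "\<alpha> q k"] norm_mult_ineq[of "star (\<alpha> q k) - e" "\<alpha> q k"] by simp
      also have "\<dots> < norm k * norm k"
        using e(2) k by (intro mult_strict_right_mono) (simp_all add: dist_norm norm_minus_commute)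
      finally show False by (simp add: power2_eq_square)
    qed
    moreover have "(1 - \<omega> p q r) *\<^sub>C K1 (\<lambda>p. \<alpha> p e) (\<lambda>q. \<alpha> q (star a)) (\<lambda>_. a) p q r = 0"
      using eq by (simp add: scaleC_diff_left)
    then have "cmod (1 - \<omega> p q r) * norm (e * \<alpha> q k) = 0"
      by (metis norm_scaleC norm_zero norm_K1)
    ultimately show ?case by (simp add: w)
  qed
  \<comment> \<open>\<open>\<omega>\<close> is continuous in each variable separately, so the
    exceptional null set is unfolded into iterated ones and removed one variable at a time.\<close>
  from triple.AE_pair[OF this] have AE_one: "AE p in M. AE q in M. AE r in M. \<omega> p q r = 1"
  proof eventually_elim
    case (elim p)
    from AE_pair[OF elim] show ?case by simp
  qed
  note char = tricharacter[unfolded antisymmetric_tricharacter_def group_character_def]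
  have cont: "continuous_on UNIV (\<lambda>x. \<omega> x y z)" "continuous_on UNIV (\<lambda>y. \<omega> x y z)"
    "continuous_on UNIV (\<lambda>z. \<omega> x y z)" for x y z
    using char by blast+
  from AE_one have "AE p in M. \<omega> p y z = 1"
  proof eventually_elim
    case (elim p)
    then have "AE q in M. \<omega> p q z = 1"
      by eventually_elim (rule AE_character_one[OF cont(3)])
    then show ?case by (rule AE_character_one[OF cont(2)])
  qed
  then show ?thesis by (rule AE_character_one[OF cont(1)])
qed

end

text \<open>The involution identity carries the condition on \<open>\<phi> x x y\<close> because the
  twist contributes values \<open>\<omega> s s t\<close> to both sides, and antisymmetry makes these
  only \<open>1\<close> or \<open>-1\<close>. In the double integrals \<open>u\<close> stands where
  the convolution puts it, between the factors with \<open>g\<close> and \<open>h\<close>; for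
  central \<open>u\<close> it moves to the end.\<close>

theorem proposition3p1:
  fixes M :: "'g::{topological_group_add,t2_space,second_countable_topology} measure"
    and \<alpha> :: "'g \<Rightarrow> 'a::cstar_algebra \<Rightarrow> 'a"
    and u :: "'g \<Rightarrow> 'g \<Rightarrow> 'a multiplier"
    and \<phi> :: "'g \<Rightarrow> 'g \<Rightarrow> 'g \<Rightarrow> 'a multiplier"
    and \<omega> :: "'g \<Rightarrow> 'g \<Rightarrow> 'g \<Rightarrow> complex"
    and L :: "('g \<Rightarrow> 'a) set"
    and conv :: "('g \<Rightarrow> 'a) \<Rightarrow> ('g \<Rightarrow> 'a) \<Rightarrow> 'g \<Rightarrow> 'a"  (infixl \<open>\<star>\<close> 70)
    and adj :: "('g \<Rightarrow> 'a) \<Rightarrow> 'g \<Rightarrow> 'a"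
  assumes "locally compact (UNIV :: 'g set)"
    and "haar_measure M" and "right_invariant M"
    and "twisted_action \<alpha> u"
    and "associator_of \<alpha> u \<phi>"
    and "antisymmetric_tricharacter \<omega>" and "\<And>x y z. \<phi> x y z = mscalar (\<omega> x y z)"
  defines "L \<equiv> crossed_product M"
    and "conv \<equiv> twisted_conv M \<alpha> u"
    and "adj \<equiv> twisted_adj \<alpha> u"
  shows
    "(\<forall>f\<in>L. \<forall>g\<in>L. f \<star> g \<in> L \<and> adj f \<in> L) \<and>
     ((\<forall>x y. \<phi> x x y = mone) \<longrightarrow>
        (\<forall>f\<in>L. \<forall>g\<in>L. AE x in M. adj (f \<star> g) x = (adj g \<star> adj f) x)) \<and>
     ((\<forall>f\<in>L. \<forall>g\<in>L. \<forall>h\<in>L. AE x in M. ((f \<star> g) \<star> h) x = (f \<star> (g \<star> h)) x) \<longleftrightarrow>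
        (\<forall>x y z. \<phi> x y z = mone)) \<and>
     (\<forall>f\<in>L. \<forall>g\<in>L. \<forall>h\<in>L.
        let P = (\<lambda>x.
          has_strong_integral (M \<Otimes>\<^sub>M M)
            (\<lambda>(z, y). ((f z * \<alpha> z (g (- z + y))) \<lhd> u z (- z + y)) *
                       \<alpha> y (h (- y + x)) \<lhd> u y (- y + x))
            (((f \<star> g) \<star> h) x) \<and>
          has_strong_integral (M \<Otimes>\<^sub>M M)
            (\<lambda>(z, y). ((f z * \<alpha> z (g (- z + y))) \<lhd> (\<phi> z (- z + y) (- y + x) \<odot> u z (- z + y))) *
                       \<alpha> y (h (- y + x)) \<lhd> u y (- y + x))
            ((f \<star> (g \<star> h)) x) \<and>
          ((\<forall>x y. central_multiplier (u x y)) \<longrightarrow>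
            has_strong_integral (M \<Otimes>\<^sub>M M)
              (\<lambda>(z, y). f z * \<alpha> z (g (- z + y)) * \<alpha> y (h (- y + x)) \<lhd>
                         (u z (- z + y) \<odot> u y (- y + x)))
              (((f \<star> g) \<star> h) x) \<and>
            has_strong_integral (M \<Otimes>\<^sub>M M)
              (\<lambda>(z, y). f z * \<alpha> z (g (- z + y)) * \<alpha> y (h (- y + x)) \<lhd>
                         (\<phi> z (- z + y) (- y + x) \<odot> u z (- z + y) \<odot> u y (- y + x)))
              ((f \<star> (g \<star> h)) x)))
        in (AE x in M. P x) \<and>
           (f \<in> cc_functions \<and> g \<in> cc_functions \<and> h \<in> cc_functions \<longrightarrow> (\<forall>x. P x)))"
proof -
  interpret twisted_product M \<alpha> u \<phi> \<omega>
    by unfold_locales (rule assms(1-7))+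
  have L: "f \<in> L \<longleftrightarrow> strongly_integrable M f" for f
    unfolding L_def by (rule crossed_product_iff)
  have conv: "conv = twisted_conv M \<alpha> u" and adj: "adj = twisted_adj \<alpha> u"
    by (rule conv_def[THEN meta_eq_to_obj_eq], rule adj_def[THEN meta_eq_to_obj_eq])
  let ?F1 = "\<lambda>f g h x (z, y). ((f z * \<alpha> z (g (- z + y))) \<lhd> u z (- z + y)) *
      \<alpha> y (h (- y + x)) \<lhd> u y (- y + x)"
    and ?F2 = "\<lambda>f g h x (z, y). ((f z * \<alpha> z (g (- z + y))) \<lhd>
      (\<phi> z (- z + y) (- y + x) \<odot> u z (- z + y))) * \<alpha> y (h (- y + x)) \<lhd> u y (- y + x)"
    and ?C1 = "\<lambda>f g h x (z, y). f z * \<alpha> z (g (- z + y)) * \<alpha> y (h (- y + x)) \<lhd>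
      (u z (- z + y) \<odot> u y (- y + x))"
    and ?C2 = "\<lambda>f g h x (z, y). f z * \<alpha> z (g (- z + y)) * \<alpha> y (h (- y + x)) \<lhd>
      (\<phi> z (- z + y) (- y + x) \<odot> u z (- z + y) \<odot> u y (- y + x))"
  let ?int = "has_strong_integral (M \<Otimes>\<^sub>M M)"
  \<comment> \<open>\<open>Q\<close> is the predicate \<open>P\<close> of the statement with its
    four integrands named.\<close>
  define Q where "Q f g h x \<longleftrightarrow>
      ?int (?F1 f g h x) (((f \<star> g) \<star> h) x) \<and> ?int (?F2 f g h x) ((f \<star> (g \<star> h)) x) \<and>
      ((\<forall>x y. central_multiplier (u x y)) \<longrightarrow>
        ?int (?C1 f g h x) (((f \<star> g) \<star> h) x) \<and> ?int (?C2 f g h x) ((f \<star> (g \<star> h)) x))" for f g h x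
  have Q: "Q f g h x"
    if f: "strongly_integrable M f" and g: "strongly_integrable M g" and h: "strongly_integrable M h"
      and fin: "finite_at f g h x" for f g h x
  proof -
    note I1 = has_strong_integral_K1[OF f g h fin] and I2 = has_strong_integral_K2[OF f g h fin]
    have K1: "(\<lambda>(z, y). K1 f g h z (- z + y) (- y + x)) = ?F1 f g h x"
      unfolding K1_def group_cancel(1) ..
    have K2: "(\<lambda>(z, y). K2 f g h z (- z + y) (- y + x)) = ?F2 f g h x"
      unfolding K2_eq K1_def group_cancel(1)
      by (simp only: mtimes_apply phi mscalar_apply u_simps(4) scaleC_mult_left)
    \<comment> \<open>A central \<open>u z w\<close> slides past \<open>b\<close>, which brings both
      factors of \<open>u\<close> to the end of the integrand.\<close>
    have central: "((a \<lhd> u z w) * b) \<lhd> u y v = (a * b \<lhd> u z w) \<lhd> u y v"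
      if "\<forall>x y. central_multiplier (u x y)" for a b z w y v
    proof -
      have "(a \<lhd> u z w) * b = a * (u z w \<rhd> b)" by (rule u_simps(7)[symmetric])
      also have "u z w \<rhd> b = b \<lhd> u z w"
        using that by (intro central_multiplier_commute) blast
      also have "a * (b \<lhd> u z w) = a * b \<lhd> u z w" by (rule u_simps(6)[symmetric])
      finally show ?thesis by (rule arg_cong)
    qed
    have C: "?F1 f g h x = ?C1 f g h x" "?F2 f g h x = ?C2 f g h x"
      if "\<forall>x y. central_multiplier (u x y)"
      by (simp_all only: mtimes_apply central[OF that] phi mscalar_apply scaleC_mult_left)
    show ?thesis
      unfolding Q_def conv
    proof (intro conjI impI)
      assume c: "\<forall>x y. central_multiplier (u x y)"
      show "?int (?C1 f g h x) (((f \<diamondop> g) \<diamondop> h) x)"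
        by (subst C(1)[OF c, symmetric], subst K1[symmetric], rule I1)
      show "?int (?C2 f g h x) ((f \<diamondop> (g \<diamondop> h)) x)"
        by (subst C(2)[OF c, symmetric], subst K2[symmetric], rule I2)
    qed (subst K1[symmetric], rule I1, subst K2[symmetric], rule I2)
  qed
  have AE_Q: "AE x in M. Q f g h x"
    if "strongly_integrable M f" "strongly_integrable M g" "strongly_integrable M h" for f g h
    using triple_finite(2)[OF that] by eventually_elim (rule Q[OF that])
  have phi_one: "(\<forall>x y z. \<phi> x y z = mone)"
    if assoc: "\<And>f g h. strongly_integrable M f \<Longrightarrow> strongly_integrable M g \<Longrightarrow>
      strongly_integrable M h \<Longrightarrow> AE x in M. ((f \<star> g) \<star> h) x = (f \<star> (g \<star> h)) x"
  \<comment> \<open>In the zero algebra every scalar multiplier is \<open>mone\<close>, although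
    \<open>\<omega>\<close> may be nontrivial.\<close>
  proof (cases "\<forall>a::'a. a = 0")
    case False
    then obtain a :: 'a where "a \<noteq> 0" by blast
    then have "\<omega> x y z = 1" for x y z by (rule \<omega>_eq_one[OF _ assoc[unfolded conv]])
    then show ?thesis by (simp add: phi mscalar_eq_mone_iff)
  qed (simp add: phi mscalar_eq_mone_iff)
  have assoc: "AE x in M. ((f \<star> g) \<star> h) x = (f \<star> (g \<star> h)) x"
    if "\<forall>x y z. \<phi> x y z = mone"
      and "strongly_integrable M f" "strongly_integrable M g" "strongly_integrable M h" for f g h
    using AE_Q[OF that(2-4)]
  proof eventually_elim
    case (elim x)
    note I = elim[unfolded Q_def]
    have "?int (?F1 f g h x) ((f \<star> (g \<star> h)) x)"
      using conjunct1[OF conjunct2[OF I]] by (simp only: that(1)[rule_format] mtimes_apply mone_apply)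
    with conjunct1[OF I] show ?case by (rule has_strong_integral_unique)
  qed
  have star: "AE x in M. adj (f \<star> g) x = (adj g \<star> adj f) x"
    if one: "\<forall>x y. \<phi> x x y = mone" and f: "strongly_integrable M f" and g: "strongly_integrable M g" for f g
  proof (cases "\<forall>a::'a. a = 0")
    case True
    have eq: "a = b" for a b :: 'a
      using True[rule_format, of a] True[rule_format, of b] by (rule trans[OF _ sym])
    show ?thesis by (intro AE_I2 eq)
  next
    case False
    then have "\<omega> s s t = 1" for s t
      using one[rule_format, of s t] by (simp only: phi mscalar_eq_mone_iff simp_thms)
    from adj_conv[OF this f g] show ?thesis unfolding conv adj .
  qed
  have closed: "\<forall>f\<in>L. \<forall>g\<in>L. f \<star> g \<in> L \<and> adj f \<in> L"
    by (simp add: L conv adj strongly_integrable_conv strongly_integrable_adj)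
  have involution: "(\<forall>x y. \<phi> x x y = mone) \<longrightarrow>
      (\<forall>f\<in>L. \<forall>g\<in>L. AE x in M. adj (f \<star> g) x = (adj g \<star> adj f) x)"
    by (intro impI ballI star) (assumption | simp only: L)+
  have associative: "(\<forall>f\<in>L. \<forall>g\<in>L. \<forall>h\<in>L. AE x in M. ((f \<star> g) \<star> h) x = (f \<star> (g \<star> h)) x) \<longleftrightarrow>
      (\<forall>x y z. \<phi> x y z = mone)"
  proof
    assume "\<forall>f\<in>L. \<forall>g\<in>L. \<forall>h\<in>L. AE x in M. ((f \<star> g) \<star> h) x = (f \<star> (g \<star> h)) x"
    then show "\<forall>x y z. \<phi> x y z = mone" by (intro phi_one) (simp only: L Ball_def)
  next
    assume "\<forall>x y z. \<phi> x y z = mone"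
    then show "\<forall>f\<in>L. \<forall>g\<in>L. \<forall>h\<in>L. AE x in M. ((f \<star> g) \<star> h) x = (f \<star> (g \<star> h)) x"
      by (intro ballI assoc) (assumption | simp only: L)+
  qed
  have products: "\<forall>f\<in>L. \<forall>g\<in>L. \<forall>h\<in>L. (AE x in M. Q f g h x) \<and>
      (f \<in> cc_functions \<and> g \<in> cc_functions \<and> h \<in> cc_functions \<longrightarrow> (\<forall>x. Q f g h x))"
    by (intro ballI conjI impI allI AE_Q Q finite_at_cc_functions) (simp_all only: L)
  show ?thesis
    unfolding Q_def[symmetric] Let_def
    by (intro conjI closed involution associative products)
qed

end
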